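(* Let $(M^n,g)$ be a semi-Riemannian manifold of signature $(r,s)$, $g=\langle\cdot,\cdot\rangle$, and let $\kappa\in\mathbb{R}$. Let $A$ be a field of symmetric endomorphisms of $TM$ satisfying the equations of Gauss and Codazzi-Mainardi: $$(\nabla^M_XA)Y=(\nabla^M_YA)X,$$ $$R^M(X,Y)Z=\langle A(Y),Z\rangle A(X)-\langle A(X),Z\rangle A(Y)+\kappa\,(\langle Y,Z\rangle X-\langle X,Z\rangle Y)$$ for all $X,Y,Z\in T_pM$, $p\in M$. Then for every point $p\in M$, for every $q\in\mathbb{M}_\kappa^{r+1,s}$, and for every linear isometric embedding $F:T_pM\to T_q\mathbb{M}_\kappa^{r+1,s}$ there exist a neighborhood $U$ of $p$ in $M$ and an isometric embedding $f:U\to\mathbb{M}_\kappa^{r+1,s}$ as a semi-Riemannian hypersurface with Weingarten map $A$, such that $f(p)=q$ and $df(p)=F$. Moreover, any two such local embeddings $f_1$ and $f_2$ must agree in a neighborhood of $p$ if $f_1(p)=f_2(p)=:q$ and $df_1(p)=df_2(p):T_pM\to T_q\mathbb{M}_\kappa^{r+1,s}$.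
   Context: $\nabla^M$ is the Levi-Civita connection of $(M,g)$ and $R^M(X,Y)Z=\nabla^M_X\nabla^M_YZ-\nabla^M_Y\nabla^M_XZ-\nabla^M_{[X,Y]}Z$ its curvature tensor. The Weingarten map $W$ of a semi-Riemannian hypersurface with respect to a unit spacelike normal field $\nu$ ($\langle\nu,\nu\rangle=+1$) is given by $W(X)=-\nabla_X\nu$, where $\nabla$ is the Levi-Civita connection of the ambient space; for an embedding $f$ it is regarded as an endomorphism field on $TM$ via $df$. Model spaces. For signature $(p,s)$ with $N=p+s$, let $g_{p,s}=\langle\cdot,\cdot\rangle_{p,s}=(dx^1)^2+\dots+(dx^p)^2-(dx^{p+1})^2-\dots-(dx^N)^2$ on $\mathbb{R}^N$. Then $\mathbb{M}_0^{p,s}=(\mathbb{R}^N,g_{p,s})$. For $\kappa>0$, $\mathbb{M}_\kappa^{p,s}$ is the semi-Riemannian hypersurface of $(\mathbb{R}^{N+1},g_{p+1,s})$ defined by $\langle x,x\rangle_{p+1,s}=1/\kappa$, and in addition $x^1>0$ if $p=0$. For $\kappa<0$, $\mathbb{M}_\kappa^{p,s}$ is the semi-Riemannian hypersurface of $(\mathbb{R}^{N+1},g_{p,s+1})$ defined by $\langle x,x\rangle_{p,s+1}=1/\kappa$, and in addition $x^{N+1}>0$ if $s=0$. Each is connected, homogeneous and of constant sectional curvature $\kappa$. Here they are used with $p=r+1$.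
   Formalization: In the uniqueness part the two embeddings are also required to have the same unit normal at p; without this it fails, e.g. for a piece of the unit sphere and its reflection in a tangent plane, both with A = Id; the dimension n is at least 1. *)

theory Defs
  imports "HOL-Analysis.Analysis" "HOL-Library.Function_Algebras"
begin

section \<open>Smooth maps between Euclidean spaces\<close>

primrec Ck_on :: "nat \<Rightarrow> 'e::euclidean_space set \<Rightarrow> ('e \<Rightarrow> 'f::euclidean_space) \<Rightarrow> bool" where
  "Ck_on 0 S h \<longleftrightarrow> continuous_on S h"
| "Ck_on (Suc k) S h \<longleftrightarrow> (\<forall>x\<in>S. h differentiable (at x)) \<and>
     (\<forall>v. Ck_on k S (\<lambda>x. frechet_derivative h (at x) v))"

text \<open>Only used for open \<open>S\<close>.\<close>

definition smooth_on :: "'e::euclidean_space set \<Rightarrow> ('e \<Rightarrow> 'f::euclidean_space) \<Rightarrow> bool" where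
  "smooth_on S h \<longleftrightarrow> (\<forall>k. Ck_on k S h)"


section \<open>Smooth manifolds\<close>

text \<open>A chart is a pair of its domain and its coordinate map; the values of the coordinate map
  outside the domain are irrelevant.  A smooth structure is given by any (not necessarily maximal)
  atlas.  The dimension is \<open>DIM('e)\<close>.\<close>

type_synonym ('a, 'e) chart = "'a set \<times> ('a \<Rightarrow> 'e)"

abbreviation chart_inv :: "('a, 'e) chart \<Rightarrow> 'e \<Rightarrow> 'a" where
  "chart_inv c \<equiv> inv_into (fst c) (snd c)"

definition smooth_manifold :: "'a topology \<Rightarrow> ('a, 'e::euclidean_space) chart set \<Rightarrow> bool" where
  "smooth_manifold M \<A> \<longleftrightarrow>
     Hausdorff_space M \<and> second_countable M \<and>
     topspace M = (\<Union>c\<in>\<A>. fst c) \<and>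
     (\<forall>c\<in>\<A>. openin M (fst c) \<and> open (snd c ` fst c) \<and>
        homeomorphic_map (subtopology M (fst c)) (top_of_set (snd c ` fst c)) (snd c)) \<and>
     (\<forall>c\<in>\<A>. \<forall>d\<in>\<A>. smooth_on (snd c ` (fst c \<inter> fst d)) (\<lambda>y. snd d (chart_inv c y)))"

text \<open>A tangent vector at \<open>p\<close> is the family of its coordinate representations in the charts
  around \<open>p\<close>, related by the differentials of the coordinate changes (and padded by \<open>0\<close>
  at all other charts, so that tangent vectors have a unique representation).\<close>

type_synonym ('a, 'e) tvec = "('a, 'e) chart \<Rightarrow> 'e"

definition charts_at :: "('a, 'e) chart set \<Rightarrow> 'a \<Rightarrow> ('a, 'e) chart set" where
  "charts_at \<A> p = {c \<in> \<A>. p \<in> fst c}"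

definition tangent_space ::
    "('a, 'e::euclidean_space) chart set \<Rightarrow> 'a \<Rightarrow> ('a, 'e) tvec set" where
  "tangent_space \<A> p = {v.
     (\<forall>c\<in>charts_at \<A> p. \<forall>d\<in>charts_at \<A> p.
        v d = frechet_derivative (\<lambda>y. snd d (chart_inv c y)) (at (snd c p)) (v c)) \<and>
     (\<forall>c. c \<notin> charts_at \<A> p \<longrightarrow> v c = 0)}"

definition tscale :: "real \<Rightarrow> ('a, 'e::real_vector) tvec \<Rightarrow> ('a, 'e) tvec" where
  "tscale a v = (\<lambda>c. a *\<^sub>R v c)"

text \<open>The derivative \<open>v(h)\<close> of a vector valued function \<open>h\<close> in the direction of the tangent
  vector \<open>v\<close> at \<open>p\<close>; by the chain rule it does not depend on the choice of the chart.\<close>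

definition dir_deriv ::
    "('a, 'e::euclidean_space) chart set \<Rightarrow> 'a \<Rightarrow> ('a, 'e) tvec \<Rightarrow> ('a \<Rightarrow> 'f::euclidean_space) \<Rightarrow> 'f" where
  "dir_deriv \<A> p v h =
     (let c = (SOME c. c \<in> charts_at \<A> p)
      in frechet_derivative (\<lambda>y. h (chart_inv c y)) (at (snd c p)) (v c))"

definition smooth_fun ::
    "('a, 'e::euclidean_space) chart set \<Rightarrow> 'a set \<Rightarrow> ('a \<Rightarrow> 'f::euclidean_space) \<Rightarrow> bool" where
  "smooth_fun \<A> U h \<longleftrightarrow> (\<forall>c\<in>\<A>. smooth_on (snd c ` (U \<inter> fst c)) (\<lambda>y. h (chart_inv c y)))"

definition smooth_field ::
    "('a, 'e::euclidean_space) chart set \<Rightarrow> 'a set \<Rightarrow> ('a \<Rightarrow> ('a, 'e) tvec) \<Rightarrow> bool" where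
  "smooth_field \<A> U X \<longleftrightarrow>
     (\<forall>x\<in>U. X x \<in> tangent_space \<A> x) \<and>
     (\<forall>c\<in>\<A>. smooth_on (snd c ` (U \<inter> fst c)) (\<lambda>y. X (chart_inv c y) c))"

text \<open>In each chart, \<open>[X,Y]\<^sup>k = X(Y\<^sup>k) - Y(X\<^sup>k)\<close>.\<close>

definition lie_bracket ::
    "('a, 'e::euclidean_space) chart set \<Rightarrow> ('a \<Rightarrow> ('a, 'e) tvec) \<Rightarrow> ('a \<Rightarrow> ('a, 'e) tvec) \<Rightarrow>
     'a \<Rightarrow> ('a, 'e) tvec" where
  "lie_bracket \<A> X Y p = (\<lambda>c. if c \<in> charts_at \<A> p
     then dir_deriv \<A> p (X p) (\<lambda>x. Y x c) - dir_deriv \<A> p (Y p) (\<lambda>x. X x c) else 0)"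

definition differential ::
    "('a, 'e::euclidean_space) chart set \<Rightarrow> ('b, 'h::euclidean_space) chart set \<Rightarrow> ('a \<Rightarrow> 'b) \<Rightarrow>
     'a \<Rightarrow> ('a, 'e) tvec \<Rightarrow> ('b, 'h) tvec" where
  "differential \<A> \<B> f p v = (\<lambda>d. if d \<in> charts_at \<B> (f p)
     then dir_deriv \<A> p v (\<lambda>x. snd d (f x)) else 0)"

definition smooth_map ::
    "'a topology \<Rightarrow> ('a, 'e::euclidean_space) chart set \<Rightarrow>
     'b topology \<Rightarrow> ('b, 'h::euclidean_space) chart set \<Rightarrow> 'a set \<Rightarrow> ('a \<Rightarrow> 'b) \<Rightarrow> bool" where
  "smooth_map M \<A> N \<B> U f \<longleftrightarrow>
     continuous_map (subtopology M U) N f \<and>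
     (\<forall>c\<in>\<A>. \<forall>d\<in>\<B>. smooth_on (snd c ` {x \<in> U \<inter> fst c. f x \<in> fst d})
        (\<lambda>y. snd d (f (chart_inv c y))))"

definition smooth_embedding ::
    "'a topology \<Rightarrow> ('a, 'e::euclidean_space) chart set \<Rightarrow>
     'b topology \<Rightarrow> ('b, 'h::euclidean_space) chart set \<Rightarrow> 'a set \<Rightarrow> ('a \<Rightarrow> 'b) \<Rightarrow> bool" where
  "smooth_embedding M \<A> N \<B> U f \<longleftrightarrow>
     smooth_map M \<A> N \<B> U f \<and> embedding_map (subtopology M U) N f \<and>
     (\<forall>x\<in>U. inj_on (differential \<A> \<B> f x) (tangent_space \<A> x))"


section \<open>Semi-Riemannian metrics\<close>

definition tangent_linear ::
    "('a, 'e::euclidean_space) chart set \<Rightarrow> 'a \<Rightarrow> ('b, 'h::euclidean_space) chart set \<Rightarrow> 'b \<Rightarrow>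
     (('a, 'e) tvec \<Rightarrow> ('b, 'h) tvec) \<Rightarrow> bool" where
  "tangent_linear \<A> p \<B> q F \<longleftrightarrow>
     (\<forall>u\<in>tangent_space \<A> p. F u \<in> tangent_space \<B> q) \<and>
     (\<forall>u\<in>tangent_space \<A> p. \<forall>v\<in>tangent_space \<A> p. F (u + v) = F u + F v) \<and>
     (\<forall>a. \<forall>u\<in>tangent_space \<A> p. F (tscale a u) = tscale a (F u))"

type_synonym ('a, 'e) metric = "'a \<Rightarrow> ('a, 'e) tvec \<Rightarrow> ('a, 'e) tvec \<Rightarrow> real"

text \<open>Signature \<open>(r, s)\<close>: \<open>r\<close> positive and \<open>s\<close> negative directions.  The vectors \<open>e i\<close> below are
  automatically linearly independent, hence form a basis of the \<open>(r + s)\<close>-dimensional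
  tangent space.\<close>

definition semi_riemannian_metric ::
    "'a topology \<Rightarrow> ('a, 'e::euclidean_space) chart set \<Rightarrow> nat \<Rightarrow> nat \<Rightarrow> ('a, 'e) metric \<Rightarrow> bool" where
  "semi_riemannian_metric M \<A> r s g \<longleftrightarrow>
     DIM('e) = r + s \<and>
     (\<forall>p\<in>topspace M.
        (\<forall>u\<in>tangent_space \<A> p. \<forall>v\<in>tangent_space \<A> p. g p u v = g p v u) \<and>
        (\<forall>u\<in>tangent_space \<A> p. \<forall>v\<in>tangent_space \<A> p. \<forall>w\<in>tangent_space \<A> p.
           g p (u + v) w = g p u w + g p v w) \<and>
        (\<forall>a. \<forall>u\<in>tangent_space \<A> p. \<forall>v\<in>tangent_space \<A> p. g p (tscale a u) v = a * g p u v) \<and>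
        (\<exists>e. (\<forall>i\<in>{1..r + s}. e i \<in> tangent_space \<A> p) \<and>
             (\<forall>i\<in>{1..r + s}. \<forall>j\<in>{1..r + s}.
                g p (e i) (e j) = (if i \<noteq> j then 0 else if i \<le> r then 1 else - 1)))) \<and>
     (\<forall>U X Y. openin M U \<longrightarrow> smooth_field \<A> U X \<longrightarrow> smooth_field \<A> U Y \<longrightarrow>
        smooth_fun \<A> U (\<lambda>x. g x (X x) (Y x)))"

definition symmetric_endomorphism_field ::
    "'a topology \<Rightarrow> ('a, 'e::euclidean_space) chart set \<Rightarrow> ('a, 'e) metric \<Rightarrow>
     ('a \<Rightarrow> ('a, 'e) tvec \<Rightarrow> ('a, 'e) tvec) \<Rightarrow> bool" where
  "symmetric_endomorphism_field M \<A> g A \<longleftrightarrow>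
     (\<forall>p\<in>topspace M. tangent_linear \<A> p \<A> p (A p) \<and>
        (\<forall>u\<in>tangent_space \<A> p. \<forall>v\<in>tangent_space \<A> p. g p (A p u) v = g p u (A p v))) \<and>
     (\<forall>U X. openin M U \<longrightarrow> smooth_field \<A> U X \<longrightarrow> smooth_field \<A> U (\<lambda>x. A x (X x)))"

definition linear_isometric_embedding ::
    "('a, 'e::euclidean_space) chart set \<Rightarrow> ('a, 'e) metric \<Rightarrow> 'a \<Rightarrow>
     ('b, 'h::euclidean_space) chart set \<Rightarrow> ('b, 'h) metric \<Rightarrow> 'b \<Rightarrow>
     (('a, 'e) tvec \<Rightarrow> ('b, 'h) tvec) \<Rightarrow> bool" where
  "linear_isometric_embedding \<A> g p \<B> h q F \<longleftrightarrow>
     tangent_linear \<A> p \<B> q F \<and> inj_on F (tangent_space \<A> p) \<and>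
     (\<forall>u\<in>tangent_space \<A> p. \<forall>v\<in>tangent_space \<A> p. h q (F u) (F v) = g p u v)"


section \<open>Connections and curvature\<close>

text \<open>\<open>D p v Y\<close> stands for \<open>\<nabla>\<^sub>v Y\<close>, where \<open>v\<close> is a tangent vector at \<open>p\<close> and \<open>Y\<close> is a vector
  field that is smooth on some open neighbourhood of \<open>p\<close>.  That \<open>D p v Y\<close> depends only on the
  germ of \<open>Y\<close> at \<open>p\<close> follows from the Leibniz rule applied to the indicator function of a
  neighbourhood of \<open>p\<close>.\<close>

type_synonym ('a, 'e) connection = "'a \<Rightarrow> ('a, 'e) tvec \<Rightarrow> ('a \<Rightarrow> ('a, 'e) tvec) \<Rightarrow> ('a, 'e) tvec"

definition affine_connection ::
    "'a topology \<Rightarrow> ('a, 'e::euclidean_space) chart set \<Rightarrow> ('a, 'e) connection \<Rightarrow> bool" where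
  "affine_connection M \<A> D \<longleftrightarrow>
     (\<forall>U Y. openin M U \<longrightarrow> smooth_field \<A> U Y \<longrightarrow>
        (\<forall>p\<in>U. tangent_linear \<A> p \<A> p (\<lambda>v. D p v Y)) \<and>
        (\<forall>X. smooth_field \<A> U X \<longrightarrow> smooth_field \<A> U (\<lambda>p. D p (X p) Y)) \<and>
        (\<forall>Z. smooth_field \<A> U Z \<longrightarrow>
           (\<forall>p\<in>U. \<forall>v\<in>tangent_space \<A> p. D p v (\<lambda>x. Y x + Z x) = D p v Y + D p v Z)) \<and>
        (\<forall>h. smooth_fun \<A> U h \<longrightarrow>
           (\<forall>p\<in>U. \<forall>v\<in>tangent_space \<A> p.
              D p v (\<lambda>x. tscale (h x) (Y x)) = tscale (dir_deriv \<A> p v h) (Y p) + tscale (h p) (D p v Y))))"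

definition levi_civita_connection ::
    "'a topology \<Rightarrow> ('a, 'e::euclidean_space) chart set \<Rightarrow> ('a, 'e) metric \<Rightarrow> ('a, 'e) connection \<Rightarrow> bool" where
  "levi_civita_connection M \<A> g D \<longleftrightarrow>
     affine_connection M \<A> D \<and>
     (\<forall>U X Y. openin M U \<longrightarrow> smooth_field \<A> U X \<longrightarrow> smooth_field \<A> U Y \<longrightarrow>
        (\<forall>p\<in>U. D p (X p) Y - D p (Y p) X = lie_bracket \<A> X Y p) \<and>
        (\<forall>p\<in>U. \<forall>v\<in>tangent_space \<A> p.
           dir_deriv \<A> p v (\<lambda>x. g x (X x) (Y x)) = g p (D p v X) (Y p) + g p (X p) (D p v Y)))"

definition curvature ::
    "('a, 'e::euclidean_space) chart set \<Rightarrow> ('a, 'e) connection \<Rightarrow>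
     ('a \<Rightarrow> ('a, 'e) tvec) \<Rightarrow> ('a \<Rightarrow> ('a, 'e) tvec) \<Rightarrow> ('a \<Rightarrow> ('a, 'e) tvec) \<Rightarrow> 'a \<Rightarrow> ('a, 'e) tvec" where
  "curvature \<A> D X Y Z p =
     D p (X p) (\<lambda>x. D x (Y x) Z) - D p (Y p) (\<lambda>x. D x (X x) Z) - D p (lie_bracket \<A> X Y p) Z"

text \<open>\<open>(\<nabla>\<^sub>X A) Y = \<nabla>\<^sub>X (A Y) - A (\<nabla>\<^sub>X Y)\<close>\<close>

definition cov_deriv_endo ::
    "('a, 'e::euclidean_space) connection \<Rightarrow> ('a \<Rightarrow> ('a, 'e) tvec \<Rightarrow> ('a, 'e) tvec) \<Rightarrow>
     ('a \<Rightarrow> ('a, 'e) tvec) \<Rightarrow> ('a \<Rightarrow> ('a, 'e) tvec) \<Rightarrow> 'a \<Rightarrow> ('a, 'e) tvec" where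
  "cov_deriv_endo D A X Y p = D p (X p) (\<lambda>x. A x (Y x)) - A p (D p (X p) Y)"

text \<open>Both sides of the following equations are tensorial and every tangent vector extends to a
  smooth field on a neighbourhood, so quantifying over local vector fields is the same as quantifying
  over tangent vectors.\<close>

definition codazzi_mainardi_equation ::
    "'a topology \<Rightarrow> ('a, 'e::euclidean_space) chart set \<Rightarrow> ('a, 'e) connection \<Rightarrow>
     ('a \<Rightarrow> ('a, 'e) tvec \<Rightarrow> ('a, 'e) tvec) \<Rightarrow> bool" where
  "codazzi_mainardi_equation M \<A> D A \<longleftrightarrow>
     (\<forall>U X Y. openin M U \<longrightarrow> smooth_field \<A> U X \<longrightarrow> smooth_field \<A> U Y \<longrightarrow>
        (\<forall>p\<in>U. cov_deriv_endo D A X Y p = cov_deriv_endo D A Y X p))"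

definition gauss_equation ::
    "'a topology \<Rightarrow> ('a, 'e::euclidean_space) chart set \<Rightarrow> ('a, 'e) metric \<Rightarrow> ('a, 'e) connection \<Rightarrow>
     real \<Rightarrow> ('a \<Rightarrow> ('a, 'e) tvec \<Rightarrow> ('a, 'e) tvec) \<Rightarrow> bool" where
  "gauss_equation M \<A> g D \<kappa> A \<longleftrightarrow>
     (\<forall>U X Y Z. openin M U \<longrightarrow> smooth_field \<A> U X \<longrightarrow> smooth_field \<A> U Y \<longrightarrow> smooth_field \<A> U Z \<longrightarrow>
        (\<forall>p\<in>U. curvature \<A> D X Y Z p =
           tscale (g p (A p (Y p)) (Z p)) (A p (X p)) - tscale (g p (A p (X p)) (Z p)) (A p (Y p))
           + tscale \<kappa> (tscale (g p (Y p) (Z p)) (X p) - tscale (g p (X p) (Z p)) (Y p))))"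


section \<open>Hypersurfaces and the Weingarten map\<close>

text \<open>\<open>\<nu> x\<close> is the unit spacelike normal at the point \<open>f x\<close> of the hypersurface \<open>f(U)\<close>.  It is smooth if
  it extends locally to smooth vector fields on the ambient manifold, and \<open>\<nabla>\<^sub>w \<nu>\<close>, for \<open>w\<close>
  tangent to the hypersurface, is \<open>\<nabla>\<^sub>w E\<close> for any such extension \<open>E\<close>.  The last
  condition says that \<open>W(w) = - \<nabla>\<^sub>w \<nu>\<close> corresponds to \<open>A\<close> under \<open>df\<close>.\<close>

definition extends_along ::
    "'b topology \<Rightarrow> ('b, 'h::euclidean_space) chart set \<Rightarrow> 'a set \<Rightarrow> ('a \<Rightarrow> 'b) \<Rightarrow> ('a \<Rightarrow> ('b, 'h) tvec) \<Rightarrow>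
     'b set \<Rightarrow> ('b \<Rightarrow> ('b, 'h) tvec) \<Rightarrow> bool" where
  "extends_along N \<B> U f \<nu> V E \<longleftrightarrow>
     openin N V \<and> smooth_field \<B> V E \<and> (\<forall>y\<in>U. f y \<in> V \<longrightarrow> E (f y) = \<nu> y)"

definition hypersurface_with_weingarten_map ::
    "'a topology \<Rightarrow> ('a, 'e::euclidean_space) chart set \<Rightarrow> ('a, 'e) metric \<Rightarrow>
     'b topology \<Rightarrow> ('b, 'h::euclidean_space) chart set \<Rightarrow> ('b, 'h) metric \<Rightarrow> ('b, 'h) connection \<Rightarrow>
     ('a \<Rightarrow> ('a, 'e) tvec \<Rightarrow> ('a, 'e) tvec) \<Rightarrow> 'a set \<Rightarrow> ('a \<Rightarrow> 'b) \<Rightarrow> ('a \<Rightarrow> ('b, 'h) tvec) \<Rightarrow> bool" where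
  "hypersurface_with_weingarten_map M \<A> g N \<B> h D A U f \<nu> \<longleftrightarrow>
     DIM('h) = DIM('e) + 1 \<and>
     smooth_embedding M \<A> N \<B> U f \<and>
     (\<forall>x\<in>U. linear_isometric_embedding \<A> g x \<B> h (f x) (differential \<A> \<B> f x)) \<and>
     (\<forall>x\<in>U. \<nu> x \<in> tangent_space \<B> (f x) \<and> h (f x) (\<nu> x) (\<nu> x) = 1 \<and>
        (\<forall>v\<in>tangent_space \<A> x. h (f x) (\<nu> x) (differential \<A> \<B> f x v) = 0)) \<and>
     (\<forall>x\<in>U. \<exists>V E. f x \<in> V \<and> extends_along N \<B> U f \<nu> V E) \<and>
     (\<forall>x\<in>U. \<forall>V E. f x \<in> V \<longrightarrow> extends_along N \<B> U f \<nu> V E \<longrightarrow>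
        (\<forall>v\<in>tangent_space \<A> x.
           differential \<A> \<B> f x (A x v) = - D (f x) (differential \<A> \<B> f x v) E))"


section \<open>The model spaces\<close>

text \<open>The coordinates \<open>x\<^sup>1, \<dots>, x\<^sup>m\<close> on an \<open>m\<close>-dimensional Euclidean space, with respect to some
  fixed enumeration of its standard basis.\<close>

definition coord :: "nat \<Rightarrow> 'v::euclidean_space \<Rightarrow> real" where
  "coord i x = x \<bullet> (SOME b. bij_betw b {1..DIM('v)} (Basis :: 'v set)) i"

definition pseudo_inner :: "nat \<Rightarrow> nat \<Rightarrow> 'v::euclidean_space \<Rightarrow> 'v \<Rightarrow> real" where
  "pseudo_inner p s x y =
     (\<Sum>i\<in>{1..p}. coord i x * coord i y) - (\<Sum>i\<in>{p + 1..p + s}. coord i x * coord i y)"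

text \<open>The dimension of the vector space in which the model space is defined.\<close>

definition model_ambient_dim :: "real \<Rightarrow> nat \<Rightarrow> nat \<Rightarrow> nat" where
  "model_ambient_dim \<kappa> p s = (if \<kappa> = 0 then p + s else p + s + 1)"

definition model_inner :: "real \<Rightarrow> nat \<Rightarrow> nat \<Rightarrow> 'v::euclidean_space \<Rightarrow> 'v \<Rightarrow> real" where
  "model_inner \<kappa> p s =
     (if \<kappa> = 0 then pseudo_inner p s
      else if \<kappa> > 0 then pseudo_inner (p + 1) s
      else pseudo_inner p (s + 1))"

definition model_space :: "real \<Rightarrow> nat \<Rightarrow> nat \<Rightarrow> 'v::euclidean_space set" where
  "model_space \<kappa> p s =
     (if \<kappa> = 0 then UNIV
      else if \<kappa> > 0 then {x. model_inner \<kappa> p s x x = 1 / \<kappa> \<and> (p = 0 \<longrightarrow> coord 1 x > 0)}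
      else {x. model_inner \<kappa> p s x x = 1 / \<kappa> \<and> (s = 0 \<longrightarrow> coord (p + s + 1) x > 0)})"

text \<open>The smooth structure of an embedded submanifold \<open>S\<close> of a Euclidean space: its charts are the
  inverses of the regular parametrizations of open subsets of \<open>S\<close>.\<close>

definition submanifold_atlas :: "'v::euclidean_space set \<Rightarrow> ('v, 'h::euclidean_space) chart set" where
  "submanifold_atlas S = {c.
     openin (top_of_set S) (fst c) \<and> open (snd c ` fst c) \<and>
     homeomorphic_map (top_of_set (fst c)) (top_of_set (snd c ` fst c)) (snd c) \<and>
     smooth_on (snd c ` fst c) (chart_inv c) \<and>
     (\<forall>y\<in>snd c ` fst c. inj (frechet_derivative (chart_inv c) (at y)))}"

abbreviation model_top :: "real \<Rightarrow> nat \<Rightarrow> nat \<Rightarrow> 'v::euclidean_space topology" where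
  "model_top \<kappa> p s \<equiv> top_of_set (model_space \<kappa> p s)"

abbreviation model_atlas :: "real \<Rightarrow> nat \<Rightarrow> nat \<Rightarrow> ('v::euclidean_space, 'h::euclidean_space) chart set" where
  "model_atlas \<kappa> p s \<equiv> submanifold_atlas (model_space \<kappa> p s)"

text \<open>The induced metric; \<open>dir_deriv \<B> q v (\<lambda>x. x)\<close> is the image of \<open>v\<close> under the differential
  of the inclusion into the ambient vector space.\<close>

definition model_metric :: "real \<Rightarrow> nat \<Rightarrow> nat \<Rightarrow> ('v::euclidean_space, 'h::euclidean_space) metric" where
  "model_metric \<kappa> p s q v w = model_inner \<kappa> p s
     (dir_deriv (model_atlas \<kappa> p s) q v (\<lambda>x. x)) (dir_deriv (model_atlas \<kappa> p s) q w (\<lambda>x. x))"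

end

theory Submission
  imports Defs
begin

text \<open>The model space is, locally, the quadric \<open>\<langle>x,x\<rangle> = 1/\<kappa>\<close> in a pseudo-Euclidean vector space (all of it if
\<open>\<kappa> = 0\<close>).  A hypersurface \<open>f\<close> with unit normal \<open>\<nu>\<close> is encoded by the linear maps
\<open>\<Phi>\<^sub>x (a, w, b) = a f(x) + df\<^sub>x(w) + b \<nu>(x)\<close> from \<open>\<real> \<oplus> T\<^sub>xM \<oplus> \<real>\<close> into that vector space.  The formulas of Gauss and
Weingarten say precisely that \<open>d\<Phi> = \<Phi> \<circ> \<theta>\<close>, where the connection form
  \<open>\<theta>(w)(a, z, b) = (- \<kappa> \<langle>w, z\<rangle>, a w + \<Gamma>(w, z) - b A w, \<langle>A w, z\<rangle>)\<close>
involves only the intrinsic data \<open>g\<close>, \<open>\<nabla>\<close>, \<open>A\<close>, \<open>\<kappa>\<close>, and the equations of Gauss and Codazzi-Mainardi (with the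
symmetry of \<open>A\<close>) say that \<open>\<theta>\<close> is flat (lemma \<open>flat_conn_form\<close>).

Existence: a flat linear system has local solutions with arbitrary initial value (\<open>flat_system_solution\<close>).  The
form \<open>aa'/\<kappa> + \<langle>z, z'\<rangle> + bb'\<close> is parallel for \<open>\<theta>\<close>, so \<open>\<Phi>\<close> stays isometric if it is so at the
initial point (\<open>parallel_frame_isometric\<close>); then \<open>f = \<Phi>(1, 0, 0)\<close> is an isometric immersion into the quadric with
differential \<open>\<Phi>(0, \<cdot>, 0)\<close>, unit normal \<open>\<Phi>(0, 0, 1)\<close> and Weingarten map \<open>A\<close>.  If \<open>\<kappa> = 0\<close>, the
summand \<open>aa'/\<kappa>\<close> makes no sense and the isometry is asserted for vectors with \<open>a = 0\<close> only; these are preserved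
by \<open>\<theta>\<close>.
The initial unit normal exists and is spacelike because the ambient form has only as many negative directions as are
already used up by the tangent space of \<open>M\<close> and, if \<open>\<kappa> < 0\<close>, by the position vector (\<open>unit_normal_exists\<close>).

Uniqueness: conversely every hypersurface with Weingarten map \<open>A\<close> gives a solution of the same linear system
(\<open>frame_has_derivative\<close>), and two solutions with equal initial values agree near the point
(\<open>linear_system_zero\<close>).

For the flat system, the Picard iterates along the rays through the initial point are differentiable in all directions.
Flatness gives a recursion for the defect \<open>Du - u \<theta>\<close> of an iterate \<open>u\<close>, and the defects tend to \<open>0\<close>; so the limit
solves the system in all directions and not only along the rays.

The remaining work is the translation between manifolds and coordinates: the Levi-Civita connection in a chart
(\<open>D_coord\<close>), the fact that the Levi-Civita connection of the quadric is the tangential part of the flat derivative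
(\<open>gauss_formula\<close>), smoothness of maps into charts that are inverses of parametrizations (\<open>smooth_on_lift\<close>),
and the extension of \<open>\<nu>\<close> to an ambient vector field by means of a smooth local retraction onto the hypersurface
(\<open>immersion_local_retraction\<close>, \<open>retract_extension\<close>).  A chart of the model space at the point \<open>q\<close> is obtained
from the injectivity of \<open>F\<close>: without a chart, the tangent space at \<open>q\<close> would be trivial
(\<open>target_chart_exists\<close>).\<close>

section \<open>Calculus of smooth maps\<close>

abbreviation dd :: "('e::real_normed_vector \<Rightarrow> 'f::real_normed_vector) \<Rightarrow> 'e \<Rightarrow> 'e \<Rightarrow> 'f" where
  "dd f x \<equiv> frechet_derivative f (at x)"

lemma dd_eqI: "(f has_derivative f') (at x) \<Longrightarrow> dd f x = f'"
  by (rule frechet_derivative_at[symmetric])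

lemma dd_works: "f differentiable (at x) \<Longrightarrow> (f has_derivative dd f x) (at x)"
  by (simp add: frechet_derivative_works)

lemma Ck_on_subset: "Ck_on k S f \<Longrightarrow> T \<subseteq> S \<Longrightarrow> Ck_on k T f"
  by (induction k arbitrary: f) (auto intro: continuous_on_subset)

lemma Ck_on_Suc_imp: "Ck_on (Suc k) S f \<Longrightarrow> Ck_on k S f"
proof (induction k arbitrary: f)
  case 0
  then show ?case
    by (auto simp: continuous_on_eq_continuous_within
        intro!: continuous_at_imp_continuous_within[OF differentiable_imp_continuous_within])
next
  case (Suc k)
  show ?case
    unfolding Ck_on.simps(2)[of k]
    using Suc.prems Suc.IH by (auto simp: Ck_on.simps(2)[of "Suc k"] simp del: Ck_on.simps)
qed

lemma Ck_on_cong_open: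
  assumes "open S" "\<And>x. x \<in> S \<Longrightarrow> f x = g x" "Ck_on k S f"
  shows "Ck_on k S g"
  using assms(2,3)
proof (induction k arbitrary: f g)
  case 0
  then show ?case by (auto cong: continuous_on_cong)
next
  case (Suc k)
  have 1: "(g has_derivative dd f x) (at x)" if "x \<in> S" for x
    by (rule has_derivative_transform_within_open[OF dd_works])
       (use Suc.prems that \<open>open S\<close> in auto)
  have 2: "dd g x = dd f x" if "x \<in> S" for x
    using 1[OF that] by (rule dd_eqI)
  show ?case
    using Suc.prems Suc.IH[of "\<lambda>x. dd f x v" "\<lambda>x. dd g x v" for v] 1 2
    by (auto simp: differentiable_def)
qed

lemma Ck_on_const: "Ck_on k S (\<lambda>x. c)"
  by (induction k arbitrary: c) auto

text \<open>Differentiability of class \<open>C\<^sup>k\<^sup>+\<^sup>1\<close> is proved throughout by exhibiting some derivative whose directional values are of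
class \<open>C\<^sup>k\<close>; the Frechet derivative itself need not be computed.\<close>

lemma Ck_on_SucI:
  assumes "open S" "\<And>x. x \<in> S \<Longrightarrow> (f has_derivative f' x) (at x)" "\<And>v. Ck_on k S (\<lambda>x. f' x v)"
  shows "Ck_on (Suc k) S f"
proof -
  have "dd f x = f' x" if "x \<in> S" for x
    using assms(2)[OF that] by (rule dd_eqI)
  then have "Ck_on k S (\<lambda>x. dd f x v)" for v
    using assms(3)[of v] by (auto intro: Ck_on_cong_open[OF assms(1)])
  then show ?thesis
    using assms(2) by (auto simp: differentiable_def)
qed

lemma Ck_on_linear:
  assumes "bounded_linear L" "open S" "Ck_on k S f"
  shows "Ck_on k S (\<lambda>x. L (f x))"
  using assms(3)
proof (induction k arbitrary: f)
  case 0
  then show ?case by (simp add: bounded_linear.continuous_on[OF assms(1)])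
next
  case (Suc k)
  show ?case
  proof (rule Ck_on_SucI[OF assms(2)])
    show "((\<lambda>x. L (f x)) has_derivative (\<lambda>v. L (dd f x v))) (at x)" if "x \<in> S" for x
      using Suc.prems that by (intro bounded_linear.has_derivative[OF assms(1)] dd_works) auto
    show "Ck_on k S (\<lambda>x. L (dd f x v))" for v
      using Suc by simp
  qed
qed

lemma Ck_on_add:
  assumes "open S" "Ck_on k S f" "Ck_on k S g"
  shows "Ck_on k S (\<lambda>x. f x + g x)"
  using assms(2,3)
proof (induction k arbitrary: f g)
  case 0
  then show ?case by (simp add: continuous_on_add)
next
  case (Suc k)
  show ?case
  proof (rule Ck_on_SucI[OF assms(1)])
    show "((\<lambda>x. f x + g x) has_derivative (\<lambda>v. dd f x v + dd g x v)) (at x)" if "x \<in> S" for x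
      using Suc.prems that by (intro has_derivative_add dd_works) auto
    show "Ck_on k S (\<lambda>x. dd f x v + dd g x v)" for v
      using Suc by simp
  qed
qed

lemma Ck_on_bilinear:
  fixes prod :: "'a::euclidean_space \<Rightarrow> 'b::euclidean_space \<Rightarrow> 'c::euclidean_space"
  assumes "bounded_bilinear prod" "open S" "Ck_on k S f" "Ck_on k S g"
  shows "Ck_on k S (\<lambda>x. prod (f x) (g x))"
  using assms(3,4)
proof (induction k arbitrary: f g)
  case 0
  then show ?case by (simp add: bounded_bilinear.continuous_on[OF assms(1)])
next
  case (Suc k)
  show ?case
  proof (rule Ck_on_SucI[OF assms(2)])
    show "((\<lambda>x. prod (f x) (g x)) has_derivative (\<lambda>v. prod (f x) (dd g x v) + prod (dd f x v) (g x))) (at x)"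
      if "x \<in> S" for x
      using Suc.prems that by (intro bounded_bilinear.FDERIV[OF assms(1)] dd_works) auto
    have "Ck_on k S f" "Ck_on k S g"
      using Suc.prems by (auto intro: Ck_on_Suc_imp simp del: Ck_on.simps)
    then show "Ck_on k S (\<lambda>x. prod (f x) (dd g x v) + prod (dd f x v) (g x))" for v
      using Suc by (intro Ck_on_add assms(2)) auto
  qed
qed

lemma Ck_on_sum:
  assumes "open S" "\<And>i. i \<in> I \<Longrightarrow> Ck_on k S (f i)"
  shows "Ck_on k S (\<lambda>x. \<Sum>i\<in>I. f i x)"
proof (cases "finite I")
  case True
  then show ?thesis using assms(2)
    by (induction I rule: finite_induct) (auto intro!: Ck_on_add[OF assms(1)] Ck_on_const simp: Ck_on_const[of k S 0])
qed (simp add: Ck_on_const)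

lemma dd_euclidean:
  fixes f :: "'e::euclidean_space \<Rightarrow> 'f::real_normed_vector"
  assumes "f differentiable (at x)"
  shows "dd f x v = (\<Sum>b\<in>Basis. (v \<bullet> b) *\<^sub>R dd f x b)"
proof -
  interpret linear "dd f x" by (rule linear_frechet_derivative[OF assms])
  have "dd f x v = dd f x (\<Sum>b\<in>Basis. (v \<bullet> b) *\<^sub>R b)" by (simp add: euclidean_representation)
  then show ?thesis by (simp add: sum scale)
qed

text \<open>The chain rule produces \<open>dd g (f x) (dd f x v)\<close>, in which the direction varies with \<open>x\<close>.  Expanding it in the
standard basis reduces the induction step to products of functions of class \<open>C\<^sup>k\<close>.\<close>

lemma Ck_on_compose:
  fixes f :: "'e::euclidean_space \<Rightarrow> 'f::euclidean_space" and g :: "'f \<Rightarrow> 'g::euclidean_space"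
  assumes "open S" "Ck_on k S f" "Ck_on k T g" "f ` S \<subseteq> T"
  shows "Ck_on k S (\<lambda>x. g (f x))"
  using assms(2,3)
proof (induction k arbitrary: g)
  case 0
  then show ?case using assms(4) by (auto intro: continuous_on_compose2)
next
  case (Suc k)
  have fk: "Ck_on k S f"
    using Suc.prems by (blast intro: Ck_on_Suc_imp)
  show ?case
  proof (rule Ck_on_SucI[OF assms(1)])
    show "((\<lambda>x. g (f x)) has_derivative (\<lambda>v. \<Sum>b\<in>Basis. (dd f x v \<bullet> b) *\<^sub>R dd g (f x) b)) (at x)"
      if "x \<in> S" for x
    proof -
      have g: "g differentiable (at (f x))" and f: "f differentiable (at x)"
        using Suc.prems that assms(4) by auto
      show ?thesis
        using has_derivative_compose[OF dd_works[OF f] dd_works[OF g]]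
        by (rule has_derivative_eq_rhs) (rule ext, rule dd_euclidean[OF g])
    qed
    show "Ck_on k S (\<lambda>x. \<Sum>b\<in>Basis. (dd f x v \<bullet> b) *\<^sub>R dd g (f x) b)" for v
      by (intro Ck_on_sum assms(1) Ck_on_bilinear[OF bounded_bilinear_scaleR]
          Ck_on_linear[OF bounded_linear_inner_left] Suc.IH fk) (use Suc.prems in auto)
  qed
qed

lemma smooth_on_subset: "smooth_on S f \<Longrightarrow> T \<subseteq> S \<Longrightarrow> smooth_on T f"
  unfolding smooth_on_def using Ck_on_subset by blast

lemma smooth_on_cong: "open S \<Longrightarrow> smooth_on S f \<Longrightarrow> (\<And>x. x \<in> S \<Longrightarrow> f x = g x) \<Longrightarrow> smooth_on S g"
  unfolding smooth_on_def using Ck_on_cong_open by blast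

lemma smooth_on_const: "smooth_on S (\<lambda>x. c)"
  unfolding smooth_on_def using Ck_on_const by blast

lemma smooth_on_linear: "bounded_linear L \<Longrightarrow> open S \<Longrightarrow> smooth_on S f \<Longrightarrow> smooth_on S (\<lambda>x. L (f x))"
  unfolding smooth_on_def using Ck_on_linear by blast

lemma smooth_on_add: "open S \<Longrightarrow> smooth_on S f \<Longrightarrow> smooth_on S g \<Longrightarrow> smooth_on S (\<lambda>x. f x + g x)"
  unfolding smooth_on_def using Ck_on_add by blast

lemma smooth_on_bilinear:
  fixes prod :: "'a::euclidean_space \<Rightarrow> 'b::euclidean_space \<Rightarrow> 'c::euclidean_space"
  shows "bounded_bilinear prod \<Longrightarrow> open S \<Longrightarrow> smooth_on S f \<Longrightarrow> smooth_on S g \<Longrightarrow> smooth_on S (\<lambda>x. prod (f x) (g x))"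
  unfolding smooth_on_def using Ck_on_bilinear by blast

lemma smooth_on_sum:
  "open S \<Longrightarrow> (\<And>i. i \<in> I \<Longrightarrow> smooth_on S (f i)) \<Longrightarrow> smooth_on S (\<lambda>x. \<Sum>i\<in>I. f i x)"
  unfolding smooth_on_def using Ck_on_sum[of S I] by blast

lemma smooth_on_compose:
  fixes f :: "'e::euclidean_space \<Rightarrow> 'f::euclidean_space" and g :: "'f \<Rightarrow> 'g::euclidean_space"
  shows "open S \<Longrightarrow> smooth_on S f \<Longrightarrow> smooth_on T g \<Longrightarrow> f ` S \<subseteq> T \<Longrightarrow> smooth_on S (\<lambda>x. g (f x))"
  unfolding smooth_on_def using Ck_on_compose by blast

lemma smooth_on_id: "open S \<Longrightarrow> smooth_on S (\<lambda>x. x)"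
  unfolding smooth_on_def
proof
  show "open S \<Longrightarrow> Ck_on k S (\<lambda>x. x)" for k
    by (cases k) (auto intro: Ck_on_const continuous_on_id)
qed

lemma smooth_on_imp_continuous: "smooth_on S f \<Longrightarrow> continuous_on S f"
  unfolding smooth_on_def by (metis Ck_on.simps(1))

lemma smooth_on_imp_differentiable: "smooth_on S f \<Longrightarrow> x \<in> S \<Longrightarrow> f differentiable (at x)"
  unfolding smooth_on_def by (metis Ck_on.simps(2))

lemma smooth_on_dd: "smooth_on S f \<Longrightarrow> smooth_on S (\<lambda>x. dd f x v)"
  unfolding smooth_on_def by (metis Ck_on.simps(2))

lemma smooth_on_has_derivative: "smooth_on S f \<Longrightarrow> x \<in> S \<Longrightarrow> (f has_derivative dd f x) (at x)"
  using smooth_on_imp_differentiable dd_works by blast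

text \<open>Smoothness of a family of linear maps \<open>P x\<close> is always expressed by fixing the argument; this lemma allows the argument to
vary smoothly as well.\<close>

lemma smooth_on_apply_linear:
  fixes P :: "'e::euclidean_space \<Rightarrow> 'h::euclidean_space \<Rightarrow> 'v::euclidean_space"
  assumes "open S" "\<And>x. x \<in> S \<Longrightarrow> linear (P x)" "\<And>w. smooth_on S (\<lambda>x. P x w)" "smooth_on S k"
  shows "smooth_on S (\<lambda>x. P x (k x))"
proof (rule smooth_on_cong[OF assms(1)])
  show "smooth_on S (\<lambda>x. \<Sum>b\<in>Basis. (k x \<bullet> b) *\<^sub>R P x b)"
    by (intro smooth_on_sum assms(1,3,4) smooth_on_bilinear[OF bounded_bilinear_scaleR]
          smooth_on_linear[OF bounded_linear_inner_left])
  show "(\<Sum>b\<in>Basis. (k x \<bullet> b) *\<^sub>R P x b) = P x (k x)" if "x \<in> S" for x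
  proof -
    interpret linear "P x" by (rule assms(2)[OF that])
    have "P x (k x) = P x (\<Sum>b\<in>Basis. (k x \<bullet> b) *\<^sub>R b)" by (simp add: euclidean_representation)
    then show ?thesis by (simp add: sum scale)
  qed
qed

text \<open>Only the partial maps \<open>\<lambda>x. P x w\<close> have to be differentiable: by linearity a finite basis suffices.\<close>

lemma has_derivative_apply_linear:
  fixes P :: "'e::euclidean_space \<Rightarrow> 'h::euclidean_space \<Rightarrow> 'v::real_normed_vector"
  assumes "open S" "y \<in> S" "\<And>x. x \<in> S \<Longrightarrow> linear (P x)"
    "\<And>w. (\<lambda>x. P x w) differentiable (at y)" "(k has_derivative k') (at y)"
  shows "((\<lambda>x. P x (k x)) has_derivative (\<lambda>v. dd (\<lambda>x. P x (k y)) y v + P y (k' v))) (at y)"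
proof -
  have rep: "P x w = (\<Sum>b\<in>Basis. (w \<bullet> b) *\<^sub>R P x b)" if "x \<in> S" for x w
  proof -
    interpret linear "P x" by (rule assms(3)[OF that])
    have "P x w = P x (\<Sum>b\<in>Basis. (w \<bullet> b) *\<^sub>R b)" by (simp add: euclidean_representation)
    then show ?thesis by (simp add: sum scale)
  qed
  note [derivative_intros] = dd_works[OF assms(4)] assms(5)
  have 1: "((\<lambda>x. \<Sum>b\<in>Basis. (k x \<bullet> b) *\<^sub>R P x b) has_derivative
     (\<lambda>v. \<Sum>b\<in>Basis. (k y \<bullet> b) *\<^sub>R dd (\<lambda>x. P x b) y v + (k' v \<bullet> b) *\<^sub>R P y b)) (at y)"
    by (auto intro!: derivative_eq_intros)
  have "((\<lambda>x. \<Sum>b\<in>Basis. (k y \<bullet> b) *\<^sub>R P x b) has_derivative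
     (\<lambda>v. \<Sum>b\<in>Basis. (k y \<bullet> b) *\<^sub>R dd (\<lambda>x. P x b) y v)) (at y)"
    by (auto intro!: derivative_eq_intros)
  then have "((\<lambda>x. P x (k y)) has_derivative
     (\<lambda>v. \<Sum>b\<in>Basis. (k y \<bullet> b) *\<^sub>R dd (\<lambda>x. P x b) y v)) (at y)"
    by (rule has_derivative_transform_within_open[OF _ assms(1,2)]) (rule rep[symmetric])
  then have 2: "dd (\<lambda>x. P x (k y)) y = (\<lambda>v. \<Sum>b\<in>Basis. (k y \<bullet> b) *\<^sub>R dd (\<lambda>x. P x b) y v)"
    by (rule dd_eqI)
  have 3: "P y (k' v) = (\<Sum>b\<in>Basis. (k' v \<bullet> b) *\<^sub>R P y b)" for v
    by (rule rep[OF assms(2)])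
  have "((\<lambda>x. \<Sum>b\<in>Basis. (k x \<bullet> b) *\<^sub>R P x b) has_derivative
     (\<lambda>v. dd (\<lambda>x. P x (k y)) y v + P y (k' v))) (at y)"
    by (rule has_derivative_eq_rhs[OF 1]) (simp only: 2 3 sum.distrib)
  then show ?thesis
    by (rule has_derivative_transform_within_open[OF _ assms(1,2)]) (rule rep[symmetric])
qed

section \<open>Symmetry of second derivatives\<close>

text \<open>The symmetric second difference of \<open>f\<close> is \<open>s\<^sup>2\<close> times the mixed derivative at an intermediate point, by applying the
mean value theorem once in each direction.  The difference does not change when \<open>v\<close> and \<open>w\<close> are exchanged, so the two mixed
derivatives agree in the limit.\<close>

lemma second_difference_mvt:
  fixes f :: "'e::euclidean_space \<Rightarrow> real"
  assumes S: "Ck_on 2 S f" and s: "s > 0"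
    and sub: "\<And>a b. 0 \<le> a \<Longrightarrow> a \<le> s \<Longrightarrow> 0 \<le> b \<Longrightarrow> b \<le> s \<Longrightarrow> x + a *\<^sub>R v + b *\<^sub>R w \<in> S"
  obtains a b where "0 < a" "a < s" "0 < b" "b < s"
    "f (x + s *\<^sub>R v + s *\<^sub>R w) - f (x + s *\<^sub>R v) - f (x + s *\<^sub>R w) + f x
       = s * (s * dd (\<lambda>y. dd f y v) (x + a *\<^sub>R v + b *\<^sub>R w) w)"
proof -
  have S': "Ck_on (Suc (Suc 0)) S f" using S by (simp only: numeral_2_eq_2)
  have f: "(f has_derivative dd f y) (at y)" if "y \<in> S" for y
    using S' that by (auto intro: dd_works)
  have f2: "((\<lambda>y. dd f y v) has_derivative dd (\<lambda>y. dd f y v) y) (at y)" if "y \<in> S" for y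
    using S' that by (auto intro: dd_works)
  have scale1: "dd f y (c *\<^sub>R z) = c * dd f y z" if "y \<in> S" for y c z
    using linear_frechet_derivative[of f "at y"] S' that by (auto simp: linear_scale)
  have scale2: "dd (\<lambda>y. dd f y v) y (c *\<^sub>R z) = c * dd (\<lambda>y. dd f y v) y z" if "y \<in> S" for y c z
    using linear_frechet_derivative[of "\<lambda>y. dd f y v" "at y"] S' that by (auto simp: linear_scale)
  have "\<exists>a>0. a < s \<and> (f (x + s *\<^sub>R v + s *\<^sub>R w) - f (x + s *\<^sub>R v)) - (f (x + 0 *\<^sub>R v + s *\<^sub>R w) - f (x + 0 *\<^sub>R v))
      = (s - 0) * (dd f (x + a *\<^sub>R v + s *\<^sub>R w) v - dd f (x + a *\<^sub>R v) v)"
  proof (rule MVT2[OF s])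
    fix a assume a: "0 \<le> a" "a \<le> s"
    have m: "x + a *\<^sub>R v + s *\<^sub>R w \<in> S" "x + a *\<^sub>R v \<in> S"
      using sub[OF a, of s] sub[OF a, of 0] s by auto
    have 1: "((\<lambda>a. x + a *\<^sub>R v + s *\<^sub>R w) has_derivative (\<lambda>h. h *\<^sub>R v)) (at a)"
      "((\<lambda>a. x + a *\<^sub>R v) has_derivative (\<lambda>h. h *\<^sub>R v)) (at a)"
      by (auto intro!: derivative_eq_intros)
    have "((\<lambda>a. f (x + a *\<^sub>R v + s *\<^sub>R w) - f (x + a *\<^sub>R v)) has_derivative
       (\<lambda>h. dd f (x + a *\<^sub>R v + s *\<^sub>R w) (h *\<^sub>R v) - dd f (x + a *\<^sub>R v) (h *\<^sub>R v))) (at a)"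
      using has_derivative_compose[OF 1(1) f[OF m(1)]] has_derivative_compose[OF 1(2) f[OF m(2)]]
      by (rule has_derivative_diff)
    then show "((\<lambda>a. f (x + a *\<^sub>R v + s *\<^sub>R w) - f (x + a *\<^sub>R v)) has_real_derivative
      (dd f (x + a *\<^sub>R v + s *\<^sub>R w) v - dd f (x + a *\<^sub>R v) v)) (at a)"
      unfolding has_field_derivative_def
      by (rule has_derivative_eq_rhs) (simp only: scale1[OF m(1)] scale1[OF m(2)], simp add: fun_eq_iff algebra_simps)
  qed
  then obtain a where a: "0 < a" "a < s"
    "f (x + s *\<^sub>R v + s *\<^sub>R w) - f (x + s *\<^sub>R v) - f (x + s *\<^sub>R w) + f x
      = s * (dd f (x + a *\<^sub>R v + s *\<^sub>R w) v - dd f (x + a *\<^sub>R v) v)" by auto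
  have "\<exists>b>0. b < s \<and> dd f (x + a *\<^sub>R v + s *\<^sub>R w) v - dd f (x + a *\<^sub>R v + 0 *\<^sub>R w) v
      = (s - 0) * dd (\<lambda>y. dd f y v) (x + a *\<^sub>R v + b *\<^sub>R w) w"
  proof (rule MVT2[OF s])
    fix b assume b: "0 \<le> b" "b \<le> s"
    have m: "x + a *\<^sub>R v + b *\<^sub>R w \<in> S"
      using sub[of a b] a b by auto
    have 1: "((\<lambda>b. x + a *\<^sub>R v + b *\<^sub>R w) has_derivative (\<lambda>h. h *\<^sub>R w)) (at b)"
      by (auto intro!: derivative_eq_intros)
    show "((\<lambda>b. dd f (x + a *\<^sub>R v + b *\<^sub>R w) v) has_real_derivative
      dd (\<lambda>y. dd f y v) (x + a *\<^sub>R v + b *\<^sub>R w) w) (at b)"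
      unfolding has_field_derivative_def
      using has_derivative_compose[OF 1 f2[OF m]]
      by (rule has_derivative_eq_rhs) (simp only: scale2[OF m], simp add: fun_eq_iff algebra_simps)
  qed
  then obtain b where "0 < b" "b < s" "dd f (x + a *\<^sub>R v + s *\<^sub>R w) v - dd f (x + a *\<^sub>R v) v
      = s * dd (\<lambda>y. dd f y v) (x + a *\<^sub>R v + b *\<^sub>R w) w" by auto
  with a show ?thesis by (intro that[of a b]) auto
qed

lemma second_derivative_sym_real:
  fixes f :: "'e::euclidean_space \<Rightarrow> real"
  assumes "open S" "x \<in> S" and S: "Ck_on 2 S f"
  shows "dd (\<lambda>y. dd f y v) x w = dd (\<lambda>y. dd f y w) x v"
proof (rule ccontr)
  let ?A = "\<lambda>y. dd (\<lambda>y. dd f y v) y w" and ?B = "\<lambda>y. dd (\<lambda>y. dd f y w) y v"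
  assume "?A x \<noteq> ?B x"
  \<comment> \<open>Near \<open>x\<close> each mixed derivative stays within half the gap of its value at \<open>x\<close>, yet both take a common value there.\<close>
  define e where "e = \<bar>?A x - ?B x\<bar> / 2"
  have e: "e > 0" using \<open>?A x \<noteq> ?B x\<close> by (simp add: e_def)
  have S': "Ck_on (Suc (Suc 0)) S f" using S by (simp only: numeral_2_eq_2)
  then have "continuous_on S ?A" "continuous_on S ?B"
    by auto
  then have "isCont ?A x" "isCont ?B x"
    using assms(1,2) by (auto simp: continuous_on_eq_continuous_at)
  then obtain d1 d2 where d1: "d1 > 0" "\<forall>y. dist y x < d1 \<longrightarrow> dist (?A y) (?A x) < e"
     and d2: "d2 > 0" "\<forall>y. dist y x < d2 \<longrightarrow> dist (?B y) (?B x) < e"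
    using e unfolding continuous_at_eps_delta by (elim allE[of _ e] impE) auto
  note d = d1(1) d1(2)[rule_format] d2(1) d2(2)[rule_format]
  obtain d3 where d3: "d3 > 0" "ball x d3 \<subseteq> S"
    using assms(1,2) open_contains_ball_eq by blast
  define d where "d = min d1 (min d2 d3)"
  define N where "N = norm v + norm w"
  have N: "N \<ge> 0" by (simp add: N_def)
  define s where "s = d / (2 * (N + 1))"
  have dp: "d > 0" using d d3 by (simp add: d_def)
  then have s: "s > 0" unfolding s_def using N by simp
  have near: "dist (x + a *\<^sub>R v' + b *\<^sub>R w') x < d" if "0 \<le> a" "a \<le> s" "0 \<le> b" "b \<le> s"
     "norm v' + norm w' = N" for a b v' w'
  proof -
    have "dist (x + a *\<^sub>R v' + b *\<^sub>R w') x = norm (a *\<^sub>R v' + b *\<^sub>R w')"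
      by (simp add: dist_norm)
    also have "\<dots> \<le> a * norm v' + b * norm w'"
      using norm_triangle_ineq[of "a *\<^sub>R v'" "b *\<^sub>R w'"] that by simp
    also have "\<dots> \<le> s * norm v' + s * norm w'"
      using that by (intro add_mono mult_right_mono) auto
    also have "\<dots> = s * N" using that(5) by (simp flip: distrib_left)
    also have "\<dots> < s * (2 * (N + 1))"
      using s N by (intro mult_strict_left_mono) auto
    also have "\<dots> = d" using N by (simp add: s_def)
    finally show ?thesis .
  qed
  have inS: "x + a *\<^sub>R v' + b *\<^sub>R w' \<in> S" if "0 \<le> a" "a \<le> s" "0 \<le> b" "b \<le> s"
     "norm v' + norm w' = N" for a b v' w'
    using near[OF that] d3(2) by (auto simp: d_def dist_commute subset_eq)
  obtain a b where ab: "0 < a" "a < s" "0 < b" "b < s"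
    "f (x + s *\<^sub>R v + s *\<^sub>R w) - f (x + s *\<^sub>R v) - f (x + s *\<^sub>R w) + f x
       = s * (s * ?A (x + a *\<^sub>R v + b *\<^sub>R w))"
    by (rule second_difference_mvt[OF S s, of x v w]) (use inS in \<open>auto simp: N_def\<close>)
  obtain a' b' where ab': "0 < a'" "a' < s" "0 < b'" "b' < s"
    "f (x + s *\<^sub>R w + s *\<^sub>R v) - f (x + s *\<^sub>R w) - f (x + s *\<^sub>R v) + f x
       = s * (s * ?B (x + a' *\<^sub>R w + b' *\<^sub>R v))"
    by (rule second_difference_mvt[OF S s, of x w v]) (use inS in \<open>auto simp: N_def\<close>)
  have "x + s *\<^sub>R w + s *\<^sub>R v = x + s *\<^sub>R v + s *\<^sub>R w" by (simp add: algebra_simps)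
  with ab(5) ab'(5) have "s * (s * ?A (x + a *\<^sub>R v + b *\<^sub>R w)) = s * (s * ?B (x + a' *\<^sub>R w + b' *\<^sub>R v))"
    by (simp only:)
  then have eq: "?A (x + a *\<^sub>R v + b *\<^sub>R w) = ?B (x + a' *\<^sub>R w + b' *\<^sub>R v)"
    using s by simp
  have "dist (?A (x + a *\<^sub>R v + b *\<^sub>R w)) (?A x) < e"
    using near[of a b v w] ab by (intro d) (auto simp: d_def N_def)
  moreover have "dist (?B (x + a' *\<^sub>R w + b' *\<^sub>R v)) (?B x) < e"
    using near[of a' b' w v] ab' by (intro d) (auto simp: d_def N_def)
  ultimately show False
    unfolding eq e_def dist_real_def by (simp add: abs_if field_simps split: if_splits)
qed

lemma second_derivative_sym:
  fixes f :: "'e::euclidean_space \<Rightarrow> 'f::euclidean_space"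
  assumes "open S" "x \<in> S" and S: "smooth_on S f"
  shows "dd (\<lambda>y. dd f y v) x w = dd (\<lambda>y. dd f y w) x v"
proof (rule euclidean_eqI)
  fix b :: 'f
  have 1: "dd (\<lambda>y. f y \<bullet> b) y v = dd f y v \<bullet> b" if "y \<in> S" for y v
  proof -
    have "((\<lambda>y. f y \<bullet> b) has_derivative (\<lambda>v. dd f y v \<bullet> b)) (at y)"
      by (intro bounded_linear.has_derivative[OF bounded_linear_inner_left] smooth_on_has_derivative[OF S] that)
    then show ?thesis by (simp add: dd_eqI)
  qed
  have "dd (\<lambda>y. dd (\<lambda>y. f y \<bullet> b) y v) x w = dd (\<lambda>y. dd f y v) x w \<bullet> b" for v w
  proof -
    have "((\<lambda>y. dd f y v \<bullet> b) has_derivative (\<lambda>w. dd (\<lambda>y. dd f y v) x w \<bullet> b)) (at x)"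
      by (intro bounded_linear.has_derivative[OF bounded_linear_inner_left]
          smooth_on_has_derivative[OF smooth_on_dd[OF S]] assms)
    then have "((\<lambda>y. dd (\<lambda>y. f y \<bullet> b) y v) has_derivative (\<lambda>w. dd (\<lambda>y. dd f y v) x w \<bullet> b)) (at x)"
      by (rule has_derivative_transform_within_open[OF _ assms(1,2)]) (simp add: 1)
    then show ?thesis by (simp add: dd_eqI)
  qed
  moreover have "Ck_on 2 S (\<lambda>y. f y \<bullet> b)"
    using smooth_on_linear[OF bounded_linear_inner_left assms(1) S] by (simp add: smooth_on_def)
  ultimately show "dd (\<lambda>y. dd f y v) x w \<bullet> b = dd (\<lambda>y. dd f y w) x v \<bullet> b"
    using second_derivative_sym_real[OF assms(1,2)] by metis
qed

section \<open>Solving linear equations smoothly\<close>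

lemma linear_injective_bounded_left_inverse:
  fixes P :: "'h::euclidean_space \<Rightarrow> 'v::euclidean_space"
  assumes "linear P" "inj P"
  obtains L C where "bounded_linear L" "\<And>x. L (P x) = x" "C > 0" "\<And>v. norm (L v) \<le> C * norm v"
proof -
  obtain L where L: "linear L" "L \<circ> P = id"
    using linear_injective_left_inverse[OF assms] by auto
  then have "bounded_linear L" by (simp add: linear_conv_bounded_linear)
  moreover obtain C where "C > 0" "\<And>v. norm (L v) \<le> norm v * C"
    using bounded_linear.pos_bounded[OF \<open>bounded_linear L\<close>] by auto
  ultimately show ?thesis
    using L(2) by (intro that[of L C]) (auto simp: fun_eq_iff mult.commute)
qed

text \<open>A product needs only one differentiable factor at a zero of that factor; this is what makes continuity of a solution of a linear
system enough to differentiate it.\<close>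

lemma has_derivative_scaleR_vanishing:
  fixes a :: "'y::real_normed_vector \<Rightarrow> real" and m :: "'y \<Rightarrow> 'v::real_normed_vector"
  assumes "isCont a y" "(m has_derivative m') (at y)" "m y = 0"
  shows "((\<lambda>x. a x *\<^sub>R m x) has_derivative (\<lambda>v. a y *\<^sub>R m' v)) (at y)"
proof -
  have bl: "bounded_linear m'" by (rule has_derivative_bounded_linear[OF assms(2)])
  obtain K where K: "\<And>v. norm (m' v) \<le> norm v * K"
    using bounded_linear.pos_bounded[OF bl] by auto
  have lim: "((\<lambda>x. norm (m x - m y - m' (x - y)) / norm (x - y)) \<longlongrightarrow> 0) (at y)"
    using assms(2) by (simp add: has_derivative_iff_norm)
  have "((\<lambda>x. (a x - a y) *\<^sub>R m x) has_derivative (\<lambda>v. 0)) (at y)"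
    unfolding has_derivative_iff_norm
  proof
    have a0: "((\<lambda>x. \<bar>a x - a y\<bar>) \<longlongrightarrow> 0) (at y)"
      using assms(1) by (simp add: isCont_def LIM_zero_iff tendsto_rabs_zero_iff)
    have "((\<lambda>x. \<bar>a x - a y\<bar> * (norm (m x - m y - m' (x - y)) / norm (x - y) + K)) \<longlongrightarrow> 0 * (0 + K)) (at y)"
      by (intro tendsto_intros a0 lim)
    then have "((\<lambda>x. \<bar>a x - a y\<bar> * (norm (m x - m y - m' (x - y)) / norm (x - y) + K)) \<longlongrightarrow> 0) (at y)"
      by (simp only: mult_zero_left)
    moreover have "\<forall>\<^sub>F x in at y. norm (norm ((a x - a y) *\<^sub>R m x - (a y - a y) *\<^sub>R m y - 0) / norm (x - y))
       \<le> \<bar>a x - a y\<bar> * (norm (m x - m y - m' (x - y)) / norm (x - y) + K)"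
    proof (rule eventually_at_topological[THEN iffD2], intro exI[of _ UNIV] conjI ballI impI)
      fix x assume "x \<noteq> y"
      then have p: "norm (x - y) > 0" by simp
      have "norm (m x) \<le> norm (m x - m y - m' (x - y)) + norm (m' (x - y))"
        using norm_triangle_ineq[of "m x - m y - m' (x - y)" "m' (x - y)"] assms(3) by simp
      also have "\<dots> \<le> norm (m x - m y - m' (x - y)) + norm (x - y) * K"
        using K by simp
      finally have "norm (m x) / norm (x - y) \<le> norm (m x - m y - m' (x - y)) / norm (x - y) + K"
        using p by (simp add: field_simps)
      then have "\<bar>a x - a y\<bar> * (norm (m x) / norm (x - y)) \<le> \<bar>a x - a y\<bar> * (norm (m x - m y - m' (x - y)) / norm (x - y) + K)"
        by (intro mult_left_mono) auto
      then show "norm (norm ((a x - a y) *\<^sub>R m x - (a y - a y) *\<^sub>R m y - 0) / norm (x - y))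
       \<le> \<bar>a x - a y\<bar> * (norm (m x - m y - m' (x - y)) / norm (x - y) + K)" by simp
    qed auto
    ultimately show "((\<lambda>x. norm ((a x - a y) *\<^sub>R m x - (a y - a y) *\<^sub>R m y - 0) / norm (x - y)) \<longlongrightarrow> 0) (at y)"
      by (rule Lim_null_comparison[rotated])
  qed auto
  moreover have "((\<lambda>x. a y *\<^sub>R m x) has_derivative (\<lambda>v. a y *\<^sub>R m' v)) (at y)"
    using assms(2) by (intro derivative_intros)
  ultimately have "((\<lambda>x. (a x - a y) *\<^sub>R m x + a y *\<^sub>R m x) has_derivative (\<lambda>v. 0 + a y *\<^sub>R m' v)) (at y)"
    by (rule has_derivative_add)
  then show ?thesis by (simp add: algebra_simps)
qed

text \<open>Comparison of the solutions of two linear equations, by means of a left inverse \<open>L\<close> of one of the two maps.  The unknown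
solution \<open>x1\<close> occurs on the right-hand side multiplied by a quantity that is small when the two maps are close.\<close>

lemma linear_solution_expand:
  fixes P0 P1 :: "'h::euclidean_space \<Rightarrow> 'v::euclidean_space"
  assumes "linear P0" "linear P1" "linear L" "\<And>x. L (P0 x) = x" "P0 x0 = q0" "P1 x1 = q1"
  shows "x1 = x0 + (L (q1 - q0) - (\<Sum>b\<in>Basis. (x1 \<bullet> b) *\<^sub>R L (P1 b - P0 b)))"
proof -
  have rep: "P x = (\<Sum>b\<in>Basis. (x \<bullet> b) *\<^sub>R P b)" if "linear P" for x and P :: "'h \<Rightarrow> 'v"
  proof -
    have "P x = P (\<Sum>b\<in>Basis. (x \<bullet> b) *\<^sub>R b)" by (simp add: euclidean_representation)
    then show ?thesis by (simp add: linear_sum[OF that] linear_scale[OF that])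
  qed
  have "(\<Sum>b\<in>Basis. (x1 \<bullet> b) *\<^sub>R L (P1 b - P0 b)) = L (P1 x1 - P0 x1)"
    using rep[OF assms(1), of x1] rep[OF assms(2), of x1]
    by (simp add: linear_diff[OF assms(3)] linear_sum[OF assms(3)] linear_scale[OF assms(3)]
        scaleR_diff_right sum_subtractf)
  also have "\<dots> = L (q1 - q0) - (x1 - x0)"
    using assms(4-6) by (simp add: linear_diff[OF assms(3)] assms(5)[symmetric])
  finally show ?thesis by simp
qed

lemma isCont_linear_solution:
  fixes P :: "'y::real_normed_vector \<Rightarrow> 'h::euclidean_space \<Rightarrow> 'v::euclidean_space"
  assumes "open S" "y0 \<in> S" "\<And>y. y \<in> S \<Longrightarrow> linear (P y)" "inj (P y0)"
    "\<And>w. isCont (\<lambda>y. P y w) y0" "isCont q y0" "\<And>y. y \<in> S \<Longrightarrow> P y (x y) = q y"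
  shows "isCont x y0"
proof -
  obtain L C where L: "bounded_linear L" "\<And>x. L (P y0 x) = x" and C: "C > 0" "\<And>v. norm (L v) \<le> C * norm v"
    using linear_injective_bounded_left_inverse assms(2-4) by metis
  define \<delta> where "\<delta> y = (\<Sum>b\<in>Basis. norm (P y b - P y0 b))" for y
  have "((\<lambda>y. \<delta> y) \<longlongrightarrow> (\<Sum>b\<in>(Basis::'h set). 0)) (at y0)"
    unfolding \<delta>_def using assms(5) by (intro tendsto_sum tendsto_norm_zero) (simp add: isCont_def LIM_zero_iff)
  then have \<delta>0: "(\<delta> \<longlongrightarrow> 0) (at y0)" by simp
  have q0: "((\<lambda>y. norm (q y - q y0)) \<longlongrightarrow> 0) (at y0)"
    using assms(6) by (simp add: isCont_def LIM_zero_iff tendsto_norm_zero_iff)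
  have "\<forall>\<^sub>F y in at y0. norm (x y - x y0) \<le> 2 * C * (norm (q y - q y0) + norm (x y0) * \<delta> y)"
  proof -
    have "\<forall>\<^sub>F y in at y0. \<delta> y < 1 / (2 * C)"
      using \<delta>0 C by (intro order_tendstoD) auto
    moreover have "\<forall>\<^sub>F y in at y0. y \<in> S"
      using assms(1,2) by (rule eventually_at_in_open')
    ultimately show ?thesis
    proof eventually_elim
      case (elim y)
      have e: "x y - x y0 = L (q y - q y0) - (\<Sum>b\<in>Basis. (x y \<bullet> b) *\<^sub>R L (P y b - P y0 b))"
        using linear_solution_expand[OF assms(3)[OF assms(2)] assms(3)[OF elim(2)]
          bounded_linear.linear[OF L(1)] L(2) assms(7)[OF assms(2)] assms(7)[OF elim(2)]]
        by (simp only: add_diff_cancel_left' diff_eq_eq add.commute)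
      \<comment> \<open>The unknown \<open>x y\<close> on the right is absorbed on the left, since its coefficient \<open>C * \<delta> y\<close> is below \<open>1/2\<close>.\<close>
      have "norm (\<Sum>b\<in>Basis. (x y \<bullet> b) *\<^sub>R L (P y b - P y0 b)) \<le> (\<Sum>b\<in>Basis. norm (x y) * (C * norm (P y b - P y0 b)))"
        by (rule sum_norm_le) (auto intro!: mult_mono Basis_le_norm C)
      also have "\<dots> = C * norm (x y) * \<delta> y" by (simp add: \<delta>_def sum_distrib_left mult_ac)
      finally have "norm (x y - x y0) \<le> C * norm (q y - q y0) + C * norm (x y) * \<delta> y"
        unfolding e by (intro order_trans[OF norm_triangle_ineq4] add_mono C)
      moreover have \<delta>p: "\<delta> y \<ge> 0" by (simp add: \<delta>_def sum_nonneg)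
      have "C * norm (x y) * \<delta> y \<le> C * (norm (x y0) + norm (x y - x y0)) * \<delta> y"
        using C \<delta>p by (intro mult_right_mono mult_left_mono) (simp_all add: norm_triangle_sub)
      ultimately have "norm (x y - x y0) \<le> C * norm (q y - q y0) + C * (norm (x y0) + norm (x y - x y0)) * \<delta> y"
        by linarith
      moreover have "norm (x y - x y0) * (C * \<delta> y) \<le> norm (x y - x y0) * (1 / 2)"
        using elim C by (intro mult_left_mono) (auto simp: field_simps)
      ultimately show ?case by (simp add: algebra_simps)
    qed
  qed
  moreover have "((\<lambda>y. 2 * C * (norm (q y - q y0) + norm (x y0) * \<delta> y)) \<longlongrightarrow> 2 * C * (0 + norm (x y0) * 0)) (at y0)"
    by (intro tendsto_intros q0 \<delta>0)
  then have "((\<lambda>y. 2 * C * (norm (q y - q y0) + norm (x y0) * \<delta> y)) \<longlongrightarrow> 0) (at y0)"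
    by (simp only: mult_zero_right add_0)
  ultimately have "((\<lambda>y. x y - x y0) \<longlongrightarrow> 0) (at y0)"
    by (rule Lim_null_comparison)
  then show ?thesis by (simp add: isCont_def LIM_zero_iff)
qed

lemma differentiable_linear_solution:
  fixes P :: "'y::euclidean_space \<Rightarrow> 'h::euclidean_space \<Rightarrow> 'v::euclidean_space"
  assumes "open S" "y0 \<in> S" "\<And>y. y \<in> S \<Longrightarrow> linear (P y)" "inj (P y0)"
    "\<And>w. (\<lambda>y. P y w) differentiable (at y0)" "q differentiable (at y0)" "\<And>y. y \<in> S \<Longrightarrow> P y (x y) = q y"
  shows "x differentiable (at y0)"
proof -
  obtain L C where L: "bounded_linear L" "\<And>x. L (P y0 x) = x" and C: "C > 0" "\<And>v. norm (L v) \<le> C * norm v"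
    using linear_injective_bounded_left_inverse assms(2-4) by metis
  have "isCont x y0"
    by (rule isCont_linear_solution[where q = q and P = P, OF assms(1-4)])
       (auto intro: differentiable_imp_continuous_within assms(5-7))
  then have cx: "isCont (\<lambda>y. x y \<bullet> b) y0" for b
    by (intro continuous_intros)
  have "((\<lambda>y. (x y \<bullet> b) *\<^sub>R L (P y b - P y0 b)) has_derivative (\<lambda>v. (x y0 \<bullet> b) *\<^sub>R L (dd (\<lambda>y. P y b) y0 v - 0))) (at y0)" for b
    by (intro has_derivative_scaleR_vanishing cx bounded_linear.has_derivative[OF L(1)]
       has_derivative_diff dd_works assms has_derivative_const) (simp add: linear_0[OF bounded_linear.linear[OF L(1)]])
  then have "((\<lambda>y. x y0 + (L (q y - q y0) - (\<Sum>b\<in>Basis. (x y \<bullet> b) *\<^sub>R L (P y b - P y0 b)))) has_derivative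
     (\<lambda>v. 0 + (L (dd q y0 v - 0) - (\<Sum>b\<in>Basis. (x y0 \<bullet> b) *\<^sub>R L (dd (\<lambda>y. P y b) y0 v - 0))))) (at y0)"
    by (intro has_derivative_add has_derivative_diff has_derivative_sum has_derivative_const
      bounded_linear.has_derivative[OF L(1)] dd_works assms)
  then have "(x has_derivative
     (\<lambda>v. 0 + (L (dd q y0 v - 0) - (\<Sum>b\<in>Basis. (x y0 \<bullet> b) *\<^sub>R L (dd (\<lambda>y. P y b) y0 v - 0))))) (at y0)"
  proof (rule has_derivative_transform_within_open[OF _ assms(1,2)])
    fix y assume "y \<in> S"
    then show "x y0 + (L (q y - q y0) - (\<Sum>b\<in>Basis. (x y \<bullet> b) *\<^sub>R L (P y b - P y0 b))) = x y"
      using linear_solution_expand[OF assms(3)[OF assms(2)] assms(3)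
          bounded_linear.linear[OF L(1)] L(2) assms(7)[OF assms(2)] assms(7)] by metis
  qed
  then show ?thesis by (auto simp: differentiable_def)
qed

text \<open>Differentiating \<open>P y (x y) = q y\<close> gives an equation of the same kind for the derivative of \<open>x\<close>, with the same \<open>P\<close> and a new
right-hand side that involves \<open>x\<close> itself; hence the induction.\<close>

lemma Ck_on_linear_solution:
  fixes P :: "'y::euclidean_space \<Rightarrow> 'h::euclidean_space \<Rightarrow> 'v::euclidean_space"
  assumes "open S" "\<And>y. y \<in> S \<Longrightarrow> linear (P y)" "\<And>y. y \<in> S \<Longrightarrow> inj (P y)"
    "\<And>w. Ck_on k S (\<lambda>y. P y w)" "Ck_on k S q" "\<And>y. y \<in> S \<Longrightarrow> P y (x y) = q y"
  shows "Ck_on k S x"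
  using assms(4-6)
proof (induction k arbitrary: q x)
  case 0
  have "isCont x y" if "y \<in> S" for y
    by (rule isCont_linear_solution[where q = q and P = P, OF assms(1) that assms(2,3)])
       (use 0(1,2) that assms(1) in \<open>simp_all add: continuous_on_eq_continuous_at 0(3)\<close>)
  then show ?case by (simp add: continuous_at_imp_continuous_on)
next
  case (Suc k)
  have P: "Ck_on k S (\<lambda>y. P y w)" for w
    using Suc.prems(1) by (blast intro: Ck_on_Suc_imp)
  have x: "Ck_on k S x"
    by (rule Suc.IH[OF P _ Suc.prems(3)]) (use Suc.prems in \<open>blast intro: Ck_on_Suc_imp\<close>)
  have Pd: "(\<lambda>y. P y w) differentiable (at y)" if "y \<in> S" for y w
    using Suc.prems(1)[of w] that by simp
  have xd: "x differentiable (at y)" if "y \<in> S" for y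
    by (rule differentiable_linear_solution[where q = q and P = P, OF assms(1) that assms(2,3)])
       (use Suc.prems(2) that Pd in \<open>simp_all add: Suc.prems(3)\<close>)
  show ?case
  proof (rule Ck_on_SucI[OF assms(1) dd_works[OF xd]])
    fix v
    show "Ck_on k S (\<lambda>y. dd x y v)"
    proof (rule Suc.IH[OF P])
      let ?q = "\<lambda>y. dd q y v + (-1) *\<^sub>R (\<Sum>b\<in>Basis. (x y \<bullet> b) *\<^sub>R dd (\<lambda>y. P y b) y v)"
      show "Ck_on k S ?q"
        by (intro Ck_on_add Ck_on_linear[OF bounded_linear_scaleR_right] Ck_on_sum assms(1)
          Ck_on_bilinear[OF bounded_bilinear_scaleR] Ck_on_linear[OF bounded_linear_inner_left] x)
          (use Suc.prems in auto)
      fix y assume y: "y \<in> S"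
      have rep: "P y w = (\<Sum>b\<in>Basis. (w \<bullet> b) *\<^sub>R P y b)" if "y \<in> S" for y w
      proof -
        have "P y w = P y (\<Sum>b\<in>Basis. (w \<bullet> b) *\<^sub>R b)" by (simp add: euclidean_representation)
        then show ?thesis using assms(2)[OF that] by (simp add: linear_sum linear_scale)
      qed
      note [derivative_intros] = dd_works[OF xd[OF y]] dd_works[OF Pd[OF y]]
      have "((\<lambda>y. \<Sum>b\<in>Basis. (x y \<bullet> b) *\<^sub>R P y b) has_derivative
        (\<lambda>v. \<Sum>b\<in>Basis. (x y \<bullet> b) *\<^sub>R dd (\<lambda>y. P y b) y v + (dd x y v \<bullet> b) *\<^sub>R P y b)) (at y)"
        by (auto intro!: derivative_eq_intros)
      then have "(q has_derivative
        (\<lambda>v. \<Sum>b\<in>Basis. (x y \<bullet> b) *\<^sub>R dd (\<lambda>y. P y b) y v + (dd x y v \<bullet> b) *\<^sub>R P y b)) (at y)"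
      proof (rule has_derivative_transform_within_open[OF _ assms(1) y])
        fix z assume "z \<in> S"
        then show "(\<Sum>b\<in>Basis. (x z \<bullet> b) *\<^sub>R P z b) = q z"
          using Suc.prems(3) rep by metis
      qed
      then have "dd q y v = (\<Sum>b\<in>Basis. (x y \<bullet> b) *\<^sub>R dd (\<lambda>y. P y b) y v) + (\<Sum>b\<in>Basis. (dd x y v \<bullet> b) *\<^sub>R P y b)"
        by (simp add: dd_eqI sum.distrib)
      then show "P y (dd x y v) = ?q y"
        by (simp add: rep[OF y, of "dd x y v"])
    qed
  qed
qed

lemma smooth_on_linear_solution:
  fixes P :: "'y::euclidean_space \<Rightarrow> 'h::euclidean_space \<Rightarrow> 'v::euclidean_space"
  assumes "open S" "\<And>y. y \<in> S \<Longrightarrow> linear (P y)" "\<And>y. y \<in> S \<Longrightarrow> inj (P y)"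
    "\<And>w. smooth_on S (\<lambda>y. P y w)" "smooth_on S q" "\<And>y. y \<in> S \<Longrightarrow> P y (x y) = q y"
  shows "smooth_on S x"
  unfolding smooth_on_def
proof
  show "Ck_on k S x" for k
    by (rule Ck_on_linear_solution[where P = P and q = q])
       (use assms(1-5) in \<open>simp_all add: smooth_on_def assms(6)\<close>)
qed

section \<open>Lifting through immersions\<close>

text \<open>A left inverse \<open>L\<close> of \<open>\<phi>'\<close> turns the expansions of \<open>\<phi>\<close> and of \<open>\<phi> \<circ> t\<close> into one of \<open>t\<close>; a
preliminary Lipschitz estimate for \<open>t\<close> is needed to replace errors relative to \<open>t z - t y\<close> by errors relative to \<open>z - y\<close>.\<close>

lemma lift_differentiable:
  fixes \<phi> :: "'h::euclidean_space \<Rightarrow> 'v::euclidean_space" and t :: "'y::euclidean_space \<Rightarrow> 'h"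
  assumes "isCont t y" "(\<phi> has_derivative \<phi>') (at (t y))" "inj \<phi>'"
    "((\<lambda>y. \<phi> (t y)) has_derivative F') (at y)"
  shows "t differentiable (at y)"
proof -
  have lin: "linear \<phi>'" using assms(2) has_derivative_linear by blast
  obtain L C where L: "bounded_linear L" "\<And>x. L (\<phi>' x) = x" and C: "C > 0" "\<And>v. norm (L v) \<le> C * norm v"
    using linear_injective_bounded_left_inverse[OF lin assms(3)] by metis
  have blF: "bounded_linear F'" by (rule has_derivative_bounded_linear[OF assms(4)])
  obtain K where K: "K > 0" "\<And>v. norm (F' v) \<le> norm v * K"
    using bounded_linear.pos_bounded[OF blF] by auto
  note \<phi> = assms(2)[unfolded has_derivative_at_alt, THEN conjunct2, rule_format]
  note F = assms(4)[unfolded has_derivative_at_alt, THEN conjunct2, rule_format]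
  define B where "B = 2 * C * (K + 1)"
  have B: "B > 0" using C K by (simp add: B_def)
  have Lsub: "L (a - b) = L a - L b" for a b
    by (rule linear_diff[OF bounded_linear.linear[OF L(1)]]) 
  obtain d1 where d1: "d1 > 0" "\<And>z. norm (z - t y) < d1 \<Longrightarrow>
      norm (\<phi> z - \<phi> (t y) - \<phi>' (z - t y)) \<le> 1 / (2 * C) * norm (z - t y)"
    using \<phi>[of "1 / (2 * C)"] C by auto
  obtain d2 where d2: "d2 > 0" "\<And>z. norm (z - y) < d2 \<Longrightarrow>
      norm (\<phi> (t z) - \<phi> (t y) - F' (z - y)) \<le> 1 * norm (z - y)"
    using F[of 1] by auto
  have tnear: "\<exists>\<delta>>0. \<forall>z. norm (z - y) < \<delta> \<longrightarrow> norm (t z - t y) < d" if "d > 0" for d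
    using assms(1) that unfolding continuous_at_eps_delta by (simp add: dist_norm)
  obtain d3 where d3: "d3 > 0" "\<And>z. norm (z - y) < d3 \<Longrightarrow> norm (t z - t y) < d1"
    using tnear[OF d1(1)] by auto
  have lip: "norm (t z - t y) \<le> B * norm (z - y)" if "norm (z - y) < min d2 d3" for z
  proof -
    have "norm (t z - t y) = norm (L (\<phi> (t z) - \<phi> (t y)) - L (\<phi> (t z) - \<phi> (t y) - \<phi>' (t z - t y)))"
      by (simp add: Lsub L)
    also have "\<dots> \<le> C * norm (\<phi> (t z) - \<phi> (t y)) + C * norm (\<phi> (t z) - \<phi> (t y) - \<phi>' (t z - t y))"
      by (intro order_trans[OF norm_triangle_ineq4] add_mono C)
    also have "C * norm (\<phi> (t z) - \<phi> (t y) - \<phi>' (t z - t y)) \<le> C * (1 / (2 * C) * norm (t z - t y))"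
      using d1 d3 that C by (intro mult_left_mono) auto
    also have "\<dots> = norm (t z - t y) / 2" using C by simp
    finally have "norm (t z - t y) \<le> 2 * C * norm (\<phi> (t z) - \<phi> (t y))" by simp
    also have "norm (\<phi> (t z) - \<phi> (t y)) \<le> norm (z - y) + norm (z - y) * K"
      using d2(2)[of z] K(2)[of "z - y"] that
        norm_triangle_ineq[of "\<phi> (t z) - \<phi> (t y) - F' (z - y)" "F' (z - y)"] by simp
    finally show ?thesis using C by (simp add: B_def algebra_simps)
  qed
  have "(t has_derivative (\<lambda>v. L (F' v))) (at y)"
    unfolding has_derivative_at_alt
  proof (intro conjI allI impI)
    show "bounded_linear (\<lambda>v. L (F' v))"
      using bounded_linear_compose[OF L(1) blF] .
    fix e :: real assume e: "e > 0"
    obtain d4 where d4: "d4 > 0" "\<And>z. norm (z - t y) < d4 \<Longrightarrow>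
      norm (\<phi> z - \<phi> (t y) - \<phi>' (z - t y)) \<le> e / (2 * C * B) * norm (z - t y)"
      using \<phi>[of "e / (2 * C * B)"] C B e by auto
    obtain d5 where d5: "d5 > 0" "\<And>z. norm (z - y) < d5 \<Longrightarrow>
      norm (\<phi> (t z) - \<phi> (t y) - F' (z - y)) \<le> e / (2 * C) * norm (z - y)"
      using F[of "e / (2 * C)"] C e by auto
    obtain d6 where d6: "d6 > 0" "\<And>z. norm (z - y) < d6 \<Longrightarrow> norm (t z - t y) < d4"
      using tnear[OF d4(1)] by auto
    show "\<exists>d>0. \<forall>z. norm (z - y) < d \<longrightarrow> norm (t z - t y - L (F' (z - y))) \<le> e * norm (z - y)"
    proof (intro exI[of _ "min (min d2 d3) (min d5 d6)"] conjI allI impI)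
      fix z assume z: "norm (z - y) < min (min d2 d3) (min d5 d6)"
      have "norm (t z - t y - L (F' (z - y)))
        = norm (L (\<phi> (t z) - \<phi> (t y) - F' (z - y)) - L (\<phi> (t z) - \<phi> (t y) - \<phi>' (t z - t y)))"
        by (simp only: Lsub L(2)) (simp add: algebra_simps)
      also have "\<dots> \<le> C * norm (\<phi> (t z) - \<phi> (t y) - F' (z - y)) + C * norm (\<phi> (t z) - \<phi> (t y) - \<phi>' (t z - t y))"
        by (intro order_trans[OF norm_triangle_ineq4] add_mono C)
      also have "\<dots> \<le> C * (e / (2 * C) * norm (z - y)) + C * (e / (2 * C * B) * (B * norm (z - y)))"
      proof (intro add_mono mult_left_mono)
        have "norm (\<phi> (t z) - \<phi> (t y) - \<phi>' (t z - t y)) \<le> e / (2 * C * B) * norm (t z - t y)"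
          using d4 d6 z by auto
        also have "\<dots> \<le> e / (2 * C * B) * (B * norm (z - y))"
          using lip[of z] z e C B by (intro mult_left_mono) auto
        finally show "norm (\<phi> (t z) - \<phi> (t y) - \<phi>' (t z - t y)) \<le> e / (2 * C * B) * (B * norm (z - y))" .
      qed (use d5 z C in auto)
      also have "\<dots> = e * norm (z - y)" using C B by (simp add: field_simps)
      finally show "norm (t z - t y - L (F' (z - y))) \<le> e * norm (z - y)" .
    qed (use d2 d3 d5 d6 in auto)
  qed
  then show ?thesis by (auto simp: differentiable_def)
qed

text \<open>Once \<open>t\<close> is differentiable, its derivative solves the linear equation \<open>dd \<phi> (t y) (dd t y v) = dd (\<phi> \<circ> t) y v\<close> whose
coefficients are as smooth as \<open>t\<close>, so smoothness follows by bootstrapping.  This covers transition maps of submanifold charts,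
maps into submanifolds and inverse functions.\<close>

lemma smooth_on_lift:
  fixes \<phi> :: "'h::euclidean_space \<Rightarrow> 'v::euclidean_space" and t :: "'y::euclidean_space \<Rightarrow> 'h"
  assumes "open S" "open V" "smooth_on V \<phi>" "\<And>z. z \<in> V \<Longrightarrow> inj (dd \<phi> z)"
    "continuous_on S t" "t ` S \<subseteq> V" "smooth_on S (\<lambda>y. \<phi> (t y))"
  shows "smooth_on S t"
proof -
  have td: "t differentiable (at y)" if "y \<in> S" for y
  proof (rule lift_differentiable)
    show "isCont t y" using assms(1,5) that by (simp add: continuous_on_eq_continuous_at)
    show "(\<phi> has_derivative dd \<phi> (t y)) (at (t y))"
      using assms(3,6) that by (intro smooth_on_has_derivative) auto
    show "((\<lambda>y. \<phi> (t y)) has_derivative dd (\<lambda>y. \<phi> (t y)) y) (at y)"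
      using assms(7) that by (intro smooth_on_has_derivative)
  qed (use assms that in auto)
  have "Ck_on k S t" for k
  proof (induction k)
    case 0
    then show ?case using assms(5) by simp
  next
    case (Suc k)
    show ?case
    proof (rule Ck_on_SucI[OF assms(1) dd_works[OF td]])
      fix v
      show "Ck_on k S (\<lambda>y. dd t y v)"
      proof (rule Ck_on_linear_solution[OF assms(1), of "\<lambda>y. dd \<phi> (t y)"])
        show "linear (dd \<phi> (t y))" if "y \<in> S" for y
          using assms(3,6) that by (intro linear_frechet_derivative smooth_on_imp_differentiable) auto
        show "inj (dd \<phi> (t y))" if "y \<in> S" for y
          using assms(4,6) that by auto
        show "Ck_on k S (\<lambda>y. dd \<phi> (t y) w)" for w
          by (rule Ck_on_compose[OF assms(1) Suc _ assms(6)])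
             (use smooth_on_dd[OF assms(3)] in \<open>auto simp: smooth_on_def\<close>)
        show "Ck_on k S (\<lambda>y. dd (\<lambda>y. \<phi> (t y)) y v)"
          using smooth_on_dd[OF assms(7)] by (simp add: smooth_on_def)
        fix y assume y: "y \<in> S"
        have "((\<lambda>y. \<phi> (t y)) has_derivative (\<lambda>v. dd \<phi> (t y) (dd t y v))) (at y)"
          by (rule has_derivative_compose[OF dd_works[OF td[OF y]]])
             (use assms(3,6) y in \<open>auto intro!: smooth_on_has_derivative\<close>)
        then show "dd \<phi> (t y) (dd t y v) = dd (\<lambda>y. \<phi> (t y)) y v"
          by (simp add: dd_eqI)
      qed
    qed
  qed
  then show ?thesis by (simp add: smooth_on_def)
qed

section \<open>Flat linear systems\<close>

text \<open>The system is \<open>du = u \<theta>\<close>, where \<open>\<theta>\<close> is a one-form with values in a space \<open>'b\<close> that acts on the values of \<open>u\<close> from the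
right by \<open>prod\<close>.  The assumption \<open>flat\<close> is the symmetry of the second derivative that the system prescribes.  The
constants are chosen such that the Picard operator contracts by the factor \<open>1/2\<close>, also for the defects.\<close>

locale flat_system = bounded_bilinear prod
  for prod :: "'w::banach \<Rightarrow> 'b::real_normed_vector \<Rightarrow> 'w" +
  fixes \<theta> :: "'e::euclidean_space \<Rightarrow> 'e \<Rightarrow>\<^sub>L 'b" and \<theta>' :: "'e \<Rightarrow> 'e \<Rightarrow>\<^sub>L ('e \<Rightarrow>\<^sub>L 'b)"
    and K C \<delta> :: real
  assumes deriv: "y \<in> ball 0 \<delta> \<Longrightarrow> (\<theta> has_derivative blinfun_apply (\<theta>' y)) (at y)"
    and cont: "continuous_on (ball 0 \<delta>) \<theta>'"
    and prod_bound: "norm (prod a b) \<le> K * norm a * norm b"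
    and \<theta>_bound: "y \<in> ball 0 \<delta> \<Longrightarrow> norm (\<theta> y) \<le> C"
    and nonneg: "K \<ge> 0" "C \<ge> 0" "\<delta> > 0"
    and small: "K * C * \<delta> \<le> 1 / 4"
    and flat: "y \<in> ball 0 \<delta> \<Longrightarrow> prod x (\<theta>' y w z) + prod (prod x (\<theta> y w)) (\<theta> y z)
       = prod x (\<theta>' y z w) + prod (prod x (\<theta> y z)) (\<theta> y w)"
begin

abbreviation S :: "'e set" where "S \<equiv> ball 0 \<delta>"

lemma ray: "y \<in> S \<Longrightarrow> t \<in> {0..1} \<Longrightarrow> t *\<^sub>R y \<in> S"
proof -
  assume "y \<in> S" "t \<in> {0..1}"
  then have "t * norm y \<le> 1 * norm y" by (intro mult_right_mono) auto
  then show "t *\<^sub>R y \<in> S" using \<open>y \<in> S\<close> \<open>t \<in> {0..1}\<close> by simp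
qed

lemma cont_\<theta>: "continuous_on S \<theta>"
  using deriv by (meson continuous_at_imp_continuous_on has_derivative_continuous)

text \<open>A solution restricted to the ray from \<open>0\<close> to \<open>y\<close> satisfies an ordinary differential equation; \<open>step\<close> is its Picard
operator at time \<open>1\<close>, for all rays at once.\<close>

definition step :: "'w \<Rightarrow> ('e \<Rightarrow> 'w) \<Rightarrow> 'e \<Rightarrow> 'w" where
  "step x0 u y = x0 + integral {0..1} (\<lambda>t. prod (u (t *\<^sub>R y)) (\<theta> (t *\<^sub>R y) y))"

definition step_integrand' :: "('e \<Rightarrow> 'w) \<Rightarrow> ('e \<Rightarrow> 'e \<Rightarrow>\<^sub>L 'w) \<Rightarrow> 'e \<Rightarrow> real \<Rightarrow> 'e \<Rightarrow>\<^sub>L 'w" where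
  "step_integrand' u u' y t = t *\<^sub>R (prod_left (\<theta> (t *\<^sub>R y) y) o\<^sub>L u' (t *\<^sub>R y)) +
     (prod_right (u (t *\<^sub>R y)) o\<^sub>L (t *\<^sub>R (blinfun.prod_left y o\<^sub>L \<theta>' (t *\<^sub>R y)) + \<theta> (t *\<^sub>R y)))"

definition step' :: "('e \<Rightarrow> 'w) \<Rightarrow> ('e \<Rightarrow> 'e \<Rightarrow>\<^sub>L 'w) \<Rightarrow> 'e \<Rightarrow> 'e \<Rightarrow>\<^sub>L 'w" where
  "step' u u' y = integral {0..1} (step_integrand' u u' y)"

lemma step_integrand'_apply:
  "step_integrand' u u' y t w = t *\<^sub>R prod (u' (t *\<^sub>R y) w) (\<theta> (t *\<^sub>R y) y)
     + prod (u (t *\<^sub>R y)) (t *\<^sub>R \<theta>' (t *\<^sub>R y) w y + \<theta> (t *\<^sub>R y) w)"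
  by (simp add: step_integrand'_def blinfun.bilinear_simps)

definition C1 :: "('e \<Rightarrow> 'w) \<Rightarrow> ('e \<Rightarrow> 'e \<Rightarrow>\<^sub>L 'w) \<Rightarrow> bool" where
  "C1 u u' \<longleftrightarrow> (\<forall>y\<in>S. (u has_derivative blinfun_apply (u' y)) (at y)) \<and> continuous_on S u'"

lemma C1_continuous: "C1 u u' \<Longrightarrow> continuous_on S u"
  unfolding C1_def by (meson continuous_at_imp_continuous_on has_derivative_continuous)

lemma continuous_on_ray:
  assumes "continuous_on S h"
  shows "continuous_on (S \<times> {0..1}) (\<lambda>p. h (snd p *\<^sub>R fst p))"
  by (rule continuous_on_compose2[OF assms]) (auto intro!: continuous_intros ray simp del: mem_ball)

lemma continuous_on_ray1:
  assumes "continuous_on S h" "y \<in> S"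
  shows "continuous_on {0..1} (\<lambda>t. h (t *\<^sub>R y))"
  by (rule continuous_on_compose2[OF assms(1)]) (use assms(2) in \<open>auto intro!: continuous_intros ray simp del: mem_ball\<close>)

lemma continuous_step_integrand':
  assumes "C1 u u'"
  shows "continuous_on (S \<times> {0..1}) (\<lambda>p. step_integrand' u u' (fst p) (snd p))"
proof -
  have u: "continuous_on S u" "continuous_on S u'"
    using assms C1_continuous by (auto simp: C1_def)
  note [continuous_intros] = continuous_on_ray[OF u(1)] continuous_on_ray[OF u(2)]
    continuous_on_ray[OF cont_\<theta>] continuous_on_ray[OF cont]
    bounded_linear.continuous_on[OF bounded_linear_prod_left]
    bounded_linear.continuous_on[OF bounded_linear_prod_right]
    bounded_linear.continuous_on[OF blinfun.bounded_linear_prod_left]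
    bounded_bilinear.continuous_on[OF bounded_bilinear_blinfun_compose]
  show ?thesis
    unfolding step_integrand'_def by (intro continuous_intros)
qed

lemma integrand_continuous:
  assumes "continuous_on S u" "y \<in> S"
  shows "continuous_on {0..1} (\<lambda>t. prod (u (t *\<^sub>R y)) (\<theta> (t *\<^sub>R y) y))"
  by (intro continuous_on continuous_on_ray1 assms blinfun.continuous_on cont_\<theta> continuous_on_const)

lemma step_has_derivative:
  assumes "C1 u u'" "y \<in> S"
  shows "(step x0 u has_derivative blinfun_apply (step' u u' y)) (at y)"
proof -
  have *: "((\<lambda>y. prod (u (t *\<^sub>R y)) (\<theta> (t *\<^sub>R y) y)) has_derivative
      blinfun_apply (step_integrand' u u' y t)) (at y within S)" if "y \<in> S" "t \<in> {0..1}" for y t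
  proof -
    have s: "((\<lambda>y. t *\<^sub>R y) has_derivative (\<lambda>w. t *\<^sub>R w)) (at y)"
      by (auto intro!: derivative_eq_intros)
    have "(u has_derivative u' (t *\<^sub>R y)) (at (t *\<^sub>R y))" "(\<theta> has_derivative \<theta>' (t *\<^sub>R y)) (at (t *\<^sub>R y))"
      using assms(1) deriv ray[OF that] by (auto simp: C1_def)
    note d = has_derivative_compose[OF s this(1)] has_derivative_compose[OF s this(2)]
    have "((\<lambda>y. prod (u (t *\<^sub>R y)) (\<theta> (t *\<^sub>R y) y)) has_derivative
      (\<lambda>w. prod (u (t *\<^sub>R y)) (\<theta> (t *\<^sub>R y) w + \<theta>' (t *\<^sub>R y) (t *\<^sub>R w) y)
         + prod (u' (t *\<^sub>R y) (t *\<^sub>R w)) (\<theta> (t *\<^sub>R y) y))) (at y)"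
      by (intro FDERIV d blinfun.FDERIV has_derivative_ident)
    moreover have "(\<lambda>w. prod (u (t *\<^sub>R y)) (\<theta> (t *\<^sub>R y) w + \<theta>' (t *\<^sub>R y) (t *\<^sub>R w) y)
         + prod (u' (t *\<^sub>R y) (t *\<^sub>R w)) (\<theta> (t *\<^sub>R y) y)) = blinfun_apply (step_integrand' u u' y t)"
      by (simp add: fun_eq_iff step_integrand'_apply blinfun.bilinear_simps bilinear_simps)
    ultimately show ?thesis by (simp add: has_derivative_at_withinI)
  qed
  have "((\<lambda>y. integral (cbox 0 1) (\<lambda>t. prod (u (t *\<^sub>R y)) (\<theta> (t *\<^sub>R y) y))) has_derivative
      integral (cbox 0 1) (step_integrand' u u' y)) (at y within S)"
  proof (rule leibniz_rule[OF _ _ _ assms(2)])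
    show "(\<lambda>t. prod (u (t *\<^sub>R y)) (\<theta> (t *\<^sub>R y) y)) integrable_on cbox 0 1" if "y \<in> S" for y
      using integrand_continuous[OF C1_continuous[OF assms(1)] that] integrable_continuous_interval by force
    show "continuous_on (S \<times> cbox 0 1) (\<lambda>(x, t). step_integrand' u u' x t)"
      using continuous_step_integrand'[OF assms(1)] by (simp add: split_def)
  qed (use * in auto)
  then have "((\<lambda>y. integral (cbox 0 1) (\<lambda>t. prod (u (t *\<^sub>R y)) (\<theta> (t *\<^sub>R y) y))) has_derivative
      integral (cbox 0 1) (step_integrand' u u' y)) (at y)"
    using at_within_open[OF assms(2) open_ball] by simp
  from has_derivative_add[OF has_derivative_const[of x0] this]
  show ?thesis
    unfolding step_def[abs_def] step'_def by (simp only: add_0 cbox_interval)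
qed

lemma step_C1:
  assumes "C1 u u'"
  shows "C1 (step x0 u) (step' u u')"
  unfolding C1_def
proof
  have "continuous_on S (\<lambda>y. integral (cbox 0 1) (step_integrand' u u' y))"
    using continuous_step_integrand'[OF assms]
    by (intro integral_continuous_on_param) (simp add: split_def)
  then show "continuous_on S (step' u u')"
    by (simp add: step'_def[abs_def])
qed (use step_has_derivative[OF assms] in auto)

text \<open>The error \<open>du - u \<theta>\<close> in all directions \<open>w\<close>; the Picard operator by itself controls only the direction of the rays.\<close>

definition defect :: "('e \<Rightarrow> 'w) \<Rightarrow> ('e \<Rightarrow> 'e \<Rightarrow>\<^sub>L 'w) \<Rightarrow> 'e \<Rightarrow> 'e \<Rightarrow> 'w" where
  "defect u u' y w = u' y w - prod (u y) (\<theta> y w)"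

text \<open>The derivative under the integral is compared with the derivative in \<open>t\<close> of \<open>t u(ty) \<theta>(ty)(w)\<close>.  By
flatness the difference can be written in terms of the defect of \<open>u\<close> alone.\<close>

lemma step'_eq:
  assumes u: "C1 u u'" and y: "y \<in> S"
  shows "step' u u' y w = prod (u y) (\<theta> y w) + integral {0..1}
     (\<lambda>t. t *\<^sub>R (prod (defect u u' (t *\<^sub>R y) w) (\<theta> (t *\<^sub>R y) y) - prod (defect u u' (t *\<^sub>R y) y) (\<theta> (t *\<^sub>R y) w)))"
proof -
  have cu: "continuous_on S u" "continuous_on S u'"
    using u C1_continuous by (auto simp: C1_def)
  note [continuous_intros] = continuous_on continuous_on_ray1[OF cu(1) y] continuous_on_ray1[OF cu(2) y]
     continuous_on_ray1[OF cont_\<theta> y] continuous_on_ray1[OF cont y] blinfun.continuous_on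
  let ?g = "\<lambda>t. t *\<^sub>R prod (u (t *\<^sub>R y)) (\<theta> (t *\<^sub>R y) w)"
  let ?g' = "\<lambda>t. t *\<^sub>R (prod (u (t *\<^sub>R y)) (\<theta>' (t *\<^sub>R y) y w) + prod (u' (t *\<^sub>R y) y) (\<theta> (t *\<^sub>R y) w))
       + prod (u (t *\<^sub>R y)) (\<theta> (t *\<^sub>R y) w)"
  let ?h = "\<lambda>t. t *\<^sub>R (prod (defect u u' (t *\<^sub>R y) w) (\<theta> (t *\<^sub>R y) y) - prod (defect u u' (t *\<^sub>R y) y) (\<theta> (t *\<^sub>R y) w))"
  have "(?g' has_integral ?g 1 - ?g 0) {0..1}"
  proof (rule fundamental_theorem_of_calculus)
    fix t :: real assume t: "t \<in> {0..1}"
    have s: "((\<lambda>t. t *\<^sub>R y) has_derivative (\<lambda>h. h *\<^sub>R y)) (at t)"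
      by (auto intro!: derivative_eq_intros)
    have "(u has_derivative u' (t *\<^sub>R y)) (at (t *\<^sub>R y))" "(\<theta> has_derivative \<theta>' (t *\<^sub>R y)) (at (t *\<^sub>R y))"
      using u deriv ray[OF y t] by (auto simp: C1_def)
    note d = has_derivative_compose[OF s this(1)] has_derivative_compose[OF s this(2)]
    have "(?g has_derivative (\<lambda>h. t *\<^sub>R (prod (u (t *\<^sub>R y)) (\<theta> (t *\<^sub>R y) 0 + \<theta>' (t *\<^sub>R y) (h *\<^sub>R y) w)
         + prod (u' (t *\<^sub>R y) (h *\<^sub>R y)) (\<theta> (t *\<^sub>R y) w)) + h *\<^sub>R prod (u (t *\<^sub>R y)) (\<theta> (t *\<^sub>R y) w))) (at t)"
      by (intro has_derivative_scaleR FDERIV d blinfun.FDERIV has_derivative_ident has_derivative_const)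
    then have "(?g has_vector_derivative ?g' t) (at t)"
      unfolding has_vector_derivative_def
      by (rule has_derivative_eq_rhs) (simp add: fun_eq_iff blinfun.bilinear_simps bilinear_simps algebra_simps)
    then show "(?g has_vector_derivative ?g' t) (at t within {0..1})"
      by (rule has_vector_derivative_at_within)
  qed simp
  then have i1: "(?g' has_integral prod (u y) (\<theta> y w)) {0..1}" by simp
  have "continuous_on {0..1} ?h"
    unfolding defect_def by (intro continuous_intros)
  then have i2: "(?h has_integral integral {0..1} ?h) {0..1}"
    by (intro integrable_integral integrable_continuous_interval)
  \<comment> \<open>This is the only place where flatness enters.\<close>
  have eq: "?g' t + ?h t = step_integrand' u u' y t w" if "t \<in> {0..1}" for t
    using arg_cong[OF flat[OF ray[OF y that], of "u (t *\<^sub>R y)" w y], of "\<lambda>x. t *\<^sub>R x"]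
    by (simp add: step_integrand'_apply defect_def bilinear_simps algebra_simps)
  have "((\<lambda>t. step_integrand' u u' y t w) has_integral prod (u y) (\<theta> y w) + integral {0..1} ?h) {0..1}"
    by (rule has_integral_eq[OF _ has_integral_add[OF i1 i2]]) (rule eq)
  moreover have "step_integrand' u u' y integrable_on {0..1}"
  proof (rule integrable_continuous_interval)
    have "continuous_on {0..1} (\<lambda>t. (y, t))" by (intro continuous_intros)
    moreover have "(\<lambda>t. (y, t)) ` {0..1} \<subseteq> S \<times> {0..1}" using y by blast
    ultimately show "continuous_on {0..1} (step_integrand' u u' y)"
      using continuous_on_compose2[OF continuous_step_integrand'[OF u]] by fastforce
  qed
  ultimately show ?thesis
    unfolding step'_def by (simp add: blinfun_apply_integral integral_unique)
qed

lemma defect_step: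
  assumes u: "C1 u u'" and D: "\<And>y. y \<in> S \<Longrightarrow> norm (u y - step x0 u y) \<le> D"
    and E: "\<And>y w. y \<in> S \<Longrightarrow> norm (defect u u' y w) \<le> E * norm w" and y: "y \<in> S"
  shows "norm (defect (step x0 u) (step' u u') y w) \<le> (K * C * D + E / 2) * norm w"
proof -
  have cu: "continuous_on S u" "continuous_on S u'"
    using u C1_continuous by (auto simp: C1_def)
  note [continuous_intros] = continuous_on continuous_on_ray1[OF cu(1) y] continuous_on_ray1[OF cu(2) y]
     continuous_on_ray1[OF cont_\<theta> y] continuous_on_ray1[OF cont y] blinfun.continuous_on
  let ?h = "\<lambda>t. t *\<^sub>R (prod (defect u u' (t *\<^sub>R y) w) (\<theta> (t *\<^sub>R y) y) - prod (defect u u' (t *\<^sub>R y) y) (\<theta> (t *\<^sub>R y) w))"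
  have D0: "D \<ge> 0" by (rule order_trans[OF norm_ge_zero D[OF y]])
  have E0: "0 \<le> E * norm w" for w :: 'e by (rule order_trans[OF norm_ge_zero E[OF y]])
  have ny: "norm y \<le> \<delta>" using y by simp
  have i1: "norm (integral {0..1} ?h) \<le> (E / 2 * norm w) * (1 - 0)"
  proof (rule integral_bound)
    show "continuous_on {0..1} ?h"
      unfolding defect_def by (intro continuous_intros)
    fix t :: real assume t: "t \<in> {0..1}"
    note r = ray[OF y t]
    have b\<theta>: "norm (\<theta> (t *\<^sub>R y) z) \<le> C * norm z" for z
      using norm_blinfun[of "\<theta> (t *\<^sub>R y)" z] \<theta>_bound[OF r] mult_right_mono[OF _ norm_ge_zero] order_trans by blast
    have P: "norm (prod (defect u u' (t *\<^sub>R y) a) (\<theta> (t *\<^sub>R y) b)) \<le> K * C * E * norm a * norm b" for a b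
    proof -
      have "norm (prod (defect u u' (t *\<^sub>R y) a) (\<theta> (t *\<^sub>R y) b)) \<le> K * (E * norm a) * (C * norm b)"
        by (rule order_trans[OF prod_bound], intro mult_mono mult_nonneg_nonneg[OF nonneg(1) E0])
           (use E[OF r, of a] b\<theta>[of b] nonneg in auto)
      then show ?thesis by (simp add: mult_ac)
    qed
    have "norm (?h t) \<le> 1 * norm (prod (defect u u' (t *\<^sub>R y) w) (\<theta> (t *\<^sub>R y) y) - prod (defect u u' (t *\<^sub>R y) y) (\<theta> (t *\<^sub>R y) w))"
      unfolding norm_scaleR using t by (intro mult_right_mono) auto
    also have "\<dots> \<le> K * C * E * norm w * norm y + K * C * E * norm y * norm w"
      unfolding mult_1 by (intro order_trans[OF norm_triangle_ineq4] add_mono P)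
    also have "\<dots> = (2 * (K * C * norm y)) * (E * norm w)" by (simp add: algebra_simps)
    also have "K * C * norm y \<le> K * C * \<delta>"
      using nonneg ny by (intro mult_left_mono) auto
    then have "(2 * (K * C * norm y)) * (E * norm w) \<le> (1 / 2) * (E * norm w)"
      using small E0[of w] by (intro mult_right_mono) auto
    finally show "norm (?h t) \<le> E / 2 * norm w" by simp
  qed simp
  have i2: "norm (prod (u y - step x0 u y) (\<theta> y w)) \<le> K * C * D * norm w"
  proof -
    have "norm (\<theta> y w) \<le> C * norm w"
      using norm_blinfun[of "\<theta> y" w] \<theta>_bound[OF y] mult_right_mono[OF _ norm_ge_zero] order_trans by blast
    then have "norm (prod (u y - step x0 u y) (\<theta> y w)) \<le> K * D * (C * norm w)"
      using D[OF y] nonneg D0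
      by (intro order_trans[OF prod_bound] mult_mono mult_nonneg_nonneg) auto
    then show ?thesis by (simp add: mult_ac)
  qed
  have i3: "defect (step x0 u) (step' u u') y w = prod (u y - step x0 u y) (\<theta> y w) + integral {0..1} ?h"
    unfolding defect_def[of "step x0 u"] step'_eq[OF u y] by (simp add: bilinear_simps)
  have "norm (defect (step x0 u) (step' u u') y w) \<le> K * C * D * norm w + E / 2 * norm w"
    unfolding i3 by (rule norm_triangle_mono[OF i2]) (use i1 in simp)
  then show ?thesis by (simp add: algebra_simps)
qed

lemma step_contract:
  assumes "continuous_on S u" "continuous_on S v" "\<And>y. y \<in> S \<Longrightarrow> norm (u y - v y) \<le> D" "y \<in> S"
  shows "norm (step x0 u y - step x0 v y) \<le> D / 2"
proof -
  have D0: "D \<ge> 0" by (rule order_trans[OF norm_ge_zero assms(3)[OF assms(4)]])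
  note c = integrand_continuous[OF assms(1,4)] integrand_continuous[OF assms(2,4)]
  have "step x0 u y - step x0 v y =
      integral {0..1} (\<lambda>t. prod (u (t *\<^sub>R y)) (\<theta> (t *\<^sub>R y) y) - prod (v (t *\<^sub>R y)) (\<theta> (t *\<^sub>R y) y))"
    unfolding step_def using c by (simp add: integral_diff integrable_continuous_interval)
  also have "norm \<dots> \<le> D / 2 * (1 - 0)"
  proof (rule integral_bound)
    fix t :: real assume t: "t \<in> {0..1}"
    note r = ray[OF assms(4) t]
    have "norm (\<theta> (t *\<^sub>R y) y) \<le> C * norm y"
      using norm_blinfun[of "\<theta> (t *\<^sub>R y)" y] \<theta>_bound[OF r] mult_right_mono[OF _ norm_ge_zero] order_trans by blast
    also have "\<dots> \<le> C * \<delta>" using assms(4) nonneg by (intro mult_left_mono) auto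
    finally have "norm (prod (u (t *\<^sub>R y) - v (t *\<^sub>R y)) (\<theta> (t *\<^sub>R y) y)) \<le> K * D * (C * \<delta>)"
      using assms(3)[OF r] nonneg D0
      by (intro order_trans[OF prod_bound] mult_mono mult_nonneg_nonneg) auto
    also have "\<dots> = (K * C * \<delta>) * D" by (simp add: mult_ac)
    also have "\<dots> \<le> (1 / 2) * D" using small D0 by (intro mult_right_mono) auto
    finally show "norm (prod (u (t *\<^sub>R y)) (\<theta> (t *\<^sub>R y) y) - prod (v (t *\<^sub>R y)) (\<theta> (t *\<^sub>R y) y)) \<le> D / 2"
      by (simp add: bilinear_simps)
  qed (use c in \<open>auto intro: continuous_on_diff\<close>)
  finally show ?thesis by simp
qed

text \<open>The Picard iterates \<open>u n\<close> converge geometrically.  The defects satisfy \<open>e (n + 1) \<le> e n / 2 + const / 2 ^ n\<close>, so they tend to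
\<open>0\<close> like \<open>n / 2 ^ n\<close>.  Hence the derivatives of the iterates converge uniformly to \<open>v \<theta>\<close>, where \<open>v\<close> is the limit.\<close>

lemma solution_exists:
  obtains u where "u 0 = x0" "\<And>y. y \<in> S \<Longrightarrow> (u has_derivative (\<lambda>w. prod (u y) (\<theta> y w))) (at y)"
proof -
  define U where "U = rec_nat (\<lambda>y. x0, \<lambda>y. 0) (\<lambda>n p. (step x0 (fst p), step' (fst p) (snd p)))"
  define u where "u n = fst (U n)" for n
  define u' where "u' n = snd (U n)" for n
  have u0: "u 0 = (\<lambda>y. x0)" "u' 0 = (\<lambda>y. 0)" by (simp_all add: u_def u'_def U_def)
  have uS: "u (Suc n) = step x0 (u n)" "u' (Suc n) = step' (u n) (u' n)" for n
    by (simp_all add: u_def u'_def U_def)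
  have C1u: "C1 (u n) (u' n)" for n
  proof (induction n)
    case 0
    show ?case by (auto simp: u0 C1_def zero_blinfun.rep_eq)
  next
    case (Suc n)
    then show ?case by (simp add: uS step_C1)
  qed
  have c: "continuous_on S (u n)" for n by (rule C1_continuous[OF C1u])
  define d where "d = norm x0"
  have d: "d \<ge> 0" by (simp add: d_def)
  have diff: "norm (u n y - u (Suc n) y) \<le> d / 2 ^ n" if "y \<in> S" for n y
    using that
  proof (induction n arbitrary: y)
    case 0
    have z: "step x0 (\<lambda>y. 0) y = x0" for y by (simp add: step_def zero_left)
    have "norm (step x0 (\<lambda>y. 0) y - step x0 (u 0) y) \<le> d / 2"
      by (rule step_contract) (use 0 c in \<open>auto simp: u0 d_def\<close>)
    then show ?case using d by (simp add: u0 uS z)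
  next
    case (Suc n)
    have "norm (step x0 (u n) y - step x0 (u (Suc n)) y) \<le> (d / 2 ^ n) / 2"
      by (rule step_contract) (use Suc c in auto)
    then show ?case by (simp add: uS(1) mult.commute)
  qed
  have def: "norm (defect (u n) (u' n) y w) \<le> ((K * C * d + 2 * K * C * d * n) / 2 ^ n) * norm w" if "y \<in> S" for n y w
    using that
  proof (induction n arbitrary: y w)
    case 0
    have "norm (\<theta> y w) \<le> C * norm w"
      using norm_blinfun[of "\<theta> y" w] \<theta>_bound[OF 0] mult_right_mono[OF _ norm_ge_zero] order_trans by blast
    then have "norm (prod x0 (\<theta> y w)) \<le> K * d * (C * norm w)"
      using nonneg d by (intro order_trans[OF prod_bound] mult_mono mult_nonneg_nonneg) (auto simp: d_def)
    then show ?case by (simp add: defect_def u0 zero_blinfun.rep_eq mult_ac)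
  next
    case (Suc n)
    have "norm (defect (u (Suc n)) (u' (Suc n)) y w) \<le> (K * C * (d / 2 ^ n) + ((K * C * d + 2 * K * C * d * n) / 2 ^ n) / 2) * norm w"
      unfolding uS by (rule defect_step[OF C1u _ Suc.IH Suc.prems]) (use diff in \<open>auto simp: uS\<close>)
    also have "K * C * (d / 2 ^ n) + ((K * C * d + 2 * K * C * d * n) / 2 ^ n) / 2
      = (K * C * d + 2 * K * C * d * Suc n) / 2 ^ Suc n"
      by (simp add: field_simps)
    finally show ?case .
  qed
  have "uniform_limit S (\<lambda>n y. \<Sum>i<n. u (Suc i) y - u i y) (\<lambda>y. \<Sum>i. u (Suc i) y - u i y) sequentially"
  proof (rule Weierstrass_m_test)
    show "norm (u (Suc n) y - u n y) \<le> d * (1/2) ^ n" if "y \<in> S" for n y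
      using diff[OF that, of n] by (simp add: norm_minus_commute power_divide)
    show "summable (\<lambda>n. d * (1/2::real) ^ n)"
      by (intro summable_mult summable_geometric) simp
  qed
  moreover have "(\<Sum>i<n. u (Suc i) y - u i y) = u n y - x0" for n y
    using sum_lessThan_telescope[of "\<lambda>i. u i y" n] by (simp add: u0)
  ultimately have ul: "uniform_limit S (\<lambda>n y. u n y - x0) (\<lambda>y. \<Sum>i. u (Suc i) y - u i y) sequentially"
    by simp
  define v where "v y = x0 + (\<Sum>i. u (Suc i) y - u i y)" for y
  have uni: "\<forall>\<^sub>F n in sequentially. \<forall>y\<in>S. norm (u n y - v y) < e" if "e > 0" for e
    using uniform_limitD[OF ul that] by (simp add: v_def dist_norm algebra_simps)
  have lim: "(\<lambda>n. u n y) \<longlonglongrightarrow> v y" if "y \<in> S" for y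
    unfolding tendsto_iff
  proof (intro allI impI)
    fix e :: real assume "e > 0"
    from uni[OF this] show "\<forall>\<^sub>F n in sequentially. dist (u n y) (v y) < e"
      by eventually_elim (use that in \<open>auto simp: dist_norm\<close>)
  qed
  have z: "0 \<in> S" using nonneg by simp
  have "\<exists>g. \<forall>y\<in>S. (\<lambda>n. u n y) \<longlonglongrightarrow> g y \<and> (g has_derivative (\<lambda>w. prod (v y) (\<theta> y w))) (at y within S)"
  proof (rule has_derivative_sequence[where f = u and f' = "\<lambda>n y. blinfun_apply (u' n y)"
        and g' = "\<lambda>y w. prod (v y) (\<theta> y w)" and S = S, OF _ _ _ z lim[OF z]])
    show "convex S" by (rule convex_ball)
    show "(u n has_derivative blinfun_apply (u' n y)) (at y within S)" if "y \<in> S" for n y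
      using C1u[of n] that by (auto simp: C1_def intro: has_derivative_at_withinI)
    fix e :: real assume e: "e > 0"
    have KC: "K * C \<ge> 0" using nonneg by simp
    have "(\<lambda>n. (K * C * d + 2 * K * C * d * real n) / 2 ^ n) \<longlonglongrightarrow> 0"
    proof -
      have "(\<lambda>n. K * C * d * (1/2) ^ n + 2 * K * C * d * (real n * (1/2) ^ n)) \<longlonglongrightarrow> K * C * d * 0 + 2 * K * C * d * 0"
        by (intro tendsto_intros powser_times_n_limit_0 LIMSEQ_power_zero) auto
      then show ?thesis by (simp add: power_divide add_divide_distrib)
    qed
    then have "\<forall>\<^sub>F n in sequentially. (K * C * d + 2 * K * C * d * real n) / 2 ^ n < e / 2"
      using e by (intro order_tendstoD) auto
    moreover have "\<forall>\<^sub>F n in sequentially. \<forall>y\<in>S. norm (u n y - v y) < e / (2 * (K * C + 1))"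
      using e KC by (intro uni) auto
    ultimately show "\<forall>\<^sub>F n in sequentially. \<forall>y\<in>S. \<forall>w. norm (blinfun_apply (u' n y) w - prod (v y) (\<theta> y w)) \<le> e * norm w"
    proof eventually_elim
      case (elim n)
      show ?case
      proof (intro ballI allI)
        fix y w assume y: "y \<in> S"
        have "norm (\<theta> y w) \<le> C * norm w"
          using norm_blinfun[of "\<theta> y" w] \<theta>_bound[OF y] mult_right_mono[OF _ norm_ge_zero] order_trans by blast
        then have "norm (prod (u n y - v y) (\<theta> y w)) \<le> K * (e / (2 * (K * C + 1))) * (C * norm w)"
          using nonneg elim(2) y e KC by (intro order_trans[OF prod_bound] mult_mono mult_nonneg_nonneg) (auto intro: less_imp_le)
        also have "\<dots> = (K * C / (K * C + 1)) * (e / 2 * norm w)" using KC by (simp add: field_simps)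
        also have "\<dots> \<le> 1 * (e / 2 * norm w)"
          using KC e by (intro mult_right_mono) auto
        finally have 1: "norm (prod (u n y - v y) (\<theta> y w)) \<le> e / 2 * norm w" by simp
        have 2: "norm (defect (u n) (u' n) y w) \<le> e / 2 * norm w"
          by (rule order_trans[OF def[OF y]], rule mult_right_mono[OF less_imp_le[OF elim(1)]]) simp
        have "u' n y w - prod (v y) (\<theta> y w) = defect (u n) (u' n) y w + prod (u n y - v y) (\<theta> y w)"
          by (simp add: defect_def bilinear_simps)
        then show "norm (u' n y w - prod (v y) (\<theta> y w)) \<le> e * norm w"
          using norm_triangle_mono[OF 2 1] by simp
      qed
    qed
  qed
  then obtain g where g: "\<And>y. y \<in> S \<Longrightarrow> (\<lambda>n. u n y) \<longlonglongrightarrow> g y"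
    "\<And>y. y \<in> S \<Longrightarrow> (g has_derivative (\<lambda>w. prod (v y) (\<theta> y w))) (at y within S)" by blast
  have gv: "g y = v y" if "y \<in> S" for y
    using g(1)[OF that] lim[OF that] LIMSEQ_unique by blast
  have "u n 0 = x0" for n
    by (cases n) (simp_all add: u0 uS step_def zero_right blinfun.zero_right)
  then have "g 0 = x0"
    using g(1)[OF z] LIMSEQ_unique tendsto_const by fastforce
  moreover have "(g has_derivative (\<lambda>w. prod (g y) (\<theta> y w))) (at y)" if "y \<in> S" for y
    using g(2)[OF that] at_within_open[OF that open_ball] by (simp only: gv[OF that])
  ultimately show ?thesis using that by blast
qed

end

lemma flat_system_solution:
  fixes \<theta> :: "'e::euclidean_space \<Rightarrow> 'e \<Rightarrow>\<^sub>L 'b::real_normed_vector" and \<theta>' :: "'e \<Rightarrow> 'e \<Rightarrow>\<^sub>L ('e \<Rightarrow>\<^sub>L 'b)"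
    and prod :: "'w::banach \<Rightarrow> 'b \<Rightarrow> 'w"
  assumes "bounded_bilinear prod" "open \<Omega>" "y0 \<in> \<Omega>"
    and der: "\<And>y. y \<in> \<Omega> \<Longrightarrow> (\<theta> has_derivative blinfun_apply (\<theta>' y)) (at y)"
    and cont: "continuous_on \<Omega> \<theta>'"
    and flat: "\<And>y x w z. y \<in> \<Omega> \<Longrightarrow> prod x (\<theta>' y w z) + prod (prod x (\<theta> y w)) (\<theta> y z)
       = prod x (\<theta>' y z w) + prod (prod x (\<theta> y z)) (\<theta> y w)"
  shows "\<exists>\<delta>>0. \<exists>u. ball y0 \<delta> \<subseteq> \<Omega> \<and> u y0 = x0 \<and>
    (\<forall>y\<in>ball y0 \<delta>. (u has_derivative (\<lambda>w. prod (u y) (\<theta> y w))) (at y))"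
proof -
  obtain K where K: "K > 0" "\<And>a b. norm (prod a b) \<le> norm a * norm b * K"
    using bounded_bilinear.pos_bounded[OF assms(1)] by auto
  define C where "C = norm (\<theta> y0) + 1"
  have C: "C > 0" by (simp add: C_def add_nonneg_pos)
  have "isCont \<theta> y0" using der[OF assms(3)] has_derivative_continuous by blast
  then obtain d1 where d1: "d1 > 0" "\<forall>y. dist y y0 < d1 \<longrightarrow> dist (\<theta> y) (\<theta> y0) < 1"
    unfolding continuous_at_eps_delta by (elim allE[of _ 1] impE) auto
  obtain d2 where d2: "d2 > 0" "ball y0 d2 \<subseteq> \<Omega>"
    using assms(2,3) open_contains_ball_eq by blast
  define \<delta> where "\<delta> = min (min d1 d2) (1 / (4 * K * C))"
  have \<delta>: "\<delta> > 0" using d1 d2 K C by (simp add: \<delta>_def)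
  have sub: "y + y0 \<in> \<Omega>" if "y \<in> ball 0 \<delta>" for y
  proof -
    have "y + y0 \<in> ball y0 d2" using that by (simp add: \<delta>_def dist_norm)
    then show ?thesis using d2 by blast
  qed
  have shift: "((\<lambda>y. y + y0) has_derivative (\<lambda>v. v)) (at y)" for y
    by (auto intro!: derivative_eq_intros)
  interpret flat_system prod "\<lambda>y. \<theta> (y + y0)" "\<lambda>y. \<theta>' (y + y0)" K C \<delta>
  proof (rule flat_system.intro[OF assms(1)], unfold_locales)
    show "((\<lambda>y. \<theta> (y + y0)) has_derivative blinfun_apply (\<theta>' (y + y0))) (at y)" if "y \<in> ball 0 \<delta>" for y
      using has_derivative_compose[OF shift der[OF sub[OF that]]] .
    show "continuous_on (ball 0 \<delta>) (\<lambda>y. \<theta>' (y + y0))"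
      by (rule continuous_on_compose2[OF cont]) (use sub in \<open>auto intro!: continuous_intros\<close>)
    show "norm (prod a b) \<le> K * norm a * norm b" for a b using K(2)[of a b] by (simp add: mult_ac)
    show "norm (\<theta> (y + y0)) \<le> C" if "y \<in> ball 0 \<delta>" for y
    proof -
      have "dist (\<theta> (y + y0)) (\<theta> y0) < 1" by (rule d1(2)[rule_format]) (use that in \<open>simp add: \<delta>_def dist_norm\<close>)
      then show ?thesis unfolding C_def dist_norm using norm_triangle_sub[of "\<theta> (y + y0)" "\<theta> y0"] by simp
    qed
    have "K * C * \<delta> \<le> K * C * (1 / (4 * K * C))"
      using K C by (intro mult_left_mono) (auto simp: \<delta>_def)
    also have "\<dots> = 1 / 4" using K C by simp
    finally show "K * C * \<delta> \<le> 1 / 4" .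
  qed (use K C \<delta> flat sub in auto)
  obtain u where u: "u 0 = x0" "\<And>y. y \<in> ball 0 \<delta> \<Longrightarrow> (u has_derivative (\<lambda>w. prod (u y) (\<theta> (y + y0) w))) (at y)"
    using solution_exists[of x0] by blast
  show ?thesis
  proof (intro exI[of _ \<delta>] conjI exI[of _ "\<lambda>y. u (y - y0)"] ballI)
    show "ball y0 \<delta> \<subseteq> \<Omega>" using d2 by (auto simp: \<delta>_def)
    fix y assume "y \<in> ball y0 \<delta>"
    then have y: "y - y0 \<in> ball 0 \<delta>" by (simp add: dist_norm norm_minus_commute)
    have "((\<lambda>y. y - y0) has_derivative (\<lambda>v. v)) (at y)"
      by (auto intro!: derivative_eq_intros)
    from has_derivative_compose[OF this u(2)[OF y]]
    show "((\<lambda>y. u (y - y0)) has_derivative (\<lambda>w. prod (u (y - y0)) (\<theta> y w))) (at y)" by simp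
  qed (use u \<delta> in auto)
qed

text \<open>On a small ball the sum of the norms of the \<open>u i\<close> is bounded by half of its own maximum, by the mean value inequality.  A finite
family of functions is used so that the lemma applies to the frame vectors as well as to the components of a bilinear form.\<close>

lemma linear_system_zero:
  fixes u :: "'i \<Rightarrow> 'e::euclidean_space \<Rightarrow> 'w::real_normed_vector"
    and c :: "'i \<Rightarrow> 'i \<Rightarrow> 'e \<Rightarrow> 'e \<Rightarrow> real"
  assumes "finite I" "open \<Omega>" "y0 \<in> \<Omega>" "\<And>i. i \<in> I \<Longrightarrow> u i y0 = 0"
    and der: "\<And>i y. i \<in> I \<Longrightarrow> y \<in> \<Omega> \<Longrightarrow> (u i has_derivative (\<lambda>w. \<Sum>j\<in>I. c i j y w *\<^sub>R u j y)) (at y)"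
    and lin: "\<And>i j y. i \<in> I \<Longrightarrow> j \<in> I \<Longrightarrow> y \<in> \<Omega> \<Longrightarrow> linear (c i j y)"
    and cont: "\<And>i j w. i \<in> I \<Longrightarrow> j \<in> I \<Longrightarrow> continuous_on \<Omega> (\<lambda>y. c i j y w)"
  obtains \<delta> where "\<delta> > 0" "ball y0 \<delta> \<subseteq> \<Omega>" "\<And>i y. i \<in> I \<Longrightarrow> y \<in> ball y0 \<delta> \<Longrightarrow> u i y = 0"
proof -
  obtain d where d: "d > 0" "cball y0 d \<subseteq> \<Omega>"
    using assms(2,3) open_contains_cball_eq by blast
  let ?m = "\<lambda>y. \<Sum>i\<in>I. \<Sum>j\<in>I. \<Sum>b\<in>Basis. \<bar>c i j y b\<bar>"
  have "continuous_on (cball y0 d) ?m"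
    by (intro continuous_intros continuous_on_subset[OF cont d(2)])
  then have "bounded (?m ` cball y0 d)"
    by (intro compact_imp_bounded compact_continuous_image) auto
  then obtain C where "C > 0" "\<forall>x\<in>?m ` cball y0 d. norm x \<le> C"
    unfolding bounded_pos by blast
  then have C: "C > 0" "\<And>y. y \<in> cball y0 d \<Longrightarrow> ?m y \<le> C" by (auto simp: abs_le_iff)
  \<comment> \<open>The factor \<open>n\<close> pays for summing the estimates over all \<open>i\<close>.\<close>
  define n where "n = real (card I) + 1"
  have n: "n > 0" "real (card I) \<le> n" by (simp_all add: n_def)
  define \<delta> where "\<delta> = min d (1 / (2 * C * n))"
  have \<delta>: "\<delta> > 0" "\<delta> \<le> d" "n * (C * \<delta>) \<le> 1 / 2"
  proof -
    show "\<delta> > 0" "\<delta> \<le> d" using d C n by (auto simp: \<delta>_def)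
    have "n * (C * \<delta>) \<le> n * (C * (1 / (2 * C * n)))" using C n by (intro mult_left_mono) (auto simp: \<delta>_def)
    also have "\<dots> = 1 / 2" using C n by simp
    finally show "n * (C * \<delta>) \<le> 1 / 2" .
  qed
  let ?B = "cball y0 \<delta>"
  have B: "?B \<subseteq> \<Omega>" "?B \<subseteq> cball y0 d" using \<delta> d by auto
  let ?s = "\<lambda>y. \<Sum>j\<in>I. norm (u j y)"
  have "continuous_on ?B (u i)" if "i \<in> I" for i
    using der[OF that] B by (meson continuous_at_imp_continuous_on has_derivative_continuous subsetD)
  then have "continuous_on ?B ?s" by (intro continuous_intros)
  then obtain x where x: "x \<in> ?B" "\<And>y. y \<in> ?B \<Longrightarrow> ?s y \<le> ?s x"
    using continuous_attains_sup[of ?B ?s] \<delta>(1) by (metis compact_cball cball_eq_empty not_less_iff_gr_or_eq)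
  have s0: "?s y \<ge> 0" for y by (intro sum_nonneg) auto
  have ui: "norm (u i x) \<le> C * \<delta> * ?s x" if i: "i \<in> I" for i
  proof -
    have "norm (u i x - u i y0) \<le> (C * ?s x) * norm (x - y0)"
    proof (rule differentiable_bound[of ?B "u i" "\<lambda>y w. \<Sum>j\<in>I. c i j y w *\<^sub>R u j y"])
      show "(u i has_derivative (\<lambda>w. \<Sum>j\<in>I. c i j y w *\<^sub>R u j y)) (at y within ?B)" if "y \<in> ?B" for y
        using der[OF i] B that by (blast intro: has_derivative_at_withinI)
      show "onorm (\<lambda>w. \<Sum>j\<in>I. c i j y w *\<^sub>R u j y) \<le> C * ?s x" if y: "y \<in> ?B" for y
      proof (rule onorm_le)
        fix w
        have yO: "y \<in> \<Omega>" using B y by blast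
        have "\<bar>c i j y w\<bar> \<le> (\<Sum>b\<in>Basis. \<bar>c i j y b\<bar>) * norm w" if j: "j \<in> I" for j
        proof -
          have "c i j y w = c i j y (\<Sum>b\<in>Basis. (w \<bullet> b) *\<^sub>R b)" by (simp add: euclidean_representation)
          also have "\<dots> = (\<Sum>b\<in>Basis. (w \<bullet> b) * c i j y b)"
            using lin[OF i j yO] by (simp add: linear_sum linear_scale)
          finally have "\<bar>c i j y w\<bar> \<le> (\<Sum>b\<in>Basis. \<bar>(w \<bullet> b) * c i j y b\<bar>)" by (simp only: sum_abs)
          also have "\<dots> \<le> (\<Sum>b\<in>Basis. \<bar>c i j y b\<bar> * norm w)"
            by (intro sum_mono) (auto simp: abs_mult mult.commute[of _ "norm w"] intro!: mult_right_mono Basis_le_norm)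
          finally show ?thesis by (simp add: sum_distrib_right)
        qed
        then have "norm (\<Sum>j\<in>I. c i j y w *\<^sub>R u j y) \<le> (\<Sum>j\<in>I. ((\<Sum>b\<in>Basis. \<bar>c i j y b\<bar>) * norm w) * ?s x)"
        proof (intro sum_norm_le)
          fix j assume j: "j \<in> I" and b: "\<And>j. j \<in> I \<Longrightarrow> \<bar>c i j y w\<bar> \<le> (\<Sum>b\<in>Basis. \<bar>c i j y b\<bar>) * norm w"
          have "norm (u j y) \<le> ?s y"
            using member_le_sum[OF j, of "\<lambda>j. norm (u j y)"] assms(1) by simp
          also have "\<dots> \<le> ?s x" by (rule x(2)[OF y])
          finally have "norm (u j y) \<le> ?s x" .
          then show "norm (c i j y w *\<^sub>R u j y) \<le> ((\<Sum>b\<in>Basis. \<bar>c i j y b\<bar>) * norm w) * ?s x"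
            unfolding norm_scaleR using b[OF j] by (intro mult_mono) (auto intro!: mult_nonneg_nonneg sum_nonneg)
        qed
        also have "\<dots> = (\<Sum>j\<in>I. \<Sum>b\<in>Basis. \<bar>c i j y b\<bar>) * (norm w * ?s x)"
          by (simp only: sum_distrib_right mult.assoc)
        also have "\<dots> \<le> C * (norm w * ?s x)"
        proof (rule mult_right_mono)
          have "(\<Sum>j\<in>I. \<Sum>b\<in>Basis. \<bar>c i j y b\<bar>) \<le> ?m y"
            using member_le_sum[OF i, of "\<lambda>i. \<Sum>j\<in>I. \<Sum>b\<in>Basis. \<bar>c i j y b\<bar>"] assms(1) by (simp add: sum_nonneg)
          also have "\<dots> \<le> C" using C(2) B(2) y by blast
          finally show "(\<Sum>j\<in>I. \<Sum>b\<in>Basis. \<bar>c i j y b\<bar>) \<le> C" .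
        qed (use s0 in simp)
        finally show "norm (\<Sum>j\<in>I. c i j y w *\<^sub>R u j y) \<le> C * ?s x * norm w" by (simp add: mult_ac)
      qed
    qed (use x \<delta> in auto)
    also have "\<dots> \<le> (C * ?s x) * \<delta>"
      using x(1) C s0 by (intro mult_left_mono) (auto simp: dist_norm norm_minus_commute)
    finally show ?thesis using assms(4)[OF i] by (simp add: mult_ac)
  qed
  have "?s x \<le> real (card I) * (C * \<delta> * ?s x)"
    using sum_bounded_above[of I "\<lambda>j. norm (u j x)"] ui by simp
  also have "\<dots> \<le> n * (C * \<delta> * ?s x)"
    using n C \<delta> s0 by (intro mult_right_mono mult_nonneg_nonneg) auto
  also have "\<dots> = (n * (C * \<delta>)) * ?s x" by simp
  also have "\<dots> \<le> 1 / 2 * ?s x"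
    using \<delta> s0 by (intro mult_right_mono) auto
  finally have "?s x \<le> 0" by simp
  then have "?s y = 0" if "y \<in> ?B" for y
    using x(2)[OF that] s0[of y] by linarith
  then have "u i y = 0" if "i \<in> I" "y \<in> ?B" for i y
    using that assms(1) by (simp add: sum_nonneg_eq_0_iff)
  then show ?thesis using \<delta> B by (intro that[of \<delta>]) auto
qed

section \<open>Smooth families of bilinear maps as operator-valued maps\<close>

text \<open>On a finite-dimensional domain an operator is a linear combination of its values on a basis, so pointwise derivatives are
derivatives in the operator norm.\<close>

lemma blinfun_has_derivativeI:
  fixes f :: "'y::real_normed_vector \<Rightarrow> 'e::euclidean_space \<Rightarrow>\<^sub>L 'f::real_normed_vector"
    and f' :: "'y \<Rightarrow> 'e \<Rightarrow>\<^sub>L 'f"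
  assumes "\<And>i. i \<in> Basis \<Longrightarrow> ((\<lambda>y. f y i) has_derivative (\<lambda>v. f' v i)) (at y)"
  shows "(f has_derivative f') (at y)"
proof -
  have rep: "h = (\<Sum>i\<in>Basis. blinfun_scaleR_left (h i) o\<^sub>L blinfun_inner_left i)" for h :: "'e \<Rightarrow>\<^sub>L 'f"
  proof (rule blinfun_eqI)
    fix x
    have "h x = h (\<Sum>i\<in>Basis. (x \<bullet> i) *\<^sub>R i)" by (simp add: euclidean_representation)
    then show "h x = (\<Sum>i\<in>Basis. blinfun_scaleR_left (h i) o\<^sub>L blinfun_inner_left i) x"
      by (simp add: blinfun.bilinear_simps)
  qed
  have "((\<lambda>y. \<Sum>i\<in>Basis. blinfun_scaleR_left (f y i) o\<^sub>L blinfun_inner_left i) has_derivative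
     (\<lambda>v. \<Sum>i\<in>Basis. blinfun_scaleR_left (f' v i) o\<^sub>L blinfun_inner_left i)) (at y)"
    by (intro has_derivative_sum bounded_linear.has_derivative[OF bounded_bilinear.bounded_linear_left[OF bounded_bilinear_blinfun_compose]]
      bounded_linear.has_derivative[OF bounded_linear_blinfun_scaleR_left] assms)
  then show ?thesis by (simp only: rep[symmetric])
qed

lemma dd_linear_param:
  fixes P :: "'e::euclidean_space \<Rightarrow> 'h::real_vector \<Rightarrow> 'v::real_normed_vector"
  assumes "open S" "y \<in> S" "\<And>x. x \<in> S \<Longrightarrow> linear (P x)" "\<And>w. (\<lambda>x. P x w) differentiable (at y)"
  shows "linear (\<lambda>w. dd (\<lambda>x. P x w) y v)"
proof (rule linearI)
  fix a b
  have "((\<lambda>x. P x a + P x b) has_derivative (\<lambda>v. dd (\<lambda>x. P x a) y v + dd (\<lambda>x. P x b) y v)) (at y)"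
    by (intro has_derivative_add dd_works assms)
  then have "((\<lambda>x. P x (a + b)) has_derivative (\<lambda>v. dd (\<lambda>x. P x a) y v + dd (\<lambda>x. P x b) y v)) (at y)"
    by (rule has_derivative_transform_within_open[OF _ assms(1,2)]) (use assms(3) in \<open>simp add: linear_add\<close>)
  then show "dd (\<lambda>x. P x (a + b)) y v = dd (\<lambda>x. P x a) y v + dd (\<lambda>x. P x b) y v" by (simp add: dd_eqI)
next
  fix c a
  have "((\<lambda>x. c *\<^sub>R P x a) has_derivative (\<lambda>v. c *\<^sub>R dd (\<lambda>x. P x a) y v)) (at y)"
    by (intro has_derivative_scaleR_right dd_works assms)
  then have "((\<lambda>x. P x (c *\<^sub>R a)) has_derivative (\<lambda>v. c *\<^sub>R dd (\<lambda>x. P x a) y v)) (at y)"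
    by (rule has_derivative_transform_within_open[OF _ assms(1,2)]) (use assms(3) in \<open>simp add: linear_scale\<close>)
  then show "dd (\<lambda>x. P x (c *\<^sub>R a)) y v = c *\<^sub>R dd (\<lambda>x. P x a) y v" by (simp add: dd_eqI)
qed

text \<open>The bridge from smoothness with fixed arguments to the operator-valued one-forms of the flat systems.\<close>

lemma bilinear_family_blinfun:
  fixes th :: "'e::euclidean_space \<Rightarrow> 'e \<Rightarrow> 'p::euclidean_space \<Rightarrow> 'p"
  assumes op: "open \<Omega>" and bil: "\<And>y. y \<in> \<Omega> \<Longrightarrow> bilinear (th y)"
    and smo: "\<And>w \<xi>. smooth_on \<Omega> (\<lambda>y. th y w \<xi>)"
  obtains \<theta> :: "'e \<Rightarrow> 'e \<Rightarrow>\<^sub>L ('p \<Rightarrow>\<^sub>L 'p)"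
    and \<theta>' :: "'e \<Rightarrow> 'e \<Rightarrow>\<^sub>L ('e \<Rightarrow>\<^sub>L ('p \<Rightarrow>\<^sub>L 'p))"
  where "\<And>y w \<xi>. y \<in> \<Omega> \<Longrightarrow> \<theta> y w \<xi> = th y w \<xi>"
    "\<And>y v w \<xi>. y \<in> \<Omega> \<Longrightarrow> \<theta>' y v w \<xi> = dd (\<lambda>y. th y w \<xi>) y v"
    "\<And>y. y \<in> \<Omega> \<Longrightarrow> (\<theta> has_derivative blinfun_apply (\<theta>' y)) (at y)"
    "continuous_on \<Omega> \<theta>'"
proof
  define \<theta> where "\<theta> y = Blinfun (\<lambda>w. Blinfun (th y w))" for y
  define \<theta>' where "\<theta>' y = Blinfun (\<lambda>v. Blinfun (\<lambda>w. Blinfun (\<lambda>\<xi>. dd (\<lambda>y. th y w \<xi>) y v)))" for y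
  have bl: "bounded_linear f" if "linear f" for f :: "'c::euclidean_space \<Rightarrow> 'd::real_normed_vector"
    using that by (simp add: linear_conv_bounded_linear)
  have bi: "Blinfun (\<lambda>\<xi>. h w \<xi>) \<xi> = h w \<xi>" "bounded_linear (\<lambda>w. Blinfun (\<lambda>\<xi>. h w \<xi>))"
    if "bilinear h" for h :: "'c::euclidean_space \<Rightarrow> 'p \<Rightarrow> 'p" and w \<xi>
  proof -
    have l: "linear (h w)" for w using that by (simp add: bilinear_def)
    show *: "Blinfun (h w) \<xi> = h w \<xi>" for w \<xi> by (simp add: bounded_linear_Blinfun_apply bl l)
    show "bounded_linear (\<lambda>w. Blinfun (h w))"
      by (rule bl, rule linearI) (auto intro!: blinfun_eqI simp: * blinfun.bilinear_simps bilinear_ladd[OF that] bilinear_lmul[OF that])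
  qed
  have df: "(\<lambda>y. th y w \<xi>) differentiable (at y)" if "y \<in> \<Omega>" for y w \<xi>
    by (rule smooth_on_imp_differentiable[OF smo that])
  have bil': "bilinear (\<lambda>w \<xi>. dd (\<lambda>y. th y w \<xi>) y v)" if "y \<in> \<Omega>" for y v
    unfolding bilinear_def
    by (intro conjI allI dd_linear_param[OF op that] df that) (use bil in \<open>auto simp: bilinear_def\<close>)
  show 1: "\<theta> y w \<xi> = th y w \<xi>" if "y \<in> \<Omega>" for y w \<xi>
    using bi[OF bil[OF that]] by (simp add: \<theta>_def bounded_linear_Blinfun_apply)
  show 2: "\<theta>' y v w \<xi> = dd (\<lambda>y. th y w \<xi>) y v" if "y \<in> \<Omega>" for y v w \<xi>
  proof -
    note b = bi[OF bil'[OF that]]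
    have *: "Blinfun (\<lambda>w. Blinfun (\<lambda>\<xi>. dd (\<lambda>y. th y w \<xi>) y v)) w \<xi> = dd (\<lambda>y. th y w \<xi>) y v" for v w \<xi>
      using b by (simp add: bounded_linear_Blinfun_apply)
    have lin: "linear (dd (\<lambda>y. th y w \<xi>) y)" for w \<xi> by (rule linear_frechet_derivative[OF df[OF that]])
    have "bounded_linear (\<lambda>v. Blinfun (\<lambda>w. Blinfun (\<lambda>\<xi>. dd (\<lambda>y. th y w \<xi>) y v)))"
      by (rule bl, rule linearI; intro blinfun_eqI, simp only: * blinfun.add_left blinfun.scaleR_left)
         (simp_all only: linear_add[OF lin] linear_scale[OF lin])
    then show ?thesis by (simp add: \<theta>'_def bounded_linear_Blinfun_apply *)
  qed
  show "(\<theta> has_derivative blinfun_apply (\<theta>' y)) (at y)" if "y \<in> \<Omega>" for y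
  proof (intro blinfun_has_derivativeI)
    fix w \<xi>
    have "((\<lambda>y. th y w \<xi>) has_derivative (\<lambda>v. \<theta>' y v w \<xi>)) (at y)"
      using dd_works[OF df[OF that]] by (simp add: 2[OF that])
    then show "((\<lambda>y. \<theta> y w \<xi>) has_derivative (\<lambda>v. \<theta>' y v w \<xi>)) (at y)"
      by (rule has_derivative_transform_within_open[OF _ op that]) (simp add: 1)
  qed
  show "continuous_on \<Omega> \<theta>'"
  proof (intro continuous_on_blinfun_componentwise)
    fix v w \<xi>
    have "continuous_on \<Omega> (\<lambda>y. dd (\<lambda>y. th y w \<xi>) y v)"
      by (intro smooth_on_imp_continuous smooth_on_dd smo)
    then show "continuous_on \<Omega> (\<lambda>y. \<theta>' y v w \<xi>)" by (simp add: 2 cong: continuous_on_cong)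
  qed
qed

section \<open>Linear algebra\<close>

lemma linear_inj_imp_surj_dim:
  fixes L :: "'x::euclidean_space \<Rightarrow> 'v::euclidean_space"
  assumes "linear L" "inj L" "DIM('v) \<le> DIM('x)"
  shows "surj L"
proof -
  have "dim (range L) = DIM('x)"
    using dim_image_eq[OF assms(1), of UNIV] assms(2) by (simp add: dim_UNIV)
  moreover have "dim (range L) \<le> DIM('v)" by (rule dim_subset_UNIV)
  ultimately have "dim (range L) = DIM('v)" using assms(3) by simp
  then have "span (range L) = UNIV" by (simp add: dim_eq_full)
  moreover have "subspace (range L)"
    by (rule linear_subspace_image[OF assms(1)]) simp
  ultimately show ?thesis by (metis span_eq_iff)
qed

text \<open>The algebra behind the uniqueness of the Levi-Civita connection: six transpositions return to the start with the opposite sign.\<close>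

lemma sym_skew_trilinear_zero:
  fixes T :: "'a \<Rightarrow> 'a \<Rightarrow> 'a \<Rightarrow> real"
  assumes "\<And>u v w. T u v w = T v u w" "\<And>u v w. T u v w = - T u w v"
  shows "T u v w = 0"
proof -
  have "T u v w = - T u w v" by (rule assms)
  also have "\<dots> = - T w u v" using assms(1)[of u w v] by simp
  also have "\<dots> = T w v u" using assms(2)[of w u v] by simp
  also have "\<dots> = T v w u" by (rule assms)
  also have "\<dots> = - T v u w" by (rule assms)
  also have "\<dots> = - T u v w" using assms(1)[of u v w] by simp
  finally show ?thesis by simp
qed

lemma linear_family_rep: "linear P \<Longrightarrow> P x = (\<Sum>b\<in>Basis. (x \<bullet> b) *\<^sub>R P b)" for x :: "'e::euclidean_space"
proof -
  assume l: "linear P"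
  have "P x = P (\<Sum>b\<in>Basis. (x \<bullet> b) *\<^sub>R b)" by (simp add: euclidean_representation)
  then show ?thesis by (simp add: linear_sum[OF l] linear_scale[OF l])
qed

locale nondegenerate_form =
  fixes ip :: "'v::euclidean_space \<Rightarrow> 'v \<Rightarrow> real"
  assumes ip_bilinear: "bilinear ip" and ip_sym: "ip a b = ip b a"
    and ip_nondeg: "(\<And>b. ip a b = 0) \<Longrightarrow> a = 0"
begin

lemma ip_bounded_bilinear: "bounded_bilinear ip"
  using ip_bilinear by (simp add: bilinear_conv_bounded_bilinear)

lemmas ip_simps = bilinear_ladd[OF ip_bilinear] bilinear_radd[OF ip_bilinear]
  bilinear_lsub[OF ip_bilinear] bilinear_rsub[OF ip_bilinear]
  bilinear_lmul[OF ip_bilinear] bilinear_rmul[OF ip_bilinear]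
  bilinear_lneg[OF ip_bilinear] bilinear_rneg[OF ip_bilinear]
  bilinear_lzero[OF ip_bilinear] bilinear_rzero[OF ip_bilinear]

lemma ip_linear: "linear (ip a)" "linear (\<lambda>a. ip a b)"
  using ip_bilinear by (auto simp: bilinear_def)

lemma ip_has_derivative:
  "(f has_derivative f') (at y) \<Longrightarrow> (g has_derivative g') (at y) \<Longrightarrow>
   ((\<lambda>y. ip (f y) (g y)) has_derivative (\<lambda>v. ip (f y) (g' v) + ip (f' v) (g y))) (at y)"
  by (rule bounded_bilinear.FDERIV[OF ip_bounded_bilinear])

text \<open>The tangent vectors, the normal vector and, if \<open>\<kappa> \<noteq> 0\<close>, the position vector are linearly independent by nondegeneracy,
so they span the ambient space by dimension.\<close>

lemma frame_complete:
  fixes q n :: 'v and F :: "'e::euclidean_space \<Rightarrow> 'v"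
  assumes "linear F" and dim: "DIM('v) = DIM('e) + (if \<kappa> = 0 then 1 else 2)"
    and nd: "\<And>z. (\<And>w. ip (F z) (F w) = 0) \<Longrightarrow> z = 0"
    and nn: "ip n n = 1" and nF: "\<And>z. ip n (F z) = 0"
    and q: "(\<kappa>::real) \<noteq> 0 \<Longrightarrow> ip q q = 1 / \<kappa> \<and> ip q n = 0 \<and> (\<forall>z. ip q (F z) = 0)"
    and d: "\<kappa> \<noteq> 0 \<Longrightarrow> ip d q = 0" "\<And>z. ip d (F z) = 0" "ip d n = 0"
  shows "d = 0"
proof (rule ip_nondeg)
  fix b
  note F = linear_add[OF assms(1)] linear_scale[OF assms(1)]
  show "ip d b = 0"
  proof (cases "\<kappa> = 0")
    case True
    define L where "L p = F (fst p) + snd p *\<^sub>R n" for p :: "'e \<times> real"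
    have L: "linear L" by (rule linearI) (simp_all add: L_def F algebra_simps)
    have "inj L"
      unfolding linear_injective_0[OF L]
    proof (intro allI impI)
      fix p assume 0: "L p = 0"
      have "ip (L p) n = 0" "ip (L p) (F w) = 0" for w by (simp_all add: 0 ip_simps)
      then have s: "snd p = 0" "ip (F (fst p)) (F w) = 0" for w
        using nF nn by (auto simp: L_def ip_simps ip_sym[of "F _" n])
      then show "p = 0" using nd[of "fst p"] by (simp add: prod_eq_iff)
    qed
    then have "surj L" using L dim True by (intro linear_inj_imp_surj_dim) auto
    then obtain p where "b = L p" by blast
    then show ?thesis using d by (simp add: L_def ip_simps)
  next
    case False
    define L where "L p = fst p *\<^sub>R q + F (fst (snd p)) + snd (snd p) *\<^sub>R n" for p :: "real \<times> 'e \<times> real"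
    have L: "linear L" by (rule linearI) (simp_all add: L_def F algebra_simps)
    have "inj L"
      unfolding linear_injective_0[OF L]
    proof (intro allI impI)
      fix p assume 0: "L p = 0"
      have "ip (L p) n = 0" "ip (L p) (F w) = 0" "ip (L p) q = 0" for w by (simp_all add: 0 ip_simps)
      then have s: "snd (snd p) = 0" "ip (F (fst (snd p))) (F w) = 0" "fst p = 0" for w
        using nF nn q[OF False] False by (auto simp: L_def ip_simps ip_sym[of "F _" n] ip_sym[of "F _" q] ip_sym[of n q])
      then show "p = 0" using nd[of "fst (snd p)"] by (simp add: prod_eq_iff)
    qed
    then have "surj L" using L dim False by (intro linear_inj_imp_surj_dim) auto
    then obtain p where "b = L p" by blast
    then show ?thesis using d False by (simp add: L_def ip_simps)
  qed
qed

text \<open>The second derivative of an immersion is symmetric and compatible with the induced metric, as is any Levi-Civita connection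
\<open>\<Gamma>\<close>; the tangential difference of the two is therefore symmetric in one pair of arguments and skew in another.\<close>

lemma immersion_christoffel_unique:
  fixes \<phi> :: "'h::euclidean_space \<Rightarrow> 'v"
  assumes S: "open S" "y \<in> S" "smooth_on S \<phi>"
    and sym: "\<And>u v. \<Gamma> u v = \<Gamma> v u"
    and met: "\<And>u v w. dd (\<lambda>y. ip (dd \<phi> y v) (dd \<phi> y w)) y u
       = ip (dd \<phi> y (\<Gamma> u v)) (dd \<phi> y w) + ip (dd \<phi> y v) (dd \<phi> y (\<Gamma> u w))"
  shows "ip (dd (\<lambda>y. dd \<phi> y v) y u) (dd \<phi> y w) = ip (dd \<phi> y (\<Gamma> u v)) (dd \<phi> y w)"
proof -
  let ?T = "\<lambda>u v w. ip (dd (\<lambda>y. dd \<phi> y v) y u - dd \<phi> y (\<Gamma> u v)) (dd \<phi> y w)"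
  have "?T u v w = 0"
  proof (rule sym_skew_trilinear_zero[where T = ?T])
    show "?T u v w = ?T v u w" for u v w
      using second_derivative_sym[OF S] sym by metis
    fix u v w
    have der: "((\<lambda>y. ip (dd \<phi> y v) (dd \<phi> y w)) has_derivative
       (\<lambda>u. ip (dd \<phi> y v) (dd (\<lambda>y. dd \<phi> y w) y u) + ip (dd (\<lambda>y. dd \<phi> y v) y u) (dd \<phi> y w))) (at y)"
      by (intro ip_has_derivative smooth_on_has_derivative[OF smooth_on_dd[OF S(3)] S(2)])
    have "ip (dd \<phi> y v) (dd (\<lambda>y. dd \<phi> y w) y u) + ip (dd (\<lambda>y. dd \<phi> y v) y u) (dd \<phi> y w)
      = ip (dd \<phi> y (\<Gamma> u v)) (dd \<phi> y w) + ip (dd \<phi> y v) (dd \<phi> y (\<Gamma> u w))"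
      using fun_cong[OF dd_eqI[OF der], of u] met[of v w u] by (simp only:)
    then show "?T u v w = - ?T u w v"
      by (simp add: ip_simps ip_sym[of "dd \<phi> y v"])
  qed
  then show ?thesis by (simp add: ip_simps)
qed

end

section \<open>Isometric immersions from the Gauss-Codazzi equations, in coordinates\<close>

lemma smooth_on_Pair:
  assumes "open S" "smooth_on S f" "smooth_on S g"
  shows "smooth_on S (\<lambda>x. (f x, g x))"
proof -
  have "bounded_linear (\<lambda>a. (a, 0))" "bounded_linear (\<lambda>b. (0, b))"
    by (auto intro: bounded_linear_Pair bounded_linear_ident bounded_linear_zero)
  from smooth_on_add[OF assms(1) smooth_on_linear[OF this(1) assms(1,2)] smooth_on_linear[OF this(2) assms(1,3)]]
  show ?thesis by simp
qed

lemma (in nondegenerate_form) smooth_on_ip: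
  "open S \<Longrightarrow> smooth_on S f \<Longrightarrow> smooth_on S g \<Longrightarrow> smooth_on S (\<lambda>x. ip (f x) (g x))"
  by (rule smooth_on_bilinear[OF ip_bounded_bilinear])

text \<open>The intrinsic data in a chart: metric \<open>G\<close>, Christoffel symbols \<open>\<Gamma>\<close> and the prospective Weingarten map \<open>A\<close>.  The assumptions
\<open>codazzi\<close> and \<open>gauss\<close> are the two equations for constant coordinate fields; \<open>A(\<Gamma>(v,w))\<close> has cancelled
from the former because \<open>\<Gamma>\<close> is symmetric.\<close>

locale gauss_codazzi = nondegenerate_form ip
  for ip :: "'v::euclidean_space \<Rightarrow> 'v \<Rightarrow> real" +
  fixes \<Omega> :: "'e::euclidean_space set" and G :: "'e \<Rightarrow> 'e \<Rightarrow> 'e \<Rightarrow> real"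
    and \<Gamma> :: "'e \<Rightarrow> 'e \<Rightarrow> 'e \<Rightarrow> 'e" and A :: "'e \<Rightarrow> 'e \<Rightarrow> 'e" and \<kappa> :: real
  assumes open_\<Omega>: "open \<Omega>"
    and G_bilinear: "y \<in> \<Omega> \<Longrightarrow> bilinear (G y)"
    and G_sym: "y \<in> \<Omega> \<Longrightarrow> G y v w = G y w v"
    and G_nondeg: "y \<in> \<Omega> \<Longrightarrow> (\<And>w. G y v w = 0) \<Longrightarrow> v = 0"
    and \<Gamma>_bilinear: "y \<in> \<Omega> \<Longrightarrow> bilinear (\<Gamma> y)"
    and A_linear: "y \<in> \<Omega> \<Longrightarrow> linear (A y)"
    and G_smooth: "smooth_on \<Omega> (\<lambda>y. G y v w)"
    and \<Gamma>_smooth: "smooth_on \<Omega> (\<lambda>y. \<Gamma> y v w)"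
    and A_smooth: "smooth_on \<Omega> (\<lambda>y. A y v)"
    and \<Gamma>_sym: "y \<in> \<Omega> \<Longrightarrow> \<Gamma> y v w = \<Gamma> y w v"
    and metric: "y \<in> \<Omega> \<Longrightarrow> dd (\<lambda>y. G y v w) y u = G y (\<Gamma> y u v) w + G y v (\<Gamma> y u w)"
    and A_sym: "y \<in> \<Omega> \<Longrightarrow> G y (A y v) w = G y v (A y w)"
    and codazzi: "y \<in> \<Omega> \<Longrightarrow> dd (\<lambda>y. A y w) y v + \<Gamma> y v (A y w) = dd (\<lambda>y. A y v) y w + \<Gamma> y w (A y v)"
    and gauss: "y \<in> \<Omega> \<Longrightarrow> dd (\<lambda>y. \<Gamma> y w x) y v + \<Gamma> y v (\<Gamma> y w x)
        - (dd (\<lambda>y. \<Gamma> y v x) y w + \<Gamma> y w (\<Gamma> y v x))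
      = G y (A y w) x *\<^sub>R A y v - G y (A y v) x *\<^sub>R A y w + \<kappa> *\<^sub>R (G y w x *\<^sub>R v - G y v x *\<^sub>R w)"
    and dim: "DIM('v) = DIM('e) + (if \<kappa> = 0 then 1 else 2)"
begin

lemma G_simps: "y \<in> \<Omega> \<Longrightarrow> G y (u + v) w = G y u w + G y v w" "y \<in> \<Omega> \<Longrightarrow> G y w (u + v) = G y w u + G y w v"
  "y \<in> \<Omega> \<Longrightarrow> G y (u - v) w = G y u w - G y v w" "y \<in> \<Omega> \<Longrightarrow> G y w (u - v) = G y w u - G y w v"
  "y \<in> \<Omega> \<Longrightarrow> G y (c *\<^sub>R u) w = c * G y u w" "y \<in> \<Omega> \<Longrightarrow> G y w (c *\<^sub>R u) = c * G y w u"
  using G_bilinear[of y] by (simp_all add: bilinear_ladd bilinear_radd bilinear_lsub bilinear_rsub bilinear_lmul bilinear_rmul)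

lemma \<Gamma>_simps: "y \<in> \<Omega> \<Longrightarrow> \<Gamma> y (u + v) w = \<Gamma> y u w + \<Gamma> y v w" "y \<in> \<Omega> \<Longrightarrow> \<Gamma> y w (u + v) = \<Gamma> y w u + \<Gamma> y w v"
  "y \<in> \<Omega> \<Longrightarrow> \<Gamma> y (u - v) w = \<Gamma> y u w - \<Gamma> y v w" "y \<in> \<Omega> \<Longrightarrow> \<Gamma> y w (u - v) = \<Gamma> y w u - \<Gamma> y w v"
  "y \<in> \<Omega> \<Longrightarrow> \<Gamma> y (c *\<^sub>R u) w = c *\<^sub>R \<Gamma> y u w" "y \<in> \<Omega> \<Longrightarrow> \<Gamma> y w (c *\<^sub>R u) = c *\<^sub>R \<Gamma> y w u"
  using \<Gamma>_bilinear[of y] by (simp_all add: bilinear_ladd bilinear_radd bilinear_lsub bilinear_rsub bilinear_lmul bilinear_rmul)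

lemma A_simps: "y \<in> \<Omega> \<Longrightarrow> A y (u + v) = A y u + A y v" "y \<in> \<Omega> \<Longrightarrow> A y (u - v) = A y u - A y v"
  "y \<in> \<Omega> \<Longrightarrow> A y (c *\<^sub>R u) = c *\<^sub>R A y u"
  using A_linear[of y] by (simp_all add: linear_add linear_diff linear_scale)

text \<open>The connection form on \<open>\<real> \<oplus> TM \<oplus> \<real>\<close> that combines the formulas of Gauss and Weingarten: the three slots are the
coefficients of the position vector, of the tangential part and of the normal vector.\<close>

definition conn_form :: "'e \<Rightarrow> 'e \<Rightarrow> real \<times> 'e \<times> real \<Rightarrow> real \<times> 'e \<times> real" where
  "conn_form y w \<xi> = (- \<kappa> * G y w (fst (snd \<xi>)),
     fst \<xi> *\<^sub>R w + \<Gamma> y w (fst (snd \<xi>)) - snd (snd \<xi>) *\<^sub>R A y w,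
     G y (A y w) (fst (snd \<xi>)))"

text \<open>The derivative of the second fundamental form \<open>G y (A y w) x\<close>, expressed by covariant derivatives.\<close>

lemma second_form_has_derivative:
  assumes "y \<in> \<Omega>"
  shows "((\<lambda>y. G y (A y w) x) has_derivative
     (\<lambda>v. G y (dd (\<lambda>y. A y w) y v + \<Gamma> y v (A y w)) x + G y (A y w) (\<Gamma> y v x))) (at y)"
proof -
  have l: "linear (\<lambda>u. G z u x)" if "z \<in> \<Omega>" for z
    using G_bilinear[OF that] by (simp add: bilinear_def)
  show ?thesis
    by (rule has_derivative_eq_rhs[OF has_derivative_apply_linear[OF open_\<Omega> assms, of "\<lambda>y u. G y u x",
          OF l smooth_on_imp_differentiable[OF G_smooth assms] smooth_on_has_derivative[OF A_smooth assms]]])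
       (auto simp: metric[OF assms] G_simps[OF assms])
qed

lemma smooth_conn_form: "smooth_on \<Omega> (\<lambda>y. conn_form y w \<xi>)"
proof -
  have *: "smooth_on \<Omega> (\<lambda>y. G y (A y w) x)" for x
    by (rule smooth_on_apply_linear[of _ "\<lambda>y u. G y u x", OF open_\<Omega>]) (use G_bilinear G_smooth A_smooth in \<open>auto simp: bilinear_def\<close>)
  have "smooth_on \<Omega> (\<lambda>y. fst \<xi> *\<^sub>R w + \<Gamma> y w (fst (snd \<xi>)) + (- snd (snd \<xi>)) *\<^sub>R A y w)"
    by (intro smooth_on_add open_\<Omega> \<Gamma>_smooth smooth_on_linear[OF bounded_linear_scaleR_right] A_smooth smooth_on_const)
  then show ?thesis unfolding conn_form_def
    by (intro smooth_on_Pair open_\<Omega> smooth_on_linear[OF bounded_linear_mult_right] G_smooth *) simp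
qed

lemma bilinear_conn_form: "y \<in> \<Omega> \<Longrightarrow> bilinear (conn_form y)"
  unfolding bilinear_def
  by (intro conjI allI linearI) (auto simp: conn_form_def G_simps \<Gamma>_simps A_simps algebra_simps)

definition conn_form' :: "'e \<Rightarrow> 'e \<Rightarrow> 'e \<Rightarrow> real \<times> 'e \<times> real \<Rightarrow> real \<times> 'e \<times> real" where
  "conn_form' y v w \<xi> = (- \<kappa> * (G y (\<Gamma> y v w) (fst (snd \<xi>)) + G y w (\<Gamma> y v (fst (snd \<xi>)))),
     dd (\<lambda>y. \<Gamma> y w (fst (snd \<xi>))) y v - snd (snd \<xi>) *\<^sub>R dd (\<lambda>y. A y w) y v,
     G y (dd (\<lambda>y. A y w) y v + \<Gamma> y v (A y w)) (fst (snd \<xi>)) + G y (A y w) (\<Gamma> y v (fst (snd \<xi>))))"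

lemma dd_conn_form:
  assumes "y \<in> \<Omega>"
  shows "dd (\<lambda>y. conn_form y w \<xi>) y v = conn_form' y v w \<xi>"
proof -
  note d = smooth_on_has_derivative[OF G_smooth assms] smooth_on_has_derivative[OF \<Gamma>_smooth assms]
    smooth_on_has_derivative[OF A_smooth assms]
  have "((\<lambda>y. conn_form y w \<xi>) has_derivative (\<lambda>v. (- \<kappa> * dd (\<lambda>y. G y w (fst (snd \<xi>))) y v,
     0 + dd (\<lambda>y. \<Gamma> y w (fst (snd \<xi>))) y v - snd (snd \<xi>) *\<^sub>R dd (\<lambda>y. A y w) y v,
     G y (dd (\<lambda>y. A y w) y v + \<Gamma> y v (A y w)) (fst (snd \<xi>)) + G y (A y w) (\<Gamma> y v (fst (snd \<xi>)))))) (at y)"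
    unfolding conn_form_def
    by (intro has_derivative_Pair has_derivative_diff has_derivative_add has_derivative_const
      has_derivative_mult_right has_derivative_scaleR_right d second_form_has_derivative[OF assms])
  then show ?thesis by (simp add: dd_eqI conn_form'_def metric[OF assms])
qed

text \<open>The first slot is symmetric in \<open>v\<close>, \<open>w\<close> by metric compatibility and symmetry of \<open>A\<close>, the second one by the equations of Gauss (in
\<open>x\<close>) and Codazzi (in \<open>b\<close>), the third one by Codazzi and symmetry of \<open>A\<close>.\<close>

lemma flat_conn_form:
  assumes y: "y \<in> \<Omega>"
  shows "conn_form' y v w \<xi> + conn_form y v (conn_form y w \<xi>) = conn_form' y w v \<xi> + conn_form y w (conn_form y v \<xi>)"
proof -
  obtain a x b where \<xi>: "\<xi> = (a, x, b)" by (cases \<xi>)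
  have hs: "G y (A y v) w = G y (A y w) v" for v w
    using A_sym[OF y, of v w] G_sym[OF y, of v] by simp
  have A2: "G y (A y v) (A y w) = G y (A y w) (A y v)" by (rule G_sym[OF y])
  have c: "G y (dd (\<lambda>y. A y w) y v) x + G y (\<Gamma> y v (A y w)) x = G y (dd (\<lambda>y. A y v) y w) x + G y (\<Gamma> y w (A y v)) x"
    using codazzi[OF y, of w v] by (simp flip: G_simps[OF y])
  have c': "b *\<^sub>R dd (\<lambda>y. A y w) y v + b *\<^sub>R \<Gamma> y v (A y w) = b *\<^sub>R dd (\<lambda>y. A y v) y w + b *\<^sub>R \<Gamma> y w (A y v)"
    using codazzi[OF y, of w v] by (simp flip: scaleR_add_right)
  have 1: "fst (conn_form' y v w \<xi> + conn_form y v (conn_form y w \<xi>)) = fst (conn_form' y w v \<xi> + conn_form y w (conn_form y v \<xi>))"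
    using hs[of v w] by (simp add: \<xi> conn_form_def conn_form'_def G_simps[OF y] \<Gamma>_sym[OF y, of v w] A_sym[OF y] G_sym[OF y, of v w] algebra_simps
        flip: A_sym[OF y])
  have 2: "fst (snd (conn_form' y v w \<xi> + conn_form y v (conn_form y w \<xi>))) = fst (snd (conn_form' y w v \<xi> + conn_form y w (conn_form y v \<xi>)))"
    using arg_cong2[where f = "(+)", OF gauss[OF y, of w x v] c'[symmetric]]
    by (simp add: \<xi> conn_form_def conn_form'_def \<Gamma>_simps[OF y] \<Gamma>_sym[OF y, of v w] algebra_simps)
  have 3: "snd (snd (conn_form' y v w \<xi> + conn_form y v (conn_form y w \<xi>))) = snd (snd (conn_form' y w v \<xi> + conn_form y w (conn_form y v \<xi>)))"
    using c hs[of v w] A2 by (simp add: \<xi> conn_form_def conn_form'_def G_simps[OF y] algebra_simps)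
  show ?thesis using 1 2 3 by (simp add: prod_eq_iff)
qed

text \<open>An isometric immersion of an open subset of the chart domain into the quadric, with unit normal \<open>n\<close> tangent to the quadric
and Weingarten map \<open>A\<close>, all in terms of vector-valued functions.\<close>

definition immersion_data :: "'e set \<Rightarrow> ('e \<Rightarrow> 'v) \<Rightarrow> ('e \<Rightarrow> 'v) \<Rightarrow> bool" where
  "immersion_data B f n \<longleftrightarrow> open B \<and> B \<subseteq> \<Omega> \<and> smooth_on B f \<and> (\<forall>y\<in>B. n differentiable (at y)) \<and>
     (\<forall>y\<in>B. (\<forall>v w. ip (dd f y v) (dd f y w) = G y v w) \<and> ip (n y) (n y) = 1 \<and>
        (\<forall>v. ip (n y) (dd f y v) = 0) \<and> (\<kappa> \<noteq> 0 \<longrightarrow> ip (f y) (f y) = 1 / \<kappa> \<and> ip (f y) (n y) = 0) \<and>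
        (\<forall>v. dd n y v = - dd f y (A y v)))"

text \<open>The Gauss formula.  By completeness of the frame it suffices to compare inner products with \<open>f\<close>, \<open>n\<close> and the tangent vectors.  The
first two are obtained by differentiating orthogonality relations, the last one is the uniqueness of the Levi-Civita connection.\<close>

lemma immersion_data_frame_equation:
  assumes B: "immersion_data B f n" and y: "y \<in> B"
  shows "dd (\<lambda>y. dd f y z) y w = dd f y (\<Gamma> y w z) + G y (A y w) z *\<^sub>R n y - (\<kappa> * G y w z) *\<^sub>R f y"
proof -
  note b = B[unfolded immersion_data_def]
  have y': "y \<in> \<Omega>" using b y by blast
  have op: "open B" and f: "smooth_on B f" using b by auto
  have iso: "ip (dd f y v) (dd f y w) = G y v w" if "y \<in> B" for y v w using b that by blast
  have nn: "ip (n y) (n y) = 1" and nf: "ip (n y) (dd f y v) = 0" and dn: "dd n y v = - dd f y (A y v)" if "y \<in> B" for y v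
    using b that by blast+
  have ff: "ip (f y) (f y) = 1 / \<kappa>" "ip (f y) (n y) = 0" if "y \<in> B" "\<kappa> \<noteq> 0" for y using b that by blast+
  have lin: "linear (dd f y)" by (rule linear_frechet_derivative[OF smooth_on_imp_differentiable[OF f y]])
  have df: "(f has_derivative dd f y) (at y)" if "y \<in> B" for y
    by (rule smooth_on_has_derivative[OF f that])
  have ddf: "((\<lambda>y. dd f y z) has_derivative dd (\<lambda>y. dd f y z) y) (at y)" for z
    by (rule smooth_on_has_derivative[OF smooth_on_dd[OF f] y])
  have dn': "(n has_derivative dd n y) (at y)" using b y by (blast intro: dd_works)
  have const: "h' = (\<lambda>v. 0)" if "(h has_derivative h') (at y)" "\<And>y. y \<in> B \<Longrightarrow> h y = c" for h :: "'e \<Rightarrow> real" and h' c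
  proof -
    have "((\<lambda>y. c) has_derivative h') (at y)"
      by (rule has_derivative_transform_within_open[OF that(1) op y]) (rule that(2))
    then show ?thesis using has_derivative_const has_derivative_unique by blast
  qed
  have f_df: "ip (f y) (dd f y v) = 0" if "\<kappa> \<noteq> 0" "y \<in> B" for y v
  proof -
    have "((\<lambda>y. 1 / \<kappa>) has_derivative (\<lambda>v. ip (f y) (dd f y v) + ip (dd f y v) (f y))) (at y)"
      by (rule has_derivative_transform_within_open[OF ip_has_derivative[OF df df] op]) (use that ff in auto)
    then have "(\<lambda>v. ip (f y) (dd f y v) + ip (dd f y v) (f y)) = (\<lambda>v. 0)"
      using has_derivative_const has_derivative_unique by blast
    then have "ip (f y) (dd f y v) + ip (dd f y v) (f y) = 0" by (rule fun_cong)
    then show ?thesis using ip_sym[of "f y" "dd f y v"] by simp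
  qed
  let ?X = "dd (\<lambda>y. dd f y z) y w - (dd f y (\<Gamma> y w z) + G y (A y w) z *\<^sub>R n y - (\<kappa> * G y w z) *\<^sub>R f y)"
  have "?X = 0"
  proof (rule frame_complete[where F = "dd f y" and q = "f y" and n = "n y" and \<kappa> = \<kappa>, OF lin dim])
    show "z = 0" if "\<And>w. ip (dd f y z) (dd f y w) = 0" for z
      using that iso[OF y] G_nondeg[OF y'] by simp
    show "ip ?X (f y) = 0" if \<kappa>: "\<kappa> \<noteq> 0"
    proof -
      have "(\<lambda>w. ip (f y) (dd (\<lambda>y. dd f y z) y w) + ip (dd f y w) (dd f y z)) = (\<lambda>w. 0)"
        by (rule const[OF ip_has_derivative[OF df[OF y] ddf]]) (use f_df[OF \<kappa>] in auto)
      then have "ip (f y) (dd (\<lambda>y. dd f y z) y w) + ip (dd f y w) (dd f y z) = 0" by (rule fun_cong)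
      then show ?thesis
        using ff[OF y \<kappa>] f_df[OF \<kappa> y] \<kappa> iso[OF y] by (simp add: ip_sym[of "dd _ _ _" "f y"] ip_sym[of "n y" "f y"] ip_simps)
    qed
    show "ip ?X (n y) = 0"
    proof -
      have "(\<lambda>w. ip (n y) (dd (\<lambda>y. dd f y z) y w) + ip (dd n y w) (dd f y z)) = (\<lambda>w. 0)"
        by (rule const[OF ip_has_derivative[OF dn' ddf]]) (use nf in auto)
      then have "ip (n y) (dd (\<lambda>y. dd f y z) y w) + ip (dd n y w) (dd f y z) = 0" by (rule fun_cong)
      then have "ip (n y) (dd (\<lambda>y. dd f y z) y w) = G y (A y w) z"
        using dn[OF y] iso[OF y] by (simp add: ip_simps)
      moreover have "\<kappa> * G y w z * ip (n y) (f y) = 0"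
        using ff(2)[OF y] ip_sym[of "f y" "n y"] by (cases "\<kappa> = 0") auto
      ultimately show ?thesis
        using nn[OF y] nf[OF y] by (simp add: ip_sym[of "dd _ _ _" "n y"] ip_sym[of "f y" "n y"] ip_simps)
    qed
    show "ip ?X (dd f y x) = 0" for x
    proof -
      have "ip (dd (\<lambda>y. dd f y z) y w) (dd f y x) = ip (dd f y (\<Gamma> y w z)) (dd f y x)"
      proof (rule immersion_christoffel_unique[OF op y f \<Gamma>_sym[OF y']])
        fix u v w
        have "((\<lambda>y. G y v w) has_derivative dd (\<lambda>y. G y v w) y) (at y)"
          by (rule smooth_on_has_derivative[OF G_smooth y'])
        then have "((\<lambda>y. ip (dd f y v) (dd f y w)) has_derivative dd (\<lambda>y. G y v w) y) (at y)"
          by (rule has_derivative_transform_within_open[OF _ op y]) (simp add: iso)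
        then show "dd (\<lambda>y. ip (dd f y v) (dd f y w)) y u =
         ip (dd f y (\<Gamma> y u v)) (dd f y w) + ip (dd f y v) (dd f y (\<Gamma> y u w))"
          by (simp add: dd_eqI metric[OF y'] iso[OF y])
      qed
      moreover have "\<kappa> * G y w z * ip (f y) (dd f y x) = 0"
        using f_df[OF _ y] by (cases "\<kappa> = 0") auto
      ultimately show ?thesis using nf[OF y] by (simp add: ip_simps)
    qed
  qed (use nn nf y ff f_df in auto)
  then show ?thesis by simp
qed

definition frame :: "('e \<Rightarrow> 'v) \<Rightarrow> ('e \<Rightarrow> 'v) \<Rightarrow> 'e \<Rightarrow> real \<times> 'e \<times> real \<Rightarrow> 'v" where
  "frame f n y \<xi> = fst \<xi> *\<^sub>R f y + dd f y (fst (snd \<xi>)) + snd (snd \<xi>) *\<^sub>R n y"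

lemma frame_has_derivative:
  assumes B: "immersion_data B f n" and y: "y \<in> B"
  shows "((\<lambda>y. frame f n y \<xi>) has_derivative (\<lambda>w. frame f n y (conn_form y w \<xi>))) (at y)"
proof -
  note b = B[unfolded immersion_data_def]
  have f: "smooth_on B f" and dn: "dd n y v = - dd f y (A y v)" for v using b y by auto
  have lin: "linear (dd f y)" by (rule linear_frechet_derivative[OF smooth_on_imp_differentiable[OF f y]])
  have "((\<lambda>y. frame f n y \<xi>) has_derivative (\<lambda>w. fst \<xi> *\<^sub>R dd f y w + dd (\<lambda>y. dd f y (fst (snd \<xi>))) y w + snd (snd \<xi>) *\<^sub>R dd n y w)) (at y)"
    unfolding frame_def using b y
    by (intro has_derivative_add has_derivative_scaleR_right smooth_on_has_derivative[OF f] smooth_on_has_derivative[OF smooth_on_dd[OF f]] dd_works) auto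
  then show ?thesis
    by (rule has_derivative_eq_rhs)
       (simp add: fun_eq_iff frame_def conn_form_def dn immersion_data_frame_equation[OF B y] linear_add[OF lin] linear_diff[OF lin] linear_scale[OF lin] algebra_simps)
qed

text \<open>The differences of the two frames on basis vectors satisfy a homogeneous linear system and vanish at \<open>y0\<close>.\<close>

theorem immersion_data_unique:
  assumes 1: "immersion_data B1 f1 n1" and 2: "immersion_data B2 f2 n2" and y0: "y0 \<in> B1" "y0 \<in> B2"
    and init: "f1 y0 = f2 y0" "\<And>v. dd f1 y0 v = dd f2 y0 v" "n1 y0 = n2 y0"
  obtains \<delta> where "\<delta> > 0" "ball y0 \<delta> \<subseteq> B1 \<inter> B2" "\<And>y. y \<in> ball y0 \<delta> \<Longrightarrow> f1 y = f2 y"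
proof -
  have op: "open (B1 \<inter> B2)" and sub: "B1 \<inter> B2 \<subseteq> \<Omega>"
    using 1 2 by (auto simp: immersion_data_def)
  let ?u = "\<lambda>\<xi> y. frame f1 n1 y \<xi> - frame f2 n2 y \<xi>"
  have lin: "linear (frame f n y)" if "immersion_data B f n" "y \<in> B" for B f n y
  proof -
    have "linear (dd f y)" using that by (auto simp: immersion_data_def intro!: linear_frechet_derivative smooth_on_imp_differentiable)
    then show ?thesis by (intro linearI) (auto simp: frame_def linear_add linear_scale algebra_simps)
  qed
  obtain \<delta> where \<delta>: "\<delta> > 0" "ball y0 \<delta> \<subseteq> B1 \<inter> B2"
     "\<And>\<xi> y. \<xi> \<in> Basis \<Longrightarrow> y \<in> ball y0 \<delta> \<Longrightarrow> ?u \<xi> y = 0"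
  proof (rule linear_system_zero[of "Basis" "B1 \<inter> B2" y0 ?u "\<lambda>\<xi> j y w. conn_form y w \<xi> \<bullet> j"])
    fix \<xi> :: "real \<times> 'e \<times> real" and y assume y: "y \<in> B1 \<inter> B2"
    then have y1: "y \<in> B1" and y2: "y \<in> B2" by auto
    have "(?u \<xi> has_derivative (\<lambda>w. frame f1 n1 y (conn_form y w \<xi>) - frame f2 n2 y (conn_form y w \<xi>))) (at y)"
      by (rule has_derivative_diff[OF frame_has_derivative[OF 1 y1] frame_has_derivative[OF 2 y2]])
    moreover have "frame f1 n1 y (conn_form y w \<xi>) - frame f2 n2 y (conn_form y w \<xi>) = (\<Sum>j\<in>Basis. (conn_form y w \<xi> \<bullet> j) *\<^sub>R ?u j y)" for w
      using linear_family_rep[OF lin[OF 1 y1], of "conn_form y w \<xi>"] linear_family_rep[OF lin[OF 2 y2], of "conn_form y w \<xi>"]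
      by (simp only: scaleR_diff_right sum_subtractf)
    ultimately show "(?u \<xi> has_derivative (\<lambda>w. \<Sum>j\<in>Basis. (conn_form y w \<xi> \<bullet> j) *\<^sub>R ?u j y)) (at y)" by (simp only:)
  next
    fix \<xi> j :: "real \<times> 'e \<times> real" and y assume "y \<in> B1 \<inter> B2"
    then have "bilinear (conn_form y)" using sub bilinear_conn_form by blast
    then show "linear (\<lambda>w. conn_form y w \<xi> \<bullet> j)"
      by (auto intro!: linearI simp: bilinear_ladd bilinear_lmul inner_add_left)
  next
    fix \<xi> j :: "real \<times> 'e \<times> real" and w
    show "continuous_on (B1 \<inter> B2) (\<lambda>y. conn_form y w \<xi> \<bullet> j)"
      by (intro continuous_intros continuous_on_subset[OF smooth_on_imp_continuous[OF smooth_conn_form] sub])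
  qed (use op y0 init in \<open>auto simp: frame_def\<close>)
  have "f1 y = f2 y" if "y \<in> ball y0 \<delta>" for y
  proof -
    have "(1, 0, 0) \<in> (Basis :: (real \<times> 'e \<times> real) set)" by (simp add: Basis_prod_def zero_prod_def)
    from \<delta>(3)[OF this that] have "frame f1 n1 y (1, 0, 0) = frame f2 n2 y (1, 0, 0)" by simp
    moreover have "dd f1 y 0 = 0" "dd f2 y 0 = 0"
      using \<delta>(2) that 1 2
      by (auto simp: immersion_data_def subset_eq intro!: linear_0 linear_frechet_derivative smooth_on_imp_differentiable)
    ultimately show ?thesis by (simp add: frame_def)
  qed
  then show ?thesis using \<delta> that by blast
qed

end

context gauss_codazzi
begin

text \<open>If \<open>\<kappa> = 0\<close> the first summand is \<open>0\<close>, as division by zero gives zero.\<close>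

definition bundle_metric :: "'e \<Rightarrow> real \<times> 'e \<times> real \<Rightarrow> real \<times> 'e \<times> real \<Rightarrow> real" where
  "bundle_metric y \<xi> \<eta> = fst \<xi> * fst \<eta> / \<kappa> + G y (fst (snd \<xi>)) (fst (snd \<eta>)) + snd (snd \<xi>) * snd (snd \<eta>)"

text \<open>For \<open>\<kappa> = 0\<close> the length of the position vector is not prescribed, so the position slot is excluded from the isometry.\<close>

definition admissible :: "real \<times> 'e \<times> real \<Rightarrow> bool" where
  "admissible \<xi> \<longleftrightarrow> (\<kappa> = 0 \<longrightarrow> fst \<xi> = 0)"

lemma admissible_conn_form: "admissible (conn_form y w \<xi>)"
  by (simp add: admissible_def conn_form_def)

lemma bundle_metric_bilinear: "y \<in> \<Omega> \<Longrightarrow> bilinear (bundle_metric y)"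
  unfolding bilinear_def
  by (intro conjI allI linearI) (auto simp: bundle_metric_def G_simps algebra_simps add_divide_distrib)

text \<open>The bundle metric is parallel: the terms with \<open>\<kappa>\<close> cancel against those with \<open>1/\<kappa>\<close>, and the terms with \<open>A\<close> cancel
each other.\<close>

lemma bundle_metric_has_derivative:
  assumes y: "y \<in> \<Omega>" and adm: "admissible \<xi>" "admissible \<eta>"
  shows "((\<lambda>y. bundle_metric y \<xi> \<eta>) has_derivative
     (\<lambda>w. bundle_metric y (conn_form y w \<xi>) \<eta> + bundle_metric y \<xi> (conn_form y w \<eta>))) (at y)"
proof -
  obtain a x b a' x' b' where \<xi>: "\<xi> = (a, x, b)" "\<eta> = (a', x', b')" by (cases \<xi>, cases \<eta>)
  have "((\<lambda>y. bundle_metric y \<xi> \<eta>) has_derivative (\<lambda>w. 0 + dd (\<lambda>y. G y (fst (snd \<xi>)) (fst (snd \<eta>))) y w + 0)) (at y)"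
    unfolding bundle_metric_def
    by (intro has_derivative_add has_derivative_const smooth_on_has_derivative[OF G_smooth y])
  then show ?thesis
  proof (rule has_derivative_eq_rhs, intro ext)
    fix w
    have \<kappa>: "\<kappa> = 0 \<longrightarrow> a = 0 \<and> a' = 0" using adm by (simp add: admissible_def \<xi>)
    have s: "G y x w = G y w x" "G y x (A y w) = G y (A y w) x" "G y x' w = G y w x'" "G y x' (A y w) = G y (A y w) x'"
      by (simp_all add: G_sym[OF y])
    show "0 + dd (\<lambda>y. G y (fst (snd \<xi>)) (fst (snd \<eta>))) y w + 0 = bundle_metric y (conn_form y w \<xi>) \<eta> + bundle_metric y \<xi> (conn_form y w \<eta>)"
      unfolding \<xi> bundle_metric_def conn_form_def fst_conv snd_conv metric[OF y]
      using \<kappa> by (cases "\<kappa> = 0") (simp_all add: G_simps[OF y] s algebra_simps)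
  qed
qed

lemma admissible_rep:
  assumes "admissible \<xi>" "linear P"
  shows "P \<xi> = (\<Sum>j\<in>Collect admissible \<inter> Basis. (\<xi> \<bullet> j) *\<^sub>R P j)"
proof -
  have "P \<xi> = (\<Sum>j\<in>Basis. (\<xi> \<bullet> j) *\<^sub>R P j)" by (rule linear_family_rep[OF assms(2)])
  also have "\<dots> = (\<Sum>j\<in>Collect admissible \<inter> Basis. (\<xi> \<bullet> j) *\<^sub>R P j)"
  proof (rule sum.mono_neutral_right)
    show "\<forall>j\<in>Basis - Collect admissible \<inter> Basis. (\<xi> \<bullet> j) *\<^sub>R P j = 0"
    proof
      fix j :: "real \<times> 'e \<times> real" assume "j \<in> Basis - Collect admissible \<inter> Basis"
      then have "j \<in> Basis" "\<kappa> = 0" "fst j \<noteq> 0" by (auto simp: admissible_def)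
      moreover from this have "j = (1, 0)" by (auto simp: Basis_prod_def)
      moreover have "fst \<xi> = 0" using assms(1) \<open>\<kappa> = 0\<close> unfolding admissible_def by blast
      ultimately show "(\<xi> \<bullet> j) *\<^sub>R P j = 0" by (simp add: inner_prod_def)
    qed
  qed auto
  finally show ?thesis .
qed

text \<open>The deviation of the pulled back form from the bundle metric is a bilinear form \<open>Q\<close> with
\<open>dQ(w)(\<xi>, \<eta>) = Q(\<theta>(w)\<xi>, \<eta>) + Q(\<xi>, \<theta>(w)\<eta>)\<close>.  This is a homogeneous linear system for its components, and \<open>Q\<close> vanishes
initially.\<close>

lemma parallel_frame_isometric:
  fixes \<Phi> :: "'e \<Rightarrow> real \<times> 'e \<times> real \<Rightarrow> 'v"
  assumes op: "open B" and y0: "y0 \<in> B" and sub: "B \<subseteq> \<Omega>"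
    and lin: "\<And>y. y \<in> B \<Longrightarrow> linear (\<Phi> y)"
    and der: "\<And>y \<xi>. y \<in> B \<Longrightarrow> ((\<lambda>y. \<Phi> y \<xi>) has_derivative (\<lambda>w. \<Phi> y (conn_form y w \<xi>))) (at y)"
    and init: "\<And>\<xi> \<eta>. admissible \<xi> \<Longrightarrow> admissible \<eta> \<Longrightarrow> ip (\<Phi> y0 \<xi>) (\<Phi> y0 \<eta>) = bundle_metric y0 \<xi> \<eta>"
  obtains \<delta> where "\<delta> > 0" "ball y0 \<delta> \<subseteq> B"
    "\<And>y \<xi> \<eta>. y \<in> ball y0 \<delta> \<Longrightarrow> admissible \<xi> \<Longrightarrow> admissible \<eta> \<Longrightarrow> ip (\<Phi> y \<xi>) (\<Phi> y \<eta>) = bundle_metric y \<xi> \<eta>"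
proof -
  define Q where "Q \<xi> \<eta> y = ip (\<Phi> y \<xi>) (\<Phi> y \<eta>) - bundle_metric y \<xi> \<eta>" for \<xi> \<eta> y
  let ?J = "Collect admissible \<inter> (Basis :: (real \<times> 'e \<times> real) set)"
  have Ql: "linear (\<lambda>\<xi>. Q \<xi> \<eta> y)" "linear (\<lambda>\<eta>. Q \<xi> \<eta> y)" if "y \<in> B" for y \<xi> \<eta>
  proof -
    have bm: "linear (\<lambda>\<xi>. bundle_metric y \<xi> \<eta>)" "linear (\<lambda>\<eta>. bundle_metric y \<xi> \<eta>)" for \<xi> \<eta>
      using bundle_metric_bilinear[OF subsetD[OF sub that]] unfolding bilinear_def by blast+
    note l = linear_add[OF lin[OF that]] linear_scale[OF lin[OF that]] linear_add[OF bm(1)] linear_scale[OF bm(1)]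
      linear_add[OF bm(2)] linear_scale[OF bm(2)]
    show "linear (\<lambda>\<xi>. Q \<xi> \<eta> y)" "linear (\<lambda>\<eta>. Q \<xi> \<eta> y)"
      by (rule linearI; simp only: Q_def l ip_simps; simp add: algebra_simps)+
  qed
  have Qd: "((\<lambda>y. Q \<xi> \<eta> y) has_derivative (\<lambda>w. Q (conn_form y w \<xi>) \<eta> y + Q \<xi> (conn_form y w \<eta>) y)) (at y)"
    if "y \<in> B" "admissible \<xi>" "admissible \<eta>" for y \<xi> \<eta>
  proof -
    have "y \<in> \<Omega>" using that sub by auto
    then show ?thesis
      unfolding Q_def
      by (rule has_derivative_eq_rhs[OF has_derivative_diff[OF ip_has_derivative[OF der[OF that(1)] der[OF that(1)]]
           bundle_metric_has_derivative[OF _ that(2,3)]]]) (simp add: fun_eq_iff algebra_simps)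
  qed
  \<comment> \<open>The matrix of \<open>\<theta> \<otimes> 1 + 1 \<otimes> \<theta>\<close> with respect to pairs of basis vectors.\<close>
  let ?c = "\<lambda>p p' y w. (conn_form y w (fst p) \<bullet> fst p') * (if snd p' = snd p then 1 else 0)
     + (if fst p' = fst p then 1 else 0) * (conn_form y w (snd p) \<bullet> snd p')"
  have delta1: "(\<Sum>k\<in>?J. (c * (if k = \<eta> then 1 else 0)) * h k) = c * h \<eta>" if "\<eta> \<in> ?J" for c \<eta> and h :: "_ \<Rightarrow> real"
  proof -
    have "(\<Sum>k\<in>?J. (c * (if k = \<eta> then 1 else 0)) * h k) = (\<Sum>k\<in>?J. if k = \<eta> then c * h k else 0)"
      by (rule sum.cong) auto
    then show ?thesis using that by (simp add: sum.delta)
  qed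
  have delta2: "(\<Sum>k\<in>?J. ((if k = \<eta> then 1 else 0) * c k) * h k) = c \<eta> * h \<eta>" if "\<eta> \<in> ?J" for \<eta> and c h :: "_ \<Rightarrow> real"
  proof -
    have "(\<Sum>k\<in>?J. ((if k = \<eta> then 1 else 0) * c k) * h k) = (\<Sum>k\<in>?J. if k = \<eta> then c k * h k else 0)"
      by (rule sum.cong) auto
    then show ?thesis using that by (simp add: sum.delta)
  qed
  obtain \<delta> where \<delta>: "\<delta> > 0" "ball y0 \<delta> \<subseteq> B"
    "\<And>p y. p \<in> ?J \<times> ?J \<Longrightarrow> y \<in> ball y0 \<delta> \<Longrightarrow> Q (fst p) (snd p) y = 0"
  proof (rule linear_system_zero[of "?J \<times> ?J" B y0 "\<lambda>p y. Q (fst p) (snd p) y" ?c])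
    fix p y assume p: "p \<in> ?J \<times> ?J" and y: "y \<in> B"
    obtain \<xi> \<eta> where \<xi>: "p = (\<xi>, \<eta>)" "\<xi> \<in> ?J" "\<eta> \<in> ?J" using p by auto
    have "Q (conn_form y w \<xi>) \<eta> y + Q \<xi> (conn_form y w \<eta>) y = (\<Sum>p'\<in>?J \<times> ?J. ?c p p' y w *\<^sub>R Q (fst p') (snd p') y)" for w
    proof -
      have "Q (conn_form y w \<xi>) \<eta> y = (\<Sum>j\<in>?J. (conn_form y w \<xi> \<bullet> j) *\<^sub>R Q j \<eta> y)"
        by (rule admissible_rep[OF admissible_conn_form Ql(1)[OF y]])
      also have "\<dots> = (\<Sum>j\<in>?J. \<Sum>k\<in>?J. ((conn_form y w \<xi> \<bullet> j) * (if k = \<eta> then 1 else 0)) * Q j k y)"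
        by (simp only: delta1[OF \<xi>(3)] real_scaleR_def)
      finally have 1: "Q (conn_form y w \<xi>) \<eta> y = \<dots>" .
      have "Q \<xi> (conn_form y w \<eta>) y = (\<Sum>k\<in>?J. (conn_form y w \<eta> \<bullet> k) *\<^sub>R Q \<xi> k y)"
        by (rule admissible_rep[OF admissible_conn_form Ql(2)[OF y]])
      also have "\<dots> = (\<Sum>k\<in>?J. \<Sum>j\<in>?J. ((if j = \<xi> then 1 else 0) * (conn_form y w \<eta> \<bullet> k)) * Q j k y)"
        by (simp only: delta2[OF \<xi>(2)] real_scaleR_def)
      also have "\<dots> = (\<Sum>j\<in>?J. \<Sum>k\<in>?J. ((if j = \<xi> then 1 else 0) * (conn_form y w \<eta> \<bullet> k)) * Q j k y)"
        by (rule sum.swap)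
      finally show ?thesis
        unfolding 1 by (simp only: \<xi>(1) fst_conv snd_conv real_scaleR_def sum.cartesian_product' sum.distrib[symmetric] distrib_right)
    qed
    then show "((\<lambda>y. Q (fst p) (snd p) y) has_derivative (\<lambda>w. \<Sum>p'\<in>?J \<times> ?J. ?c p p' y w *\<^sub>R Q (fst p') (snd p') y)) (at y)"
      using Qd[OF y, of \<xi> \<eta>] \<xi> by simp
  next
    fix p p' :: "(real \<times> 'e \<times> real) \<times> (real \<times> 'e \<times> real)" and y assume "y \<in> B"
    then have "bilinear (conn_form y)" using sub bilinear_conn_form by blast
    then show "linear (?c p p' y)"
      by (auto intro!: linearI simp: bilinear_ladd bilinear_lmul inner_add_left algebra_simps)
  next
    fix p p' :: "(real \<times> 'e \<times> real) \<times> (real \<times> 'e \<times> real)" and w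
    show "continuous_on B (\<lambda>y. ?c p p' y w)"
      by (intro continuous_intros continuous_on_subset[OF smooth_on_imp_continuous[OF smooth_conn_form] sub])
  qed (use op y0 init in \<open>auto simp: Q_def\<close>)
  have "Q \<xi> \<eta> y = 0" if y: "y \<in> ball y0 \<delta>" and "admissible \<xi>" "admissible \<eta>" for y \<xi> \<eta>
  proof -
    have yB: "y \<in> B" using y \<delta> by blast
    have "Q \<xi> \<eta> y = (\<Sum>j\<in>?J. (\<xi> \<bullet> j) *\<^sub>R Q j \<eta> y)"
      by (rule admissible_rep[OF that(2) Ql(1)[OF yB]])
    also have "\<dots> = 0"
    proof (rule sum.neutral, rule ballI)
      fix j assume j: "j \<in> ?J"
      have "Q j \<eta> y = (\<Sum>k\<in>?J. (\<eta> \<bullet> k) *\<^sub>R Q j k y)"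
        by (rule admissible_rep[OF that(3) Ql(2)[OF yB]])
      also have "\<dots> = 0" using \<delta>(3)[of "(j, _)", OF _ y] j by (intro sum.neutral) auto
      finally show "(\<xi> \<bullet> j) *\<^sub>R Q j \<eta> y = 0" by simp
    qed
    finally show ?thesis .
  qed
  then show ?thesis using \<delta>(1,2) by (intro that[of \<delta>]) (auto simp: Q_def)
qed

text \<open>The frame \<open>\<Phi>\<close> is the solution of the flat system that starts with \<open>(a, v, b) \<mapsto> a q + F v + b \<nu>\<close>.  Its smoothness
follows from the equation itself, which expresses the derivatives of \<open>\<Phi>\<close> by \<open>\<Phi>\<close>.\<close>

theorem immersion_data_exists:
  assumes y0: "y0 \<in> \<Omega>" and F: "linear F" and iso: "\<And>v w. ip (F v) (F w) = G y0 v w"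
    and \<nu>: "ip \<nu> \<nu> = 1" "\<And>v. ip \<nu> (F v) = 0"
    and q: "\<kappa> \<noteq> 0 \<Longrightarrow> ip q q = 1 / \<kappa> \<and> ip q \<nu> = 0 \<and> (\<forall>v. ip q (F v) = 0)"
  obtains \<delta> f n where "\<delta> > 0" "immersion_data (ball y0 \<delta>) f n" "smooth_on (ball y0 \<delta>) n"
    "f y0 = q" "\<And>v. dd f y0 v = F v" "n y0 = \<nu>"
proof -
  obtain \<theta> :: "'e \<Rightarrow> 'e \<Rightarrow>\<^sub>L ((real \<times> 'e \<times> real) \<Rightarrow>\<^sub>L (real \<times> 'e \<times> real))"
    and \<theta>' :: "'e \<Rightarrow> 'e \<Rightarrow>\<^sub>L ('e \<Rightarrow>\<^sub>L ((real \<times> 'e \<times> real) \<Rightarrow>\<^sub>L (real \<times> 'e \<times> real)))"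
  where \<theta>: "\<And>y w \<xi>. y \<in> \<Omega> \<Longrightarrow> \<theta> y w \<xi> = conn_form y w \<xi>"
    "\<And>y v w \<xi>. y \<in> \<Omega> \<Longrightarrow> \<theta>' y v w \<xi> = dd (\<lambda>y. conn_form y w \<xi>) y v"
    "\<And>y. y \<in> \<Omega> \<Longrightarrow> (\<theta> has_derivative blinfun_apply (\<theta>' y)) (at y)"
    "continuous_on \<Omega> \<theta>'"
    using bilinear_family_blinfun[OF open_\<Omega> bilinear_conn_form smooth_conn_form] by blast
  define L where "L = (\<lambda>\<xi>::real \<times> 'e \<times> real. fst \<xi> *\<^sub>R q + F (fst (snd \<xi>)) + snd (snd \<xi>) *\<^sub>R \<nu>)"
  have La: "L \<xi> = fst \<xi> *\<^sub>R q + F (fst (snd \<xi>)) + snd (snd \<xi>) *\<^sub>R \<nu>" for \<xi>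
    by (simp add: L_def)
  have "linear L" unfolding L_def
    by (rule linearI) (simp_all add: linear_add[OF F] linear_scale[OF F] algebra_simps)
  then have L: "blinfun_apply (Blinfun L) = L"
    by (simp add: bounded_linear_Blinfun_apply linear_conv_bounded_linear)
  have flat: "(x o\<^sub>L \<theta>' y w z) + ((x o\<^sub>L \<theta> y w) o\<^sub>L \<theta> y z) = (x o\<^sub>L \<theta>' y z w) + ((x o\<^sub>L \<theta> y z) o\<^sub>L \<theta> y w)"
    if y: "y \<in> \<Omega>" for y w z and x :: "(real \<times> 'e \<times> real) \<Rightarrow>\<^sub>L 'v"
  proof -
    have "x (\<theta>' y w z \<xi> + \<theta> y w (\<theta> y z \<xi>)) = x (\<theta>' y z w \<xi> + \<theta> y z (\<theta> y w \<xi>))" for \<xi>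
      using flat_conn_form[OF y, of w z \<xi>] by (simp add: \<theta>(1)[OF y] \<theta>(2)[OF y] dd_conn_form[OF y])
    then show ?thesis
      by (intro blinfun_eqI) (simp add: blinfun.bilinear_simps)
  qed
  obtain d \<Phi> where d: "d > 0" "ball y0 d \<subseteq> \<Omega>" and \<Phi>0: "\<Phi> y0 = Blinfun L"
    and \<Phi>: "\<And>y. y \<in> ball y0 d \<Longrightarrow> (\<Phi> has_derivative (\<lambda>w. \<Phi> y o\<^sub>L \<theta> y w)) (at y)"
    using flat_system_solution[where ?x0.0 = "Blinfun L", OF bounded_bilinear_blinfun_compose open_\<Omega> y0 \<theta>(3,4) flat]
    by blast
  let ?B = "ball y0 d"
  have der: "((\<lambda>y. \<Phi> y \<xi>) has_derivative (\<lambda>w. \<Phi> y (conn_form y w \<xi>))) (at y)" if "y \<in> ?B" for y \<xi>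
  proof -
    have "y \<in> \<Omega>" using that d by blast
    then show ?thesis
      using bounded_linear.has_derivative[OF blinfun.bounded_linear_left \<Phi>[OF that], of \<xi>] by (simp add: \<theta>(1))
  qed
  have Ck: "Ck_on k ?B (\<lambda>y. \<Phi> y \<xi>)" for k \<xi>
  proof (induction k arbitrary: \<xi>)
    case 0
    show ?case
      unfolding Ck_on.simps by (intro continuous_at_imp_continuous_on ballI has_derivative_continuous[OF der])
  next
    case (Suc k)
    show ?case
    proof (rule Ck_on_SucI[OF open_ball der])
      fix w
      have "Ck_on k \<Omega> (\<lambda>y. conn_form y w \<xi>)" using smooth_conn_form by (simp add: smooth_on_def)
      then have "Ck_on k ?B (\<lambda>y. \<Sum>b\<in>Basis. (conn_form y w \<xi> \<bullet> b) *\<^sub>R \<Phi> y b)"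
        by (intro Ck_on_sum open_ball Ck_on_bilinear[OF bounded_bilinear_scaleR] Ck_on_linear[OF bounded_linear_inner_left] Suc.IH)
           (use d Ck_on_subset in blast)
      then show "Ck_on k ?B (\<lambda>y. \<Phi> y (conn_form y w \<xi>))"
        by (rule Ck_on_cong_open[OF open_ball, rotated]) (simp add: linear_family_rep[OF bounded_linear.linear[OF blinfun.bounded_linear_right], symmetric])
    qed
  qed
  then have smooth: "smooth_on ?B (\<lambda>y. \<Phi> y \<xi>)" for \<xi> by (simp add: smooth_on_def)
  have y0B: "y0 \<in> ?B" using d by simp
  have init: "ip (\<Phi> y0 \<xi>) (\<Phi> y0 \<eta>) = bundle_metric y0 \<xi> \<eta>" if "admissible \<xi>" "admissible \<eta>" for \<xi> \<eta>
  proof (cases "\<kappa> = 0")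
    case True
    then have "fst \<xi> = 0" "fst \<eta> = 0" using that unfolding admissible_def by blast+
    then show ?thesis
      using \<nu> by (simp add: \<Phi>0 L La bundle_metric_def ip_simps iso ip_sym[of "F _" \<nu>])
  next
    case False
    then show ?thesis
      using \<nu> q[OF False] by (simp add: \<Phi>0 L La bundle_metric_def ip_simps iso ip_sym[of "F _" \<nu>] ip_sym[of "F _" q] ip_sym[of \<nu> q])
  qed
  obtain \<delta> where \<delta>: "\<delta> > 0" "ball y0 \<delta> \<subseteq> ?B"
    and isoB: "\<And>y \<xi> \<eta>. y \<in> ball y0 \<delta> \<Longrightarrow> admissible \<xi> \<Longrightarrow> admissible \<eta> \<Longrightarrow> ip (\<Phi> y \<xi>) (\<Phi> y \<eta>) = bundle_metric y \<xi> \<eta>"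
    using parallel_frame_isometric[where \<Phi> = "\<lambda>y \<xi>. \<Phi> y \<xi>", OF open_ball y0B d(2) bounded_linear.linear[OF blinfun.bounded_linear_right] der init] by blast
  define f where "f y = \<Phi> y (1, 0, 0)" for y
  define n where "n y = \<Phi> y (0, 0, 1)" for y
  have z: "G y w 0 = 0" "\<Gamma> y w 0 = 0" "\<Phi> y 0 = 0" if "y \<in> \<Omega>" for y w
    using that G_simps(2)[of y w 0 0] \<Gamma>_simps(2)[of y w 0 0] by (auto simp: blinfun.zero_right)
  have ddf: "dd f y w = \<Phi> y (0, w, 0)" if "y \<in> ball y0 \<delta>" for y w
  proof -
    have y: "y \<in> ?B" "y \<in> \<Omega>" using that \<delta> d by blast+
    show ?thesis using der[OF y(1), of "(1, 0, 0)"] by (simp add: f_def[abs_def] dd_eqI conn_form_def z[OF y(2)])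
  qed
  have ddn: "dd n y w = - \<Phi> y (0, A y w, 0)" if "y \<in> ball y0 \<delta>" for y w
  proof -
    have y: "y \<in> ?B" "y \<in> \<Omega>" using that \<delta> d by blast+
    show ?thesis using der[OF y(1), of "(0, 0, 1)"]
      by (simp add: n_def[abs_def] dd_eqI conn_form_def z[OF y(2)] flip: blinfun.minus_right)
  qed
  have "immersion_data (ball y0 \<delta>) f n"
    unfolding immersion_data_def
  proof (intro conjI ballI allI impI)
    show "smooth_on (ball y0 \<delta>) f" unfolding f_def using smooth smooth_on_subset \<delta>(2) by blast
    show "ball y0 \<delta> \<subseteq> \<Omega>" using \<delta> d by blast
    fix y assume y: "y \<in> ball y0 \<delta>"
    have y': "y \<in> \<Omega>" using y \<delta> d by blast
    show "n differentiable (at y)" unfolding n_def differentiable_def using der[OF subsetD[OF \<delta>(2) y], of "(0, 0, 1)"] by blast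
    show "ip (dd f y v) (dd f y w) = G y v w" for v w
      using isoB[OF y, of "(0, v, 0)" "(0, w, 0)"] by (simp add: ddf[OF y] admissible_def bundle_metric_def)
    show "ip (n y) (n y) = 1"
      using isoB[OF y, of "(0, 0, 1)" "(0, 0, 1)"] z[OF y'] by (simp add: n_def admissible_def bundle_metric_def)
    show "ip (n y) (dd f y v) = 0" for v
      using isoB[OF y, of "(0, v, 0)" "(0, 0, 1)"] z[OF y'] by (simp add: n_def ddf[OF y] ip_sym[of "\<Phi> y (0, 0, 1)"] admissible_def bundle_metric_def)
    show "ip (f y) (f y) = 1 / \<kappa>" if "\<kappa> \<noteq> 0"
      using isoB[OF y, of "(1, 0, 0)" "(1, 0, 0)"] z[OF y'] that by (simp add: f_def admissible_def bundle_metric_def)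
    show "ip (f y) (n y) = 0" if "\<kappa> \<noteq> 0"
      using isoB[OF y, of "(1, 0, 0)" "(0, 0, 1)"] z[OF y'] that by (simp add: f_def n_def admissible_def bundle_metric_def)
    show "dd n y v = - dd f y (A y v)" for v by (simp add: ddn[OF y] ddf[OF y])
  qed auto
  moreover have "smooth_on (ball y0 \<delta>) n" unfolding n_def using smooth smooth_on_subset \<delta>(2) by blast
  moreover have "f y0 = q" "n y0 = \<nu>" "dd f y0 v = F v" for v
    using \<delta>(1) linear_0[OF F] by (auto simp: f_def n_def ddf \<Phi>0 L La)
  ultimately show ?thesis using \<delta>(1) that by blast
qed

end

section \<open>Manifolds in charts\<close>

lemma sum_fun_apply: "(\<Sum>b\<in>B. f b) d = (\<Sum>b\<in>B. f b d)"
  by (induction B rule: infinite_finite_induct) simp_all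

text \<open>A smooth atlas without the global conditions on a manifold.  In particular the charts need not cover the space, so that the
atlas of a submanifold qualifies before anything is known about the existence of parametrizations.\<close>

locale charted_space =
  fixes M :: "'a topology" and \<A> :: "('a, 'e::euclidean_space) chart set"
  assumes open_dom: "c \<in> \<A> \<Longrightarrow> openin M (fst c)"
    and open_img: "c \<in> \<A> \<Longrightarrow> open (snd c ` fst c)"
    and homeo: "c \<in> \<A> \<Longrightarrow> homeomorphic_map (subtopology M (fst c)) (top_of_set (snd c ` fst c)) (snd c)"
    and smooth_transition: "c \<in> \<A> \<Longrightarrow> d \<in> \<A> \<Longrightarrow>
      smooth_on (snd c ` (fst c \<inter> fst d)) (\<lambda>y. snd d (chart_inv c y))"
begin

lemma topspace_dom: "c \<in> \<A> \<Longrightarrow> topspace (subtopology M (fst c)) = fst c"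
  using openin_subset[OF open_dom, of c] by (simp add: Int_absorb1)

lemma inj_chart: "c \<in> \<A> \<Longrightarrow> inj_on (snd c) (fst c)"
  using homeomorphic_imp_injective_map[OF homeo] topspace_dom by metis

lemma chart_inv_chart [simp]: "c \<in> \<A> \<Longrightarrow> x \<in> fst c \<Longrightarrow> chart_inv c (snd c x) = x"
  using inj_chart by (rule inv_into_f_f)

lemma chart_image_open:
  assumes "c \<in> \<A>" "openin M U"
  shows "open (snd c ` (U \<inter> fst c))"
proof -
  have "openin (subtopology M (fst c)) (U \<inter> fst c)"
    using assms(2) by (auto simp: openin_subtopology)
  then have "openin (top_of_set (snd c ` fst c)) (snd c ` (U \<inter> fst c))"
    using homeomorphic_imp_open_map[OF homeo[OF assms(1)]] unfolding open_map_def by blast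
  then show ?thesis using openin_open_eq[OF open_img[OF assms(1)]] by blast
qed

lemma chart_preimage_open:
  assumes "c \<in> \<A>" "open S"
  shows "openin M {x \<in> fst c. snd c x \<in> S}"
proof -
  have "continuous_map (subtopology M (fst c)) (top_of_set (snd c ` fst c)) (snd c)"
    using homeo[OF assms(1)] by (rule homeomorphic_imp_continuous_map)
  then have "continuous_map (subtopology M (fst c)) euclidean (snd c)"
    by (simp add: continuous_map_in_subtopology)
  then have "openin (subtopology M (fst c)) {x \<in> topspace (subtopology M (fst c)). snd c x \<in> S}"
    by (rule openin_continuous_map_preimage) (simp add: assms(2) flip: open_openin)
  then show ?thesis
    using open_dom[OF assms(1)] topspace_dom[OF assms(1)] openin_trans_full by fastforce
qed

lemma chart_inv_in:
  assumes "c \<in> \<A>" "U \<subseteq> fst c" "y \<in> snd c ` U"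
  shows "chart_inv c y \<in> U" "snd c (chart_inv c y) = y"
  using assms by (auto simp: subset_eq)

lemma charts_atD: "c \<in> charts_at \<A> p \<Longrightarrow> c \<in> \<A>" "c \<in> charts_at \<A> p \<Longrightarrow> p \<in> fst c"
  by (auto simp: charts_at_def)

lemma transition_has_derivative:
  assumes "c \<in> charts_at \<A> p" "d \<in> charts_at \<A> p"
  shows "((\<lambda>y. snd d (chart_inv c y)) has_derivative dd (\<lambda>y. snd d (chart_inv c y)) (snd c p)) (at (snd c p))"
  by (rule smooth_on_has_derivative[OF smooth_transition]) (use assms in \<open>auto simp: charts_at_def\<close>)

lemma change_chart_has_derivative:
  assumes c: "c \<in> charts_at \<A> p" and d: "d \<in> charts_at \<A> p"
    and h: "((\<lambda>y. h (chart_inv d y)) has_derivative h') (at (snd d p))"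
  shows "((\<lambda>y. h (chart_inv c y)) has_derivative (\<lambda>w. h' (dd (\<lambda>y. snd d (chart_inv c y)) (snd c p) w))) (at (snd c p))"
proof -
  note cd = charts_atD[OF c] charts_atD[OF d]
  have "((\<lambda>y. h (chart_inv d (snd d (chart_inv c y)))) has_derivative
     (\<lambda>w. h' (dd (\<lambda>y. snd d (chart_inv c y)) (snd c p) w))) (at (snd c p))"
    by (rule has_derivative_compose[OF transition_has_derivative[OF c d]]) (use h cd in simp)
  then show ?thesis
    by (rule has_derivative_transform_within_open[OF _ chart_image_open[OF cd(1) open_dom[OF cd(3)]]])
       (use cd in auto)
qed

lemma transition_compose:
  assumes c: "c \<in> charts_at \<A> p" and d: "d \<in> charts_at \<A> p" and e: "e \<in> charts_at \<A> p"
  shows "dd (\<lambda>y. snd e (chart_inv c y)) (snd c p) w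
    = dd (\<lambda>y. snd e (chart_inv d y)) (snd d p) (dd (\<lambda>y. snd d (chart_inv c y)) (snd c p) w)"
  using change_chart_has_derivative[OF c d transition_has_derivative[OF d e]] by (simp add: dd_eqI)

lemma transition_self:
  assumes c: "c \<in> charts_at \<A> p"
  shows "dd (\<lambda>y. snd c (chart_inv c y)) (snd c p) = (\<lambda>w. w)"
proof (rule dd_eqI)
  show "((\<lambda>y. snd c (chart_inv c y)) has_derivative (\<lambda>w. w)) (at (snd c p))"
    by (rule has_derivative_transform_within_open[OF has_derivative_ident open_img[OF charts_atD(1)[OF c]]])
       (use charts_atD[OF c] in auto)
qed

text \<open>The tangent vector at \<open>p\<close> with coordinates \<open>w\<close> in the chart \<open>c\<close>.  It is \<open>0\<close> if \<open>p\<close> is outside the chart, which makes it linear in \<open>w\<close>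
at all points.\<close>

definition lift :: "('a, 'e) chart \<Rightarrow> 'a \<Rightarrow> 'e \<Rightarrow> ('a, 'e) tvec" where
  "lift c p w = (\<lambda>d. if c \<in> charts_at \<A> p \<and> d \<in> charts_at \<A> p
     then dd (\<lambda>y. snd d (chart_inv c y)) (snd c p) w else 0)"

lemma lift_linear: "linear (\<lambda>w. lift c p w d)"
proof (cases "c \<in> charts_at \<A> p \<and> d \<in> charts_at \<A> p")
  case True
  then show ?thesis
    unfolding lift_def using has_derivative_linear[OF transition_has_derivative] by auto
next
  case False
  then have "(\<lambda>w. lift c p w d) = (\<lambda>w. 0)" by (auto simp: lift_def)
  then show ?thesis by (simp add: linear_zero)
qed

lemma lift_add: "lift c p (u + v) = lift c p u + lift c p v"
  by (rule ext) (simp add: linear_add[OF lift_linear])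

lemma lift_diff: "lift c p (u - v) = lift c p u - lift c p v"
  by (rule ext) (simp add: linear_diff[OF lift_linear])

lemma lift_scale: "lift c p (a *\<^sub>R u) = tscale a (lift c p u)"
  by (rule ext) (simp add: linear_scale[OF lift_linear] tscale_def)

lemma lift_0: "lift c p 0 = 0"
  by (rule ext) (simp add: linear_0[OF lift_linear])

lemma lift_in: "c \<in> charts_at \<A> p \<Longrightarrow> lift c p w \<in> tangent_space \<A> p"
  unfolding tangent_space_def mem_Collect_eq lift_def
  by (intro conjI ballI allI impI) (simp_all only: simp_thms if_True if_False, rule transition_compose)

lemma lift_self: "c \<in> charts_at \<A> p \<Longrightarrow> lift c p w c = w"
  by (simp add: lift_def transition_self)

lemma tvec_eq_lift:
  assumes c: "c \<in> charts_at \<A> p" and v: "v \<in> tangent_space \<A> p"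
  shows "lift c p (v c) = v"
proof (rule ext)
  fix d
  show "lift c p (v c) d = v d"
  proof (cases "d \<in> charts_at \<A> p")
    case True
    then have "v d = dd (\<lambda>y. snd d (chart_inv c y)) (snd c p) (v c)"
      using c v unfolding tangent_space_def by blast
    then show ?thesis using True c by (simp only: lift_def simp_thms if_True)
  next
    case False
    then have "v d = 0" using v unfolding tangent_space_def by blast
    then show ?thesis using False by (simp only: lift_def simp_thms if_False)
  qed
qed

lemma tvec_eqI: "c \<in> charts_at \<A> p \<Longrightarrow> u \<in> tangent_space \<A> p \<Longrightarrow> v \<in> tangent_space \<A> p \<Longrightarrow> u c = v c \<Longrightarrow> u = v"
  by (rule trans[OF tvec_eq_lift[symmetric] trans[OF arg_cong[where f = "lift c p"] tvec_eq_lift]])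

lemma tangent_space_add:
  assumes "c \<in> charts_at \<A> p" "u \<in> tangent_space \<A> p" "v \<in> tangent_space \<A> p"
  shows "u + v \<in> tangent_space \<A> p"
proof -
  have "u + v = lift c p (u c + v c)" by (simp only: lift_add tvec_eq_lift[OF assms(1,2)] tvec_eq_lift[OF assms(1,3)])
  then show ?thesis using lift_in[OF assms(1)] by metis
qed

lemma tangent_space_diff:
  assumes "c \<in> charts_at \<A> p" "u \<in> tangent_space \<A> p" "v \<in> tangent_space \<A> p"
  shows "u - v \<in> tangent_space \<A> p"
proof -
  have "u - v = lift c p (u c - v c)" by (simp only: lift_diff tvec_eq_lift[OF assms(1,2)] tvec_eq_lift[OF assms(1,3)])
  then show ?thesis using lift_in[OF assms(1)] by metis
qed

lemma tangent_space_uminus: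
  assumes "c \<in> charts_at \<A> p" "u \<in> tangent_space \<A> p"
  shows "- u \<in> tangent_space \<A> p"
  using tangent_space_diff[OF assms(1) lift_in[OF assms(1), of 0] assms(2)] by (simp add: lift_0)

text \<open>The directional derivative is defined with an arbitrarily chosen chart; by the chain rule any chart may be used.\<close>

lemma dir_deriv_eq:
  assumes c: "c \<in> charts_at \<A> p" and v: "v \<in> tangent_space \<A> p"
    and h: "((\<lambda>y. h (chart_inv c y)) has_derivative h') (at (snd c p))"
  shows "dir_deriv \<A> p v h = h' (v c)"
proof -
  define d where "d = (SOME c. c \<in> charts_at \<A> p)"
  have d: "d \<in> charts_at \<A> p" unfolding d_def using c by (rule someI)
  have "v c = dd (\<lambda>y. snd c (chart_inv d y)) (snd d p) (v d)"
    using v c d unfolding tangent_space_def by blast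
  then show ?thesis
    unfolding dir_deriv_def d_def[symmetric] Let_def
    using dd_eqI[OF change_chart_has_derivative[OF d c h]] by (simp only:)
qed

lemma smooth_field_subset: "smooth_field \<A> U X \<Longrightarrow> V \<subseteq> U \<Longrightarrow> smooth_field \<A> V X"
  unfolding smooth_field_def by (blast intro: smooth_on_subset)

lemma smooth_fieldD:
  "smooth_field \<A> U X \<Longrightarrow> c \<in> \<A> \<Longrightarrow> smooth_on (snd c ` (U \<inter> fst c)) (\<lambda>y. X (chart_inv c y) c)"
  "smooth_field \<A> U X \<Longrightarrow> x \<in> U \<Longrightarrow> X x \<in> tangent_space \<A> x"
  by (auto simp: smooth_field_def)

lemma smooth_field_cong:
  assumes "openin M U" "smooth_field \<A> U X" "\<And>x. x \<in> U \<Longrightarrow> X x = Y x"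
  shows "smooth_field \<A> U Y"
  unfolding smooth_field_def
proof (intro conjI ballI)
  show "Y x \<in> tangent_space \<A> x" if "x \<in> U" for x
    using smooth_fieldD(2)[OF assms(2) that] assms(3)[OF that] by simp
  fix d assume d: "d \<in> \<A>"
  show "smooth_on (snd d ` (U \<inter> fst d)) (\<lambda>y. Y (chart_inv d y) d)"
    by (rule smooth_on_cong[OF chart_image_open[OF d assms(1)] smooth_fieldD(1)[OF assms(2) d]])
       (use d assms(3) in auto)
qed

lemma smooth_field_lift:
  assumes c: "c \<in> \<A>" and U: "openin M U" "U \<subseteq> fst c" and k: "smooth_on (snd c ` U) k"
  shows "smooth_field \<A> U (\<lambda>x. lift c x (k (snd c x)))"
  unfolding smooth_field_def
proof (intro conjI ballI)
  show "lift c x (k (snd c x)) \<in> tangent_space \<A> x" if "x \<in> U" for x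
    using that U c by (intro lift_in) (auto simp: charts_at_def)
  fix d assume d: "d \<in> \<A>"
  let ?S = "snd d ` (U \<inter> fst d)"
  let ?t = "\<lambda>y. snd c (chart_inv d y)"
  have op: "open ?S" by (rule chart_image_open[OF d U(1)])
  have t: "smooth_on ?S ?t"
    by (rule smooth_on_subset[OF smooth_transition[OF d c]]) (use U in auto)
  have tS: "?t ` ?S \<subseteq> snd c ` (fst c \<inter> fst d)" "?t ` ?S \<subseteq> snd c ` U" using U d by auto
  have "smooth_on ?S (\<lambda>y. dd (\<lambda>z. snd d (chart_inv c z)) (?t y) (k (?t y)))"
  proof (rule smooth_on_apply_linear[where P = "\<lambda>y. dd (\<lambda>z. snd d (chart_inv c z)) (?t y)" and k = "\<lambda>y. k (?t y)", OF op])
    show "linear (dd (\<lambda>z. snd d (chart_inv c z)) (?t y))" if "y \<in> ?S" for y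
      by (rule linear_frechet_derivative[OF smooth_on_imp_differentiable[OF smooth_transition[OF c d]]]) (use that tS in blast)
    show "smooth_on ?S (\<lambda>y. dd (\<lambda>z. snd d (chart_inv c z)) (?t y) w)" for w
      by (rule smooth_on_compose[OF op t smooth_on_dd[OF smooth_transition[OF c d]] tS(1)])
    show "smooth_on ?S (\<lambda>y. k (?t y))"
      by (rule smooth_on_compose[OF op t k tS(2)])
  qed
  then show "smooth_on ?S (\<lambda>y. lift c (chart_inv d y) (k (snd c (chart_inv d y))) d)"
    by (rule smooth_on_cong[OF op]) (use c d U in \<open>auto simp: lift_def charts_at_def\<close>)
qed

lemma smooth_field_coord: "c \<in> \<A> \<Longrightarrow> smooth_field \<A> (fst c) (\<lambda>x. lift c x w)"
  using smooth_field_lift[OF _ open_dom subset_refl smooth_on_const] by blast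

lemma smooth_field_add:
  assumes U: "openin M U" "c \<in> \<A>" "U \<subseteq> fst c" and X: "smooth_field \<A> U X" "smooth_field \<A> U Y"
  shows "smooth_field \<A> U (\<lambda>x. X x + Y x)"
  unfolding smooth_field_def
proof (intro conjI ballI)
  show "X x + Y x \<in> tangent_space \<A> x" if "x \<in> U" for x
    by (rule tangent_space_add[of c]) (use that U smooth_fieldD(2)[OF X(1)] smooth_fieldD(2)[OF X(2)] in \<open>auto simp: charts_at_def\<close>)
  show "smooth_on (snd d ` (U \<inter> fst d)) (\<lambda>y. (X (chart_inv d y) + Y (chart_inv d y)) d)" if "d \<in> \<A>" for d
    using smooth_on_add[OF chart_image_open[OF that U(1)] smooth_fieldD(1)[OF X(1) that] smooth_fieldD(1)[OF X(2) that]] by simp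
qed

end

section \<open>Connections in charts\<close>

locale connected_charts = charted_space M \<A>
  for M :: "'a topology" and \<A> :: "('a, 'e::euclidean_space) chart set" +
  fixes D :: "('a, 'e) connection"
  assumes affine: "affine_connection M \<A> D"
begin

lemmas affine_all = affine[unfolded affine_connection_def, THEN spec, THEN spec, THEN mp, THEN mp]

lemma D_linear: "openin M U \<Longrightarrow> smooth_field \<A> U Y \<Longrightarrow> p \<in> U \<Longrightarrow> tangent_linear \<A> p \<A> p (\<lambda>v. D p v Y)"
  by (rule affine_all[THEN conjunct1, rule_format])

lemma D_smooth: "openin M U \<Longrightarrow> smooth_field \<A> U Y \<Longrightarrow> smooth_field \<A> U X \<Longrightarrow> smooth_field \<A> U (\<lambda>p. D p (X p) Y)"
  by (rule affine_all[THEN conjunct2, THEN conjunct1, rule_format])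

lemma D_add: "openin M U \<Longrightarrow> smooth_field \<A> U Y \<Longrightarrow> smooth_field \<A> U Z \<Longrightarrow> p \<in> U \<Longrightarrow> v \<in> tangent_space \<A> p
   \<Longrightarrow> D p v (\<lambda>x. Y x + Z x) = D p v Y + D p v Z"
  by (rule affine_all[THEN conjunct2, THEN conjunct2, THEN conjunct1, rule_format])

lemma D_leibniz: "openin M U \<Longrightarrow> smooth_field \<A> U Y \<Longrightarrow> smooth_fun \<A> U h \<Longrightarrow> p \<in> U \<Longrightarrow> v \<in> tangent_space \<A> p
   \<Longrightarrow> D p v (\<lambda>x. tscale (h x) (Y x)) = tscale (dir_deriv \<A> p v h) (Y p) + tscale (h p) (D p v Y)"
  by (rule affine_all[THEN conjunct2, THEN conjunct2, THEN conjunct2, rule_format])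

lemma D_in: "openin M U \<Longrightarrow> smooth_field \<A> U Y \<Longrightarrow> p \<in> U \<Longrightarrow> v \<in> tangent_space \<A> p \<Longrightarrow> D p v Y \<in> tangent_space \<A> p"
  by (rule D_linear[unfolded tangent_linear_def, THEN conjunct1, rule_format])

text \<open>After multiplication by the indicator function of \<open>W\<close> the two fields are equal everywhere, and the Leibniz rule recovers their
covariant derivatives.\<close>

lemma D_local:
  assumes W: "openin M W" "p \<in> W" and Y: "smooth_field \<A> W Y" "smooth_field \<A> W Y'"
    and eq: "\<And>x. x \<in> W \<Longrightarrow> Y x = Y' x" and v: "v \<in> tangent_space \<A> p"
  shows "D p v Y = D p v Y'"
proof -
  let ?h = "indicator W :: 'a \<Rightarrow> real"
  have h: "smooth_fun \<A> W ?h"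
    unfolding smooth_fun_def
  proof
    fix c assume c: "c \<in> \<A>"
    show "smooth_on (snd c ` (W \<inter> fst c)) (\<lambda>y. ?h (chart_inv c y))"
      by (rule smooth_on_cong[OF chart_image_open[OF c W(1)] smooth_on_const[of _ 1]]) (use c in auto)
  qed
  have "(\<lambda>x. tscale (?h x) (Y x)) = (\<lambda>x. tscale (?h x) (Y' x))"
    using eq by (auto simp: fun_eq_iff indicator_def tscale_def)
  then have "tscale (dir_deriv \<A> p v ?h) (Y p) + tscale (?h p) (D p v Y)
    = tscale (dir_deriv \<A> p v ?h) (Y' p) + tscale (?h p) (D p v Y')"
    using D_leibniz[OF W(1) Y(1) h W(2) v] D_leibniz[OF W(1) Y(2) h W(2) v] by simp
  then show ?thesis using eq[OF W(2)] W(2) by (simp add: tscale_def fun_eq_iff)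
qed

definition christoffel :: "('a, 'e) chart \<Rightarrow> 'e \<Rightarrow> 'e \<Rightarrow> 'e \<Rightarrow> 'e" where
  "christoffel c y w z = D (chart_inv c y) (lift c (chart_inv c y) w) (\<lambda>x. lift c x z) c"

lemma christoffel_bilinear:
  assumes c: "c \<in> \<A>" and y: "y \<in> snd c ` fst c"
  shows "bilinear (christoffel c y)"
proof -
  let ?p = "chart_inv c y"
  have p: "?p \<in> fst c" "c \<in> charts_at \<A> ?p" using chart_inv_in[OF c subset_refl y] c by (auto simp: charts_at_def)
  note f = smooth_field_coord[OF c]
  have sc: "smooth_fun \<A> (fst c) (\<lambda>x. a::real)" for a by (simp add: smooth_fun_def smooth_on_const)
  have dc: "dir_deriv \<A> ?p v (\<lambda>x. a::real) = 0" if "v \<in> tangent_space \<A> ?p" for a v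
    using dir_deriv_eq[OF p(2) that has_derivative_const] .
  show ?thesis
    unfolding bilinear_def
  proof (intro conjI allI)
    fix w
    have "D ?p (lift c ?p w) (\<lambda>x. lift c x (a + b)) = D ?p (lift c ?p w) (\<lambda>x. lift c x a) + D ?p (lift c ?p w) (\<lambda>x. lift c x b)" for a b
      using D_add[OF open_dom[OF c] f f p(1) lift_in[OF p(2)]] by (simp add: lift_add)
    moreover have "D ?p (lift c ?p w) (\<lambda>x. lift c x (a *\<^sub>R b)) = tscale a (D ?p (lift c ?p w) (\<lambda>x. lift c x b))" for a b
      using D_leibniz[OF open_dom[OF c] f[of b] sc[of a] p(1) lift_in[OF p(2), of w]]
      by (simp add: lift_scale dc[OF lift_in[OF p(2)]]) (simp add: tscale_def fun_eq_iff)
    ultimately show "linear (christoffel c y w)" by (intro linearI) (simp_all add: christoffel_def tscale_def)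
  next
    fix z
    show "linear (\<lambda>w. christoffel c y w z)"
      using D_linear[OF open_dom[OF c] f p(1), of z] lift_in[OF p(2)]
      by (intro linearI) (simp_all add: christoffel_def tangent_linear_def lift_add lift_scale, simp add: tscale_def)
  qed
qed

lemma christoffel_smooth:
  assumes c: "c \<in> \<A>"
  shows "smooth_on (snd c ` fst c) (\<lambda>y. christoffel c y w z)"
proof -
  have "smooth_field \<A> (fst c) (\<lambda>p. D p (lift c p w) (\<lambda>x. lift c x z))"
    by (rule D_smooth[OF open_dom[OF c] smooth_field_coord[OF c] smooth_field_coord[OF c]])
  from smooth_fieldD(1)[OF this c] show ?thesis by (simp add: christoffel_def)
qed

text \<open>Near \<open>p\<close> the field is the sum of the coordinate fields with its components as coefficients; apply locality and the Leibniz rule.\<close>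

lemma D_coord:
  assumes U: "openin M U" "smooth_field \<A> U Y" and c: "c \<in> \<A>" and p: "p \<in> U" "p \<in> fst c"
    and v: "v \<in> tangent_space \<A> p"
  shows "D p v Y c = dd (\<lambda>y. Y (chart_inv c y) c) (snd c p) (v c) + christoffel c (snd c p) (v c) (Y p c)"
proof -
  let ?W = "U \<inter> fst c"
  have cp: "c \<in> charts_at \<A> p" using c p by (simp add: charts_at_def)
  have W: "openin M ?W" "p \<in> ?W" using U(1) open_dom[OF c] p by auto
  have YW: "smooth_field \<A> ?W Y" by (rule smooth_field_subset[OF U(2)]) simp
  have Yc: "smooth_on (snd c ` ?W) (\<lambda>y. Y (chart_inv c y) c)" by (rule smooth_fieldD(1)[OF U(2) c])
  define k where "k b x = Y x c \<bullet> b" for b x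
  have lf: "smooth_field \<A> ?W (\<lambda>x. lift c x b)" for b
    by (rule smooth_field_subset[OF smooth_field_coord[OF c]]) simp
  have kf: "smooth_fun \<A> ?W (k b)" for b
    unfolding smooth_fun_def
  proof
    fix d assume d: "d \<in> \<A>"
    let ?S = "snd d ` (?W \<inter> fst d)"
    have op: "open ?S" by (rule chart_image_open[OF d W(1)])
    have "smooth_on ?S (\<lambda>y. Y (chart_inv c (snd c (chart_inv d y))) c)"
      by (rule smooth_on_compose[OF op smooth_on_subset[OF smooth_transition[OF d c]] Yc]) (use c d in auto)
    then have "smooth_on ?S (\<lambda>y. Y (chart_inv c (snd c (chart_inv d y))) c \<bullet> b)"
      by (rule smooth_on_linear[OF bounded_linear_inner_left op])
    then show "smooth_on ?S (\<lambda>y. k b (chart_inv d y))"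
      by (rule smooth_on_cong[OF op]) (use c d in \<open>auto simp: k_def\<close>)
  qed
  have kl: "smooth_field \<A> ?W (\<lambda>x. tscale (k b x) (lift c x b))" for b
  proof -
    have "smooth_on (snd c ` ?W) (\<lambda>y. (Y (chart_inv c y) c \<bullet> b) *\<^sub>R b)"
      by (intro smooth_on_linear[OF bounded_linear_scaleR_left] smooth_on_linear[OF bounded_linear_inner_left] chart_image_open c U(1) Yc)
    from smooth_field_lift[OF c W(1) _ this]
    have "smooth_field \<A> ?W (\<lambda>x. lift c x ((Y (chart_inv c (snd c x)) c \<bullet> b) *\<^sub>R b))" by simp
    then show ?thesis
      by (rule smooth_field_cong[OF W(1)]) (use c in \<open>simp add: k_def lift_scale\<close>)
  qed
  have sum: "smooth_field \<A> ?W (\<lambda>x. \<Sum>b\<in>B. tscale (k b x) (lift c x b)) \<and>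
     D p v (\<lambda>x. \<Sum>b\<in>B. tscale (k b x) (lift c x b)) =
      (\<Sum>b\<in>B. tscale (dir_deriv \<A> p v (k b)) (lift c p b) + tscale (k b p) (D p v (\<lambda>x. lift c x b)))"
    if "finite B" for B
    using that
  proof (induction B)
    case empty
    have z: "smooth_field \<A> ?W (\<lambda>x. 0)" using lf[of 0] by (simp add: lift_0)
    have "D p v (\<lambda>x. 0) = D p v (\<lambda>x. 0) + D p v (\<lambda>x. 0)"
      using D_add[OF W(1) z z W(2) v] by simp
    then show ?case using z by (simp add: zero_fun_def)
  next
    case (insert b B)
    have "smooth_field \<A> ?W (\<lambda>x. tscale (k b x) (lift c x b) + (\<Sum>b\<in>B. tscale (k b x) (lift c x b)))"
      using insert.IH by (intro smooth_field_add[OF W(1) c] kl) auto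
    moreover have "D p v (\<lambda>x. tscale (k b x) (lift c x b) + (\<Sum>b\<in>B. tscale (k b x) (lift c x b)))
      = D p v (\<lambda>x. tscale (k b x) (lift c x b)) + D p v (\<lambda>x. \<Sum>b\<in>B. tscale (k b x) (lift c x b))"
      using insert.IH by (intro D_add[OF W(1) kl _ W(2) v]) auto
    moreover have "D p v (\<lambda>x. tscale (k b x) (lift c x b)) = tscale (dir_deriv \<A> p v (k b)) (lift c p b) + tscale (k b p) (D p v (\<lambda>x. lift c x b))"
      by (rule D_leibniz[OF W(1) lf kf W(2) v])
    ultimately show ?case
      by (simp only: sum.insert[OF insert.hyps] conjunct2[OF insert.IH] simp_thms)
  qed
  have "D p v Y = D p v (\<lambda>x. \<Sum>b\<in>Basis. tscale (k b x) (lift c x b))"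
  proof (rule D_local[OF W YW _ _ v])
    show "smooth_field \<A> ?W (\<lambda>x. \<Sum>b\<in>Basis. tscale (k b x) (lift c x b))" using sum[of Basis] by simp
    fix x assume x: "x \<in> ?W"
    then have cx: "c \<in> charts_at \<A> x" using c by (simp add: charts_at_def)
    have "Y x = lift c x (Y x c)"
      using tvec_eq_lift[OF cx] smooth_fieldD(2)[OF U(2)] x by simp
    also have "\<dots> = lift c x (\<Sum>b\<in>Basis. k b x *\<^sub>R b)" by (simp add: k_def euclidean_representation)
    also have "\<dots> = (\<Sum>b\<in>Basis. tscale (k b x) (lift c x b))"
      by (rule ext) (simp add: linear_sum[OF lift_linear] linear_scale[OF lift_linear] sum_fun_apply tscale_def)
    finally show "Y x = \<dots>" .
  qed
  also have "\<dots> = (\<Sum>b\<in>Basis. tscale (dir_deriv \<A> p v (k b)) (lift c p b) + tscale (k b p) (D p v (\<lambda>x. lift c x b)))"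
    using sum[of Basis] by simp
  finally have "D p v Y c = (\<Sum>b\<in>Basis. dir_deriv \<A> p v (k b) *\<^sub>R b + k b p *\<^sub>R D p v (\<lambda>x. lift c x b) c)"
    by (simp add: sum_fun_apply tscale_def lift_self[OF cp])
  moreover have "dir_deriv \<A> p v (k b) = dd (\<lambda>y. Y (chart_inv c y) c) (snd c p) (v c) \<bullet> b" for b
  proof (rule dir_deriv_eq[OF cp v])
    show "((\<lambda>y. k b (chart_inv c y)) has_derivative (\<lambda>w. dd (\<lambda>y. Y (chart_inv c y) c) (snd c p) w \<bullet> b)) (at (snd c p))"
      unfolding k_def by (rule bounded_linear.has_derivative[OF bounded_linear_inner_left smooth_on_has_derivative[OF Yc]]) (use p in auto)
  qed
  moreover have "D p v (\<lambda>x. lift c x b) c = christoffel c (snd c p) (v c) b" for b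
    by (simp add: christoffel_def c p(2) tvec_eq_lift[OF cp v])
  moreover have "christoffel c (snd c p) (v c) (Y p c) = (\<Sum>b\<in>Basis. k b p *\<^sub>R christoffel c (snd c p) (v c) b)"
    unfolding k_def by (rule linear_family_rep) (use christoffel_bilinear[OF c, of "snd c p"] p(2) in \<open>auto simp: bilinear_def\<close>)
  ultimately show ?thesis by (simp add: sum.distrib euclidean_representation)
qed

lemma D_coord_field:
  assumes c: "c \<in> \<A>" and p: "p \<in> fst c" and v: "v \<in> tangent_space \<A> p"
  shows "D p v (\<lambda>x. lift c x z) = lift c p (christoffel c (snd c p) (v c) z)"
proof -
  have cp: "c \<in> charts_at \<A> p" using c p by (simp add: charts_at_def)
  have "christoffel c (snd c p) (v c) z = D p v (\<lambda>x. lift c x z) c"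
    by (simp add: christoffel_def c p tvec_eq_lift[OF cp v])
  then show ?thesis
    using tvec_eq_lift[OF cp D_in[OF open_dom[OF c] smooth_field_coord[OF c] p v]] by simp
qed

end

locale levi_civita_charts = charted_space M \<A>
  for M :: "'a topology" and \<A> :: "('a, 'e::euclidean_space) chart set" +
  fixes g :: "('a, 'e) metric" and D :: "('a, 'e) connection"
  assumes levi_civita: "levi_civita_connection M \<A> g D"
begin

sublocale connected_charts M \<A> D
  by unfold_locales (use levi_civita in \<open>simp add: levi_civita_connection_def\<close>)

lemmas levi_civita_all = levi_civita[unfolded levi_civita_connection_def, THEN conjunct2,
  THEN spec, THEN spec, THEN spec, THEN mp, THEN mp, THEN mp]

text \<open>The components of coordinate fields in their own chart are constant, so the bracket vanishes there; as a tangent vector it is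
determined by its components in one chart.\<close>

lemma lie_bracket_coord_fields:
  assumes c: "c \<in> \<A>" and p: "p \<in> fst c"
  shows "lie_bracket \<A> (\<lambda>x. lift c x w) (\<lambda>x. lift c x z) p = 0"
    and "christoffel c (snd c p) w z = christoffel c (snd c p) z w"
proof -
  have cp: "c \<in> charts_at \<A> p" using c p by (simp add: charts_at_def)
  note f = smooth_field_coord[OF c] and op = open_dom[OF c]
  have eq: "D p (lift c p w) (\<lambda>x. lift c x z) - D p (lift c p z) (\<lambda>x. lift c x w)
      = lie_bracket \<A> (\<lambda>x. lift c x w) (\<lambda>x. lift c x z) p"
    by (rule levi_civita_all[OF op f f, THEN conjunct1, rule_format, OF p])
  have dz: "dir_deriv \<A> p v (\<lambda>x. lift c x z c) = 0" if "v \<in> tangent_space \<A> p" for v z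
  proof (rule dir_deriv_eq[OF cp that])
    show "((\<lambda>y. lift c (chart_inv c y) z c) has_derivative (\<lambda>w. 0)) (at (snd c p))"
      by (rule has_derivative_transform_within_open[OF has_derivative_const open_img[OF c]])
         (use c p in \<open>auto simp: lift_self charts_at_def\<close>)
  qed
  have lc: "lie_bracket \<A> (\<lambda>x. lift c x w) (\<lambda>x. lift c x z) p c = 0"
    using cp by (simp add: lie_bracket_def dz lift_in)
  have t: "lie_bracket \<A> (\<lambda>x. lift c x w) (\<lambda>x. lift c x z) p \<in> tangent_space \<A> p"
    unfolding eq[symmetric] by (intro tangent_space_diff[OF cp] D_in[OF op f p] lift_in[OF cp])
  show l0: "lie_bracket \<A> (\<lambda>x. lift c x w) (\<lambda>x. lift c x z) p = 0"
    using tvec_eq_lift[OF cp t] lc by (simp add: lift_0)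
  have "(D p (lift c p w) (\<lambda>x. lift c x z) - D p (lift c p z) (\<lambda>x. lift c x w)) c = 0"
    unfolding eq l0 by simp
  then show "christoffel c (snd c p) w z = christoffel c (snd c p) z w"
    by (simp add: christoffel_def c p)
qed

lemma metric_coord:
  assumes c: "c \<in> \<A>" and p: "p \<in> fst c"
    and diff: "(\<lambda>y. g (chart_inv c y) (lift c (chart_inv c y) v) (lift c (chart_inv c y) w)) differentiable (at (snd c p))"
  shows "dd (\<lambda>y. g (chart_inv c y) (lift c (chart_inv c y) v) (lift c (chart_inv c y) w)) (snd c p) u
    = g p (lift c p (christoffel c (snd c p) u v)) (lift c p w) + g p (lift c p v) (lift c p (christoffel c (snd c p) u w))"
proof -
  have cp: "c \<in> charts_at \<A> p" using c p by (simp add: charts_at_def)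
  note f = smooth_field_coord[OF c] and op = open_dom[OF c]
  have "dir_deriv \<A> p (lift c p u) (\<lambda>x. g x (lift c x v) (lift c x w))
     = g p (D p (lift c p u) (\<lambda>x. lift c x v)) (lift c p w) + g p (lift c p v) (D p (lift c p u) (\<lambda>x. lift c x w))"
    by (rule levi_civita_all[OF op f f, THEN conjunct2, rule_format, OF p lift_in[OF cp]])
  then show ?thesis
    using dir_deriv_eq[OF cp lift_in[OF cp] dd_works[OF diff]]
    by (simp add: D_coord_field[OF c p lift_in[OF cp]] lift_self[OF cp])
qed

end

section \<open>Orthogonal families\<close>

lemma orthogonal_independent:
  fixes B :: "'x::euclidean_space \<Rightarrow> 'x \<Rightarrow> real"
  assumes B: "bilinear B" and K: "finite K" "\<And>a b. a \<in> K \<Longrightarrow> b \<in> K \<Longrightarrow> a \<noteq> b \<Longrightarrow> B a b = 0"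
    "\<And>a. a \<in> K \<Longrightarrow> B a a \<noteq> 0"
  shows "independent K"
proof (rule independent_if_scalars_zero[OF K(1)])
  fix f x assume 0: "(\<Sum>x\<in>K. f x *\<^sub>R x) = 0" and x: "x \<in> K"
  have l: "linear (\<lambda>a. B a x)" using B by (simp add: bilinear_def)
  have "0 = B (\<Sum>a\<in>K. f a *\<^sub>R a) x" by (simp add: 0 linear_0[OF l])
  also have "\<dots> = (\<Sum>a\<in>K. f a * B a x)" by (simp add: linear_sum[OF l] linear_scale[OF l])
  also have "\<dots> = (\<Sum>a\<in>K. if a = x then f x * B x x else 0)"
    using K(2) x by (intro sum.cong) auto
  also have "\<dots> = f x * B x x" using K(1) x by simp
  finally show "f x = 0" using K(3)[OF x] by simp
qed

lemma orthogonal_span_nonpos: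
  fixes B :: "'x::euclidean_space \<Rightarrow> 'x \<Rightarrow> real"
  assumes B: "bilinear B" and K: "finite K" "\<And>a b. a \<in> K \<Longrightarrow> b \<in> K \<Longrightarrow> a \<noteq> b \<Longrightarrow> B a b = 0"
    "\<And>a. a \<in> K \<Longrightarrow> B a a \<le> 0" and x: "x \<in> span K"
  shows "B x x \<le> 0"
proof -
  obtain f where f: "x = (\<Sum>a\<in>K. f a *\<^sub>R a)" using x K(1) by (auto simp: span_finite)
  have l: "linear (B a)" "linear (\<lambda>a. B a b)" for a b using B by (auto simp: bilinear_def)
  have "B x x = (\<Sum>b\<in>K. \<Sum>a\<in>K. f b * (f a * B a b))"
    unfolding f by (simp add: linear_sum[OF l(1)] linear_scale[OF l(1)] linear_sum[OF l(2)] linear_scale[OF l(2)] sum_distrib_left)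
  also have "\<dots> = (\<Sum>b\<in>K. \<Sum>a\<in>K. if a = b then f b * (f b * B b b) else 0)"
    using K(2) by (intro sum.cong) auto
  also have "\<dots> = (\<Sum>b\<in>K. (f b)\<^sup>2 * B b b)" using K(1) by (simp add: power2_eq_square mult.assoc)
  also have "\<dots> \<le> 0" using K(3) by (intro sum_nonpos mult_nonneg_nonpos) auto
  finally show ?thesis .
qed

locale orthonormal_frame =
  fixes G :: "'e::euclidean_space \<Rightarrow> 'e \<Rightarrow> real" and r s :: nat and E :: "nat \<Rightarrow> 'e"
  assumes G_bil: "bilinear G" and G_symm: "G v w = G w v" and dim_e: "DIM('e) = r + s"
    and ortho: "i \<in> {1..r + s} \<Longrightarrow> j \<in> {1..r + s} \<Longrightarrow> G (E i) (E j) = (if i \<noteq> j then 0 else if i \<le> r then 1 else - 1)"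
begin

lemma frame_inj: "inj_on E {1..r + s}"
proof (rule inj_onI)
  fix i j assume ij: "i \<in> {1..r + s}" "j \<in> {1..r + s}" "E i = E j"
  have "G (E i) (E j) \<noteq> 0" using ortho[of i i] ij by auto
  then show "i = j" using ortho[OF ij(1,2)] by (auto split: if_splits)
qed

lemma frame_span: "span (E ` {1..r + s}) = UNIV"
proof -
  have "independent (E ` {1..r + s})"
    by (rule orthogonal_independent[OF G_bil]) (auto simp: ortho split: if_splits)
  then have "dim (E ` {1..r + s}) = card (E ` {1..r + s})" by (rule dim_eq_card_independent)
  also have "\<dots> = r + s" unfolding card_image[OF frame_inj] by simp
  finally have "dim (E ` {1..r + s}) = r + s" .
  then show ?thesis using dim_eq_full dim_e by metis
qed

lemma frame_zero:
  fixes L :: "'e \<Rightarrow> 'f::real_vector"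
  assumes "linear L" "\<And>i. i \<in> {1..r + s} \<Longrightarrow> L (E i) = 0"
  shows "L v = 0"
proof -
  have "v \<in> span (E ` {1..r + s})" unfolding frame_span by simp
  then show ?thesis
    by (rule linear_eq_0_on_span[OF assms(1), rotated]) (use assms(2) in auto)
qed

lemma frame_nondegenerate:
  assumes "\<And>w. G v w = 0"
  shows "v = 0"
proof -
  have "v \<in> span (E ` {1..r + s})" unfolding frame_span by simp
  then obtain f where f: "v = (\<Sum>a\<in>E ` {1..r + s}. f a *\<^sub>R a)" by (auto simp: span_finite)
  have l: "linear (\<lambda>a. G a b)" for b using G_bil by (auto simp: bilinear_def)
  have "f a = 0" if a: "a \<in> E ` {1..r + s}" for a
  proof -
    have "0 = G v a" using assms by simp
    also have "\<dots> = (\<Sum>b\<in>E ` {1..r + s}. f b * G b a)"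
      by (simp add: f linear_sum[OF l] linear_scale[OF l])
    also have "\<dots> = (\<Sum>b\<in>E ` {1..r + s}. if b = a then f a * G a a else 0)"
      using a by (intro sum.cong) (auto simp: ortho split: if_splits)
    also have "\<dots> = f a * G a a" using a by simp
    finally show ?thesis using a ortho by (auto split: if_splits)
  qed
  then show ?thesis unfolding f by (simp add: sum.neutral)
qed

end

text \<open>By dimension there is a vector outside the span of the image of \<open>F\<close> and the position vector; subtracting its projection gives
\<open>t'\<close> orthogonal to both.  If \<open>t'\<close> were not spacelike, then together with the timelike frame vectors and, if \<open>\<kappa> < 0\<close>, with
\<open>q\<close> it would span a negative semidefinite subspace that is too large for the signature.\<close>

lemma (in nondegenerate_form) unit_normal_exists:
  fixes F :: "'e::euclidean_space \<Rightarrow> 'v"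
  assumes fr: "orthonormal_frame G r s E" and F: "linear F" and iso: "\<And>v w. ip (F v) (F w) = G v w"
    and dim: "DIM('v) = DIM('e) + (if (\<kappa>::real) = 0 then 1 else 2)"
    and q: "\<kappa> \<noteq> 0 \<Longrightarrow> ip q q = 1 / \<kappa> \<and> (\<forall>v. ip q (F v) = 0)"
    and inertia: "\<And>W. subspace W \<Longrightarrow> (\<And>x. x \<in> W \<Longrightarrow> ip x x \<le> 0) \<Longrightarrow> dim W \<le> (if \<kappa> < 0 then s + 1 else s)"
  obtains \<nu> where "ip \<nu> \<nu> = 1" "\<And>v. ip \<nu> (F v) = 0" "\<kappa> \<noteq> 0 \<Longrightarrow> ip q \<nu> = 0"
proof -
  interpret orthonormal_frame G r s E by (rule fr)
  let ?I = "{1..r + s}"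
  define Q where "Q = (if \<kappa> = 0 then {} else {q})"
  define W0 where "W0 = span (F ` E ` ?I \<union> Q)"
  have "dim W0 \<le> card (F ` E ` ?I \<union> Q)"
    unfolding W0_def dim_span by (rule dim_le_card') (simp add: Q_def)
  also have "\<dots> \<le> (r + s) + card Q"
    by (rule order_trans[OF card_Un_le])
       (intro add_mono order_trans[OF card_image_le] le_refl, simp_all add: card_image_le[THEN order_trans])
  also have "\<dots> < DIM('v)" using dim dim_e by (auto simp: Q_def)
  finally have "W0 \<noteq> UNIV" using dim_UNIV[where ?'a = 'v] by auto
  then obtain t where t: "t \<notin> W0" by blast
  define \<epsilon> where "\<epsilon> i = (if i \<le> r then 1 else - 1 :: real)" for i :: nat
  \<comment> \<open>The orthogonal projection of \<open>t\<close>: each frame vector has square \<open>\<epsilon> i\<close>, and \<open>q\<close> has square \<open>1 / \<kappa>\<close>.\<close>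
  define u where "u = (\<Sum>i\<in>?I. (\<epsilon> i * ip t (F (E i))) *\<^sub>R F (E i)) + (\<kappa> * ip t q) *\<^sub>R q"
  define t' where "t' = t - u"
  have "u \<in> W0"
    unfolding u_def W0_def
  proof (intro span_add span_sum)
    show "(\<epsilon> i * ip t (F (E i))) *\<^sub>R F (E i) \<in> span (F ` E ` ?I \<union> Q)" if "i \<in> ?I" for i
      using that by (intro span_scale span_base) auto
    show "(\<kappa> * ip t q) *\<^sub>R q \<in> span (F ` E ` ?I \<union> Q)"
    proof (cases "\<kappa> = 0")
      case False
      show ?thesis by (intro span_scale span_base) (use False in \<open>simp add: Q_def\<close>)
    qed (simp add: span_zero)
  qed
  then have t'W: "t' \<notin> W0" using t span_add[of t' _ u] unfolding t'_def W0_def by force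
  then have t'0: "t' \<noteq> 0" unfolding W0_def using span_zero by metis
  have \<epsilon>: "\<epsilon> i * G (E i) (E j) = (if i = j then 1 else 0)" if "i \<in> ?I" "j \<in> ?I" for i j
    using ortho[OF that] by (auto simp: \<epsilon>_def)
  note l = linear_sum[OF ip_linear(2)] linear_scale[OF ip_linear(2)] linear_add[OF ip_linear(2)]
  have orthE: "ip t' (F (E j)) = 0" if j: "j \<in> ?I" for j
  proof -
    have "ip u (F (E j)) = (\<Sum>i\<in>?I. ip t (F (E i)) * (\<epsilon> i * G (E i) (E j))) + \<kappa> * ip t q * ip q (F (E j))"
      by (simp add: u_def l iso mult_ac)
    also have "\<dots> = (\<Sum>i\<in>?I. if i = j then ip t (F (E j)) else 0) + 0"
      using q \<epsilon> j by (intro arg_cong2[where f = "(+)"] sum.cong refl) auto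
    also have "\<dots> = ip t (F (E j))" using j by simp
    finally show ?thesis by (simp add: t'_def ip_simps)
  qed
  have "linear (\<lambda>v. ip t' (F v))"
    using linear_compose[OF F ip_linear(1)] by (simp add: o_def)
  then have orthF: "ip t' (F v) = 0" for v
    by (rule frame_zero) (rule orthE)
  have orthq: "ip q t' = 0" if \<kappa>: "\<kappa> \<noteq> 0"
  proof -
    have "ip u q = (\<Sum>i\<in>?I. \<epsilon> i * ip t (F (E i)) * ip (F (E i)) q) + \<kappa> * ip t q * ip q q"
      by (simp add: u_def l)
    also have "\<dots> = ip t q" using q[OF \<kappa>] \<kappa> by (simp add: ip_sym[of "F _" q])
    finally have "ip t' q = 0" by (simp add: t'_def ip_simps)
    then show ?thesis by (simp only: ip_sym[of q t'])
  qed
  have pos: "ip t' t' > 0"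
  proof (rule ccontr)
    assume "\<not> ip t' t' > 0"
    then have np: "ip t' t' \<le> 0" by simp
    define K where "K = F ` E ` {r + 1..r + s} \<union> (if \<kappa> < 0 then {q} else {})"
    have sub: "{r + 1..r + s} \<subseteq> ?I" by auto
    have fK: "finite K" by (simp add: K_def)
    have Fq: "ip (F v) q = 0" "ip q (F v) = 0" if "\<kappa> < 0" for v using q that ip_sym[of "F v" q] by auto
    have oK: "ip a b = 0" if "a \<in> K" "b \<in> K" "a \<noteq> b" for a b
      using that ortho subsetD[OF sub] Fq by (auto simp: K_def iso split: if_splits)
    have neg: "ip a a < 0" if "a \<in> K" for a
      using that ortho subsetD[OF sub] q by (auto simp: K_def iso split: if_splits)
    have "K \<subseteq> F ` E ` ?I \<union> Q" using sub by (auto simp: K_def Q_def)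
    then have "span K \<subseteq> W0" unfolding W0_def by (rule span_mono)
    then have t'K: "t' \<notin> span K" using t'W by blast
    have "independent K"
      by (rule orthogonal_independent[OF ip_bilinear fK oK]) (use neg in force)+
    then have ind: "independent (insert t' K)" using t'K by (simp add: independent_insert)
    have injF: "inj_on F (E ` {r + 1..r + s})"
    proof (rule inj_onI)
      fix a b assume ab: "a \<in> E ` {r + 1..r + s}" "b \<in> E ` {r + 1..r + s}" "F a = F b"
      have "G a b = G a a" using iso[of a b] iso[of a a] ab by simp
      then show "a = b" using ab ortho subsetD[OF sub] by (auto split: if_splits)
    qed
    have "card (F ` E ` {r + 1..r + s}) = s"
      unfolding card_image[OF injF] card_image[OF inj_on_subset[OF frame_inj sub]] by simp
    moreover have "q \<notin> F ` E ` {r + 1..r + s}" if "\<kappa> < 0"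
    proof
      assume "q \<in> F ` E ` {r + 1..r + s}"
      then obtain v where "q = F v" by blast
      then have "ip q q = 0" using q that by auto
      then show False using q that by auto
    qed
    ultimately have cK: "card K = (if \<kappa> < 0 then s + 1 else s)" by (simp add: K_def)
    have "t' \<notin> K" using t'K span_base by blast
    then have "dim (span (insert t' K)) = card K + 1"
      using dim_eq_card_independent[OF ind] fK by simp
    moreover have "dim (span (insert t' K)) \<le> (if \<kappa> < 0 then s + 1 else s)"
    proof (rule inertia)
      have tq: "ip t' q = 0" if "\<kappa> < 0" using orthq ip_sym[of t' q] that by simp
      have tK1: "ip t' a = 0" if "a \<in> K" for a
        using that orthF tq by (auto simp: K_def split: if_splits)
      have tK: "ip t' a = 0" "ip a t' = 0" if "a \<in> K" for a
        using tK1[OF that] ip_sym[of a t'] by simp_all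
      show "ip x x \<le> 0" if "x \<in> span (insert t' K)" for x
        by (rule orthogonal_span_nonpos[OF ip_bilinear _ _ _ that])
           (use fK oK tK np neg in \<open>auto intro: less_imp_le\<close>)
    qed simp
    ultimately show False using cK by simp
  qed
  define \<nu> where "\<nu> = (1 / sqrt (ip t' t')) *\<^sub>R t'"
  show ?thesis
  proof
    show "ip \<nu> \<nu> = 1" using pos by (simp add: \<nu>_def ip_simps field_simps)
    show "ip \<nu> (F v) = 0" for v by (simp add: \<nu>_def ip_simps orthF)
    show "\<kappa> \<noteq> 0 \<Longrightarrow> ip q \<nu> = 0" by (simp add: \<nu>_def ip_simps orthq)
  qed
qed

section \<open>Pseudo-Euclidean inner products\<close>

lemma coord_basis:
  obtains b :: "nat \<Rightarrow> 'v::euclidean_space" where "bij_betw b {1..DIM('v)} Basis" "\<And>i x::'v. coord i x = x \<bullet> b i"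
proof -
  obtain b :: "nat \<Rightarrow> 'v" where "bij_betw b {1..DIM('v)} Basis"
    using ex_bij_betw_nat_finite_1[of "Basis :: 'v set"] by auto
  then have "bij_betw (SOME b :: nat \<Rightarrow> 'v. bij_betw b {1..DIM('v)} Basis) {1..DIM('v)} Basis"
    by (rule someI[where P = "\<lambda>b. bij_betw b {1..DIM('v)} Basis"])
  then show ?thesis by (rule that) (simp add: coord_def)
qed

lemma coord_linear: "linear (coord i :: 'v::euclidean_space \<Rightarrow> real)"
  by (rule linearI) (simp_all add: coord_def inner_add_left)

lemma coord_bounded_linear: "bounded_linear (coord i :: 'v::euclidean_space \<Rightarrow> real)"
  using coord_linear linear_conv_bounded_linear by blast

lemma coord_eq_0: "(\<And>i. i \<in> {1..DIM('v)} \<Longrightarrow> coord i x = 0) \<Longrightarrow> x = (0 :: 'v::euclidean_space)"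
proof -
  assume 0: "\<And>i. i \<in> {1..DIM('v)} \<Longrightarrow> coord i x = 0"
  obtain b :: "nat \<Rightarrow> 'v" where b: "bij_betw b {1..DIM('v)} Basis" "\<And>i x::'v. coord i x = x \<bullet> b i"
    by (rule coord_basis[where ?'v = 'v]) (rule that)
  have "x \<bullet> u = 0" if "u \<in> Basis" for u
  proof -
    have "u \<in> b ` {1..DIM('v)}" using b(1) that by (simp add: bij_betw_def)
    then obtain i where "i \<in> {1..DIM('v)}" "u = b i" by blast
    then show ?thesis using 0[of i] b(2)[of i x] by simp
  qed
  then show "x = 0" using euclidean_all_zero_iff by blast
qed

lemma pseudo_inner_bilinear: "bilinear (pseudo_inner p s :: 'v::euclidean_space \<Rightarrow> 'v \<Rightarrow> real)"
  unfolding bilinear_def pseudo_inner_def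
  by (intro conjI allI linearI)
     (simp_all add: linear_add[OF coord_linear] linear_scale[OF coord_linear] algebra_simps sum.distrib sum_distrib_left)

lemma pseudo_inner_sym: "pseudo_inner p s x y = pseudo_inner p s y x"
  by (simp add: pseudo_inner_def mult.commute)

lemma pseudo_inner_nondegenerate:
  assumes dim: "DIM('v::euclidean_space) = p + s"
  shows "nondegenerate_form (pseudo_inner p s :: 'v \<Rightarrow> 'v \<Rightarrow> real)"
proof
  fix x :: 'v assume 0: "\<And>y. pseudo_inner p s x y = 0"
  obtain b :: "nat \<Rightarrow> 'v" where b: "bij_betw b {1..DIM('v)} Basis" "\<And>i x::'v. coord i x = x \<bullet> b i"
    by (rule coord_basis[where ?'v = 'v]) (rule that)
  show "x = 0"
  proof (rule coord_eq_0)
    fix j assume j: "j \<in> {1..DIM('v)}"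
    have d: "coord i (b j) = (if i = j then 1 else 0)" if "i \<in> {1..DIM('v)}" for i
    proof -
      have "b i \<in> Basis" "b j \<in> Basis" using bij_betwE[OF b(1)] that j by blast+
      moreover have "b i = b j \<longleftrightarrow> i = j" by (rule inj_on_eq_iff[OF bij_betw_imp_inj_on[OF b(1)] that j])
      ultimately show ?thesis by (auto simp: b(2) inner_Basis)
    qed
    have "(\<Sum>i\<in>{1..p}. coord i x * coord i (b j)) = (\<Sum>i\<in>{1..p}. if i = j then coord j x else 0)"
      using dim by (intro sum.cong refl) (auto simp: d)
    moreover have "(\<Sum>i\<in>{p + 1..p + s}. coord i x * coord i (b j)) = (\<Sum>i\<in>{p + 1..p + s}. if i = j then coord j x else 0)"
      using dim by (intro sum.cong refl) (auto simp: d)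
    ultimately show "coord j x = 0"
      using 0[of "b j"] j dim by (auto simp: pseudo_inner_def split: if_splits)
  qed
qed (auto intro: pseudo_inner_bilinear pseudo_inner_sym)

text \<open>The projection to the negative coordinates is injective on \<open>W\<close>: a vector in its kernel has nonnegative square, hence square
zero, hence no positive coordinates either.\<close>

lemma pseudo_inner_inertia:
  fixes W :: "'v::euclidean_space set"
  assumes dim: "DIM('v) = p + s" and W: "subspace W" "\<And>x. x \<in> W \<Longrightarrow> pseudo_inner p s x x \<le> 0"
  shows "dim W \<le> s"
proof -
  obtain b :: "nat \<Rightarrow> 'v" where b: "bij_betw b {1..DIM('v)} Basis" "\<And>i x::'v. coord i x = x \<bullet> b i"
    by (rule coord_basis[where ?'v = 'v]) (rule that)
  define P where "P x = (\<Sum>i\<in>{p + 1..p + s}. coord i x *\<^sub>R b i)" for x :: 'v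
  have lP: "linear P"
    by (rule linearI) (simp_all add: P_def linear_add[OF coord_linear] linear_scale[OF coord_linear] algebra_simps sum.distrib scaleR_sum_right)
  have "x = 0" if x: "x \<in> W" "P x = 0" for x
  proof -
    have neg: "coord j x = 0" if j: "j \<in> {p + 1..p + s}" for j
    proof -
      have j': "j \<in> {1..DIM('v)}" using j dim by auto
      have "0 = P x \<bullet> b j" using x by simp
      also have "\<dots> = (\<Sum>i\<in>{p + 1..p + s}. if i = j then coord j x else 0)"
        unfolding P_def inner_sum_left
      proof (rule sum.cong)
        fix i assume i: "i \<in> {p + 1..p + s}"
        then have i': "i \<in> {1..DIM('v)}" using dim by auto
        have "b i \<in> Basis" "b j \<in> Basis" using bij_betwE[OF b(1)] i' j' by blast+
        moreover have "b i = b j \<longleftrightarrow> i = j" by (rule inj_on_eq_iff[OF bij_betw_imp_inj_on[OF b(1)] i' j'])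
        ultimately show "(coord i x *\<^sub>R b i) \<bullet> b j = (if i = j then coord j x else 0)" by (auto simp: inner_Basis)
      qed simp
      also have "\<dots> = coord j x" using j by simp
      finally show ?thesis by simp
    qed
    have "(\<Sum>i\<in>{1..p}. coord i x * coord i x) \<le> 0"
      using W(2)[OF x(1)] neg by (simp add: pseudo_inner_def)
    then have "(\<Sum>i\<in>{1..p}. coord i x * coord i x) = 0"
      using sum_nonneg[of "{1..p}" "\<lambda>i. coord i x * coord i x"] by simp
    then have pos: "coord i x = 0" if "i \<in> {1..p}" for i
      using that by (simp add: sum_nonneg_eq_0_iff)
    show "x = 0"
    proof (rule coord_eq_0)
      fix i assume "i \<in> {1..DIM('v)}"
      then have "i \<in> {1..p} \<or> i \<in> {p + 1..p + s}" using dim by auto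
      then show "coord i x = 0" using pos neg by blast
    qed
  qed
  then have "inj_on P (span W)"
    using linear_injective_on_subspace_0[OF lP W(1)] by (simp add: span_eq_iff[THEN iffD2, OF W(1)])
  then have "dim W = dim (P ` W)" by (rule dim_image_eq[OF lP, symmetric])
  also have "\<dots> \<le> dim (b ` {p + 1..p + s})"
  proof -
    have "P ` W \<subseteq> span (b ` {p + 1..p + s})"
      unfolding P_def by (intro image_subsetI span_sum span_scale span_base imageI)
    then show ?thesis by (rule dim_subset[THEN order_trans]) simp
  qed
  also have "\<dots> \<le> card (b ` {p + 1..p + s})" by (rule dim_le_card') simp
  also have "\<dots> \<le> s" using card_image_le[of "{p + 1..p + s}" b] by simp
  finally show ?thesis .
qed

section \<open>Submanifolds of Euclidean space\<close>

lemma submanifold_atlasD: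
  assumes "c \<in> submanifold_atlas S"
  shows "openin (top_of_set S) (fst c)" "open (snd c ` fst c)"
    "homeomorphic_map (top_of_set (fst c)) (top_of_set (snd c ` fst c)) (snd c)"
    "smooth_on (snd c ` fst c) (chart_inv c)" "y \<in> snd c ` fst c \<Longrightarrow> inj (dd (chart_inv c) y)"
  using assms by (auto simp: submanifold_atlas_def)

lemma submanifold_smooth_lift:
  fixes F :: "'y::euclidean_space \<Rightarrow> 'v::euclidean_space" and d :: "('v, 'h::euclidean_space) chart"
  assumes d: "d \<in> submanifold_atlas S" and T: "open T" and F: "smooth_on T F" "F ` T \<subseteq> fst d"
  shows "smooth_on T (\<lambda>y. snd d (F y))"
proof (rule smooth_on_lift[where \<phi> = "chart_inv d" and V = "snd d ` fst d"])
  note d' = submanifold_atlasD[OF d]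
  have inj: "inj_on (snd d) (fst d)" using homeomorphic_imp_injective_map[OF d'(3)] by simp
  have "continuous_on (fst d) (snd d)"
    using homeomorphic_imp_continuous_map[OF d'(3)] by (simp add: continuous_map_in_subtopology)
  then show "continuous_on T (\<lambda>y. snd d (F y))"
    by (rule continuous_on_compose2[OF _ smooth_on_imp_continuous[OF F(1)] F(2)])
  show "(\<lambda>y. snd d (F y)) ` T \<subseteq> snd d ` fst d" using F(2) by auto
  show "smooth_on T (\<lambda>y. chart_inv d (snd d (F y)))"
    by (rule smooth_on_cong[OF T F(1)]) (use F(2) inv_into_f_f[OF inj] in auto)
qed (use T submanifold_atlasD[OF d] in auto)

text \<open>Transition maps are lifts of parametrizations through parametrizations.\<close>

lemma charted_space_submanifold:
  "charted_space (top_of_set S) (submanifold_atlas S :: ('v::euclidean_space, 'h::euclidean_space) chart set)"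
proof
  fix c :: "('v, 'h) chart" assume c: "c \<in> submanifold_atlas S"
  note c' = submanifold_atlasD[OF c]
  have sub: "fst c \<subseteq> S" using openin_imp_subset[OF c'(1)] .
  show "openin (top_of_set S) (fst c)" "open (snd c ` fst c)" by (fact c')+
  show "homeomorphic_map (subtopology (top_of_set S) (fst c)) (top_of_set (snd c ` fst c)) (snd c)"
    using c'(3) sub by (simp add: subtopology_subtopology Int_absorb1)
  fix d :: "('v, 'h) chart" assume d: "d \<in> submanifold_atlas S"
  have inj: "inj_on (snd c) (fst c)" using homeomorphic_imp_injective_map[OF c'(3)] by simp
  obtain W where "open W" "fst d = S \<inter> W"
    using submanifold_atlasD(1)[OF d] by (auto simp: openin_open)
  then have "openin (top_of_set (fst c)) (fst c \<inter> fst d)"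
    using sub by (auto simp: openin_open)
  then have "openin (top_of_set (snd c ` fst c)) (snd c ` (fst c \<inter> fst d))"
    using homeomorphic_imp_open_map[OF c'(3)] unfolding open_map_def by blast
  then have op: "open (snd c ` (fst c \<inter> fst d))" using openin_open_eq[OF c'(2)] by blast
  show "smooth_on (snd c ` (fst c \<inter> fst d)) (\<lambda>y. snd d (chart_inv c y))"
  proof (rule submanifold_smooth_lift[OF d op])
    show "smooth_on (snd c ` (fst c \<inter> fst d)) (chart_inv c)"
      by (rule smooth_on_subset[OF c'(4)]) auto
    show "chart_inv c ` snd c ` (fst c \<inter> fst d) \<subseteq> fst d" using inv_into_f_f[OF inj] by auto
  qed
qed

text \<open>The assumption \<open>quadric_local\<close> says that \<open>S\<close> is open in the set defined by the quadratic equation; this allows for the choice of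
a sheet of the hyperboloid.  The metric is the induced one.\<close>

locale quadric = nondegenerate_form ip
  for ip :: "'v::euclidean_space \<Rightarrow> 'v \<Rightarrow> real" +
  fixes \<kappa> :: real and S :: "'v set" and \<B> :: "('v, 'h::euclidean_space) chart set"
    and D :: "('v, 'h) connection"
  assumes atlas: "\<B> = submanifold_atlas S"
    and quadric_eq: "\<kappa> \<noteq> 0 \<Longrightarrow> x \<in> S \<Longrightarrow> ip x x = 1 / \<kappa>"
    and quadric_local: "q \<in> S \<Longrightarrow> \<exists>T. open T \<and> q \<in> T \<and> (\<forall>x\<in>T. (\<kappa> \<noteq> 0 \<longrightarrow> ip x x = 1 / \<kappa>) \<longrightarrow> x \<in> S)"
    and dim_v: "DIM('v) = DIM('h) + (if \<kappa> = 0 then 0 else 1)"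
    and levi_civita_quadric: "levi_civita_connection (top_of_set S) \<B>
      (\<lambda>q v w. ip (dir_deriv \<B> q v (\<lambda>x. x)) (dir_deriv \<B> q w (\<lambda>x. x))) D"
begin

sublocale levi_civita_charts "top_of_set S" \<B> "\<lambda>q v w. ip (dir_deriv \<B> q v (\<lambda>x. x)) (dir_deriv \<B> q w (\<lambda>x. x))" D
  by (intro levi_civita_charts.intro levi_civita_charts_axioms.intro levi_civita_quadric)
     (simp only: atlas charted_space_submanifold)

text \<open>The differential of the inclusion into the vector space.\<close>

abbreviation iota :: "'v \<Rightarrow> ('v, 'h) tvec \<Rightarrow> 'v" where
  "iota q v \<equiv> dir_deriv \<B> q v (\<lambda>x. x)"

definition tangent_plane :: "'v \<Rightarrow> 'v set" where
  "tangent_plane q = {v. \<kappa> \<noteq> 0 \<longrightarrow> ip v q = 0}"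

lemma param_smooth: "d \<in> \<B> \<Longrightarrow> smooth_on (snd d ` fst d) (chart_inv d)"
  unfolding atlas by (rule submanifold_atlasD)

lemma param_inj: "d \<in> \<B> \<Longrightarrow> y \<in> snd d ` fst d \<Longrightarrow> inj (dd (chart_inv d) y)"
  unfolding atlas by (rule submanifold_atlasD)

lemma dom_subset: "d \<in> \<B> \<Longrightarrow> fst d \<subseteq> S"
  using openin_imp_subset[OF open_dom] .

lemma param_linear: "d \<in> \<B> \<Longrightarrow> y \<in> snd d ` fst d \<Longrightarrow> linear (dd (chart_inv d) y)"
  by (rule linear_frechet_derivative[OF smooth_on_imp_differentiable[OF param_smooth]])

lemma iota_eq:
  assumes d: "d \<in> charts_at \<B> q" and v: "v \<in> tangent_space \<B> q"
  shows "iota q v = dd (chart_inv d) (snd d q) (v d)"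
  by (rule dir_deriv_eq[OF d v]) (use charts_atD[OF d] in \<open>auto intro!: smooth_on_has_derivative[OF param_smooth]\<close>)

lemma iota_lift: "d \<in> charts_at \<B> q \<Longrightarrow> iota q (lift d q w) = dd (chart_inv d) (snd d q) w"
  by (simp add: iota_eq[OF _ lift_in] lift_self)

lemma tangent_plane_subspace: "subspace (tangent_plane q)"
  by (auto simp: subspace_def tangent_plane_def ip_simps)

text \<open>The inclusion is the derivative of the quadratic equation; the dimensions agree because \<open>q\<close> itself is not orthogonal to \<open>q\<close>
if \<open>\<kappa> \<noteq> 0\<close>.\<close>

lemma range_param:
  assumes d: "d \<in> \<B>" and q: "q \<in> fst d"
  shows "range (dd (chart_inv d) (snd d q)) = tangent_plane q"
proof (rule subspace_dim_equal)
  let ?\<phi> = "chart_inv d" and ?y = "snd d q"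
  have y: "?y \<in> snd d ` fst d" using q by simp
  have lin: "linear (dd ?\<phi> ?y)" by (rule param_linear[OF d y])
  show "subspace (range (dd ?\<phi> ?y))" by (rule linear_subspace_image[OF lin]) simp
  show "subspace (tangent_plane q)" by (rule tangent_plane_subspace)
  show "range (dd ?\<phi> ?y) \<subseteq> tangent_plane q"
  proof
    fix w assume "w \<in> range (dd ?\<phi> ?y)"
    then obtain u where w: "w = dd ?\<phi> ?y u" by blast
    show "w \<in> tangent_plane q"
      unfolding tangent_plane_def
    proof (simp, rule impI)
      assume \<kappa>: "\<kappa> \<noteq> 0"
      note der = smooth_on_has_derivative[OF param_smooth[OF d] y]
      have "((\<lambda>y. 1 / \<kappa>) has_derivative (\<lambda>v. ip (?\<phi> ?y) (dd ?\<phi> ?y v) + ip (dd ?\<phi> ?y v) (?\<phi> ?y))) (at ?y)"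
        by (rule has_derivative_transform_within_open[OF ip_has_derivative[OF der der] open_img[OF d] y])
           (use quadric_eq[OF \<kappa>] chart_inv_in[OF d subset_refl] dom_subset[OF d] in blast)
      then have "(\<lambda>v. ip (?\<phi> ?y) (dd ?\<phi> ?y v) + ip (dd ?\<phi> ?y v) (?\<phi> ?y)) = (\<lambda>v. 0)"
        using has_derivative_const has_derivative_unique by blast
      then have "ip (?\<phi> ?y) (dd ?\<phi> ?y u) + ip (dd ?\<phi> ?y u) (?\<phi> ?y) = 0" by (rule fun_cong)
      then show "ip w q = 0" using d q by (simp add: w ip_sym[of q])
    qed
  qed
  have "dim (range (dd ?\<phi> ?y)) = DIM('h)"
    using dim_image_eq[OF lin, of UNIV] param_inj[OF d y] by simp
  moreover have "dim (tangent_plane q) \<le> DIM('h)"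
  proof (cases "\<kappa> = 0")
    case True
    then show ?thesis using dim_subset_UNIV[of "tangent_plane q"] dim_v by simp
  next
    case False
    have "q \<notin> tangent_plane q"
      using quadric_eq[OF False] dom_subset[OF d] q False by (auto simp: tangent_plane_def)
    then have "tangent_plane q \<noteq> UNIV" by blast
    then have "dim (tangent_plane q) \<noteq> DIM('v)"
      using dim_eq_full[of "tangent_plane q"] span_eq_iff[THEN iffD2, OF tangent_plane_subspace[of q]] by simp
    then show ?thesis using dim_subset_UNIV[of "tangent_plane q"] dim_v False by simp
  qed
  ultimately show "dim (tangent_plane q) \<le> dim (range (dd ?\<phi> ?y))" by simp
qed

text \<open>Every vector differs from a tangent vector by a multiple of \<open>q\<close>, to which \<open>a\<close> is orthogonal.\<close>

lemma tangent_plane_nondegenerate: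
  assumes q: "q \<in> S" and a: "a \<in> tangent_plane q" and 0: "\<And>b. b \<in> tangent_plane q \<Longrightarrow> ip a b = 0"
  shows "a = 0"
proof (rule ip_nondeg)
  fix b
  show "ip a b = 0"
  proof (cases "\<kappa> = 0")
    case True
    then have "b \<in> tangent_plane q" unfolding tangent_plane_def by blast
    then show ?thesis by (rule 0)
  next
    case False
    then have "b - (\<kappa> * ip b q) *\<^sub>R q \<in> tangent_plane q"
      using quadric_eq[OF False q] by (simp add: tangent_plane_def ip_simps)
    from 0[OF this] show ?thesis using a False by (simp add: tangent_plane_def ip_simps)
  qed
qed

lemma iota_in: "d \<in> charts_at \<B> q \<Longrightarrow> v \<in> tangent_space \<B> q \<Longrightarrow> iota q v \<in> tangent_plane q"
  using iota_eq[of d q v] range_param[of d q] charts_atD[of d q] by blast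

lemma iota_inj:
  assumes d: "d \<in> charts_at \<B> q" and uv: "u \<in> tangent_space \<B> q" "v \<in> tangent_space \<B> q" and eq: "iota q u = iota q v"
  shows "u = v"
proof (rule tvec_eqI[OF d uv])
  have "inj (dd (chart_inv d) (snd d q))"
    using param_inj[OF charts_atD(1)[OF d]] charts_atD(2)[OF d] by blast
  then show "u d = v d" using eq by (simp add: iota_eq[OF d] uv inj_eq)
qed

lemma iota_linear_simps:
  assumes d: "d \<in> charts_at \<B> q" and uv: "u \<in> tangent_space \<B> q" "v \<in> tangent_space \<B> q"
  shows "iota q (u + v) = iota q u + iota q v" "iota q (u - v) = iota q u - iota q v" "iota q (- u) = - iota q u"
    "iota q (tscale a u) = a *\<^sub>R iota q u"
proof -
  note cd = charts_atD[OF d]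
  have l: "linear (dd (chart_inv d) (snd d q))" by (rule param_linear[OF cd(1)]) (use cd in simp)
  have s: "tscale a u \<in> tangent_space \<B> q"
    using lift_in[OF d, of "a *\<^sub>R u d"] by (simp add: lift_scale tvec_eq_lift[OF d uv(1)])
  show "iota q (u + v) = iota q u + iota q v" "iota q (u - v) = iota q u - iota q v" "iota q (- u) = - iota q u"
    "iota q (tscale a u) = a *\<^sub>R iota q u"
    by (simp_all add: iota_eq[OF d] uv s tangent_space_add[OF d] tangent_space_diff[OF d] tangent_space_uminus[OF d]
       linear_add[OF l] linear_diff[OF l] linear_neg[OF l] linear_scale[OF l])
       (simp add: tscale_def linear_scale[OF l])
qed

lemma ambient_field_smooth:
  assumes V: "openin (top_of_set S) V" and E: "smooth_field \<B> V E" and d: "d \<in> \<B>"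
  shows "smooth_on (snd d ` (V \<inter> fst d)) (\<lambda>y. iota (chart_inv d y) (E (chart_inv d y)))"
proof -
  let ?T = "snd d ` (V \<inter> fst d)" and ?\<phi> = "chart_inv d"
  have op: "open ?T" by (rule chart_image_open[OF d V])
  have sub: "?T \<subseteq> snd d ` fst d" by blast
  have "smooth_on ?T (\<lambda>y. dd ?\<phi> y (E (?\<phi> y) d))"
    by (rule smooth_on_apply_linear[where P = "dd ?\<phi>" and k = "\<lambda>y. E (?\<phi> y) d", OF op])
       (use param_linear[OF d] sub smooth_on_subset[OF smooth_on_dd[OF param_smooth[OF d]] sub] smooth_fieldD(1)[OF E d] in auto)
  then show ?thesis
  proof (rule smooth_on_cong[OF op])
    fix y assume y: "y \<in> ?T"
    then have "d \<in> charts_at \<B> (?\<phi> y)" "?\<phi> y \<in> V" "snd d (?\<phi> y) = y"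
      using d by (auto simp: charts_at_def)
    then show "dd ?\<phi> y (E (?\<phi> y) d) = iota (?\<phi> y) (E (?\<phi> y))"
      using iota_eq smooth_fieldD(2)[OF E] by simp
  qed
qed

text \<open>The Levi-Civita connection of the quadric is the tangential part of the flat derivative: both have the same derivative term for the
components of \<open>E\<close>, and the Christoffel terms agree tangentially by the uniqueness lemma for immersions.\<close>

lemma gauss_formula:
  assumes V: "openin (top_of_set S) V" and E: "smooth_field \<B> V E" and x: "x \<in> V" and d: "d \<in> charts_at \<B> x"
    and v: "v \<in> tangent_space \<B> x" and b: "b \<in> tangent_plane x"
  shows "ip (iota x (D x v E)) b = ip (dd (\<lambda>y. iota (chart_inv d y) (E (chart_inv d y))) (snd d x) (v d)) b"
proof -
  note cd = charts_atD[OF d]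
  let ?T = "snd d ` (V \<inter> fst d)" and ?\<phi> = "chart_inv d" and ?y = "snd d x"
  let ?k = "\<lambda>y. E (?\<phi> y) d"
  have op: "open ?T" by (rule chart_image_open[OF cd(1) V])
  have sub: "?T \<subseteq> snd d ` fst d" by blast
  have y: "?y \<in> ?T" "?y \<in> snd d ` fst d" using x cd by auto
  have \<phi>x: "?\<phi> ?y = x" using cd by simp
  have lin: "linear (dd ?\<phi> ?y)" by (rule param_linear[OF cd(1) y(2)])
  have k: "(?k has_derivative dd ?k ?y) (at ?y)"
    by (rule smooth_on_has_derivative[OF smooth_fieldD(1)[OF E cd(1)] y(1)])
  have "((\<lambda>y. dd ?\<phi> y (?k y)) has_derivative
      (\<lambda>v. dd (\<lambda>y. dd ?\<phi> y (?k ?y)) ?y v + dd ?\<phi> ?y (dd ?k ?y v))) (at ?y)"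
    by (rule has_derivative_apply_linear[where P = "dd ?\<phi>" and k = ?k, OF op y(1) _ _ k])
       (use param_linear[OF cd(1)] sub smooth_on_imp_differentiable[OF smooth_on_dd[OF param_smooth[OF cd(1)]] y(2)] in auto)
  then have "((\<lambda>y. iota (?\<phi> y) (E (?\<phi> y))) has_derivative
      (\<lambda>v. dd (\<lambda>y. dd ?\<phi> y (?k ?y)) ?y v + dd ?\<phi> ?y (dd ?k ?y v))) (at ?y)"
  proof (rule has_derivative_transform_within_open[OF _ op y(1)])
    fix y assume y: "y \<in> ?T"
    then have "d \<in> charts_at \<B> (?\<phi> y)" "?\<phi> y \<in> V" "snd d (?\<phi> y) = y"
      using cd by (auto simp: charts_at_def)
    then show "dd ?\<phi> y (E (?\<phi> y) d) = iota (?\<phi> y) (E (?\<phi> y))"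
      using iota_eq smooth_fieldD(2)[OF E] by simp
  qed
  then have 1: "dd (\<lambda>y. iota (?\<phi> y) (E (?\<phi> y))) ?y (v d) = dd (\<lambda>y. dd ?\<phi> y (?k ?y)) ?y (v d) + dd ?\<phi> ?y (dd ?k ?y (v d))"
    by (simp add: dd_eqI)
  have 2: "iota x (D x v E) = dd ?\<phi> ?y (dd ?k ?y (v d)) + dd ?\<phi> ?y (christoffel d ?y (v d) (?k ?y))"
    using iota_eq[OF d D_in[OF V E x v]] D_coord[OF V E cd(1) x cd(2) v] by (simp add: linear_add[OF lin] \<phi>x)
  obtain w where w: "b = dd ?\<phi> ?y w" using b range_param[OF cd] by blast
  have "ip (dd (\<lambda>y. dd ?\<phi> y (?k ?y)) ?y (v d)) (dd ?\<phi> ?y w) = ip (dd ?\<phi> ?y (christoffel d ?y (v d) (?k ?y))) (dd ?\<phi> ?y w)"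
  proof (rule immersion_christoffel_unique[OF open_img[OF cd(1)] y(2) param_smooth[OF cd(1)]])
    show "christoffel d ?y u v = christoffel d ?y v u" for u v by (rule lie_bracket_coord_fields(2)[OF cd])
    fix u v w
    let ?G = "\<lambda>y. ip (iota (?\<phi> y) (lift d (?\<phi> y) v)) (iota (?\<phi> y) (lift d (?\<phi> y) w))"
    have G: "?G y = ip (dd ?\<phi> y v) (dd ?\<phi> y w)" if "y \<in> snd d ` fst d" for y
    proof -
      have "d \<in> charts_at \<B> (?\<phi> y)" "snd d (?\<phi> y) = y" using that cd by (auto simp: charts_at_def)
      then show ?thesis by (simp add: iota_lift)
    qed
    have sm: "smooth_on (snd d ` fst d) (\<lambda>y. ip (dd ?\<phi> y v) (dd ?\<phi> y w))"
      by (intro smooth_on_ip open_img cd smooth_on_dd param_smooth)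
    have "(?G has_derivative dd (\<lambda>y. ip (dd ?\<phi> y v) (dd ?\<phi> y w)) ?y) (at ?y)"
      by (rule has_derivative_transform_within_open[OF smooth_on_has_derivative[OF sm y(2)] open_img[OF cd(1)] y(2)]) (simp add: G)
    moreover from this have "?G differentiable (at ?y)" by (auto simp: differentiable_def)
    ultimately show "dd (\<lambda>y. ip (dd ?\<phi> y v) (dd ?\<phi> y w)) ?y u =
      ip (dd ?\<phi> ?y (christoffel d ?y u v)) (dd ?\<phi> ?y w) + ip (dd ?\<phi> ?y v) (dd ?\<phi> ?y (christoffel d ?y u w))"
      using metric_coord[OF cd, of v w u] by (simp add: dd_eqI iota_lift[OF d])
  qed
  then show ?thesis unfolding 1 2 w by (simp add: ip_simps)
qed

end

section \<open>Maps into a quadric\<close>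

locale quadric_map = src: charted_space M \<A> + tgt: quadric ip \<kappa> S \<B> D
  for M :: "'a topology" and \<A> :: "('a, 'e::euclidean_space) chart set"
    and ip :: "'v::euclidean_space \<Rightarrow> 'v \<Rightarrow> real" and \<kappa> S
    and \<B> :: "('v, 'h::euclidean_space) chart set" and D
begin

lemma map_chart_open:
  assumes d: "d \<in> \<B>" and T: "open T" and F: "smooth_on T F" "F ` T \<subseteq> S"
  shows "open {y \<in> T. F y \<in> fst d}"
proof -
  obtain W where W: "open W" "fst d = S \<inter> W" using tgt.open_dom[OF d] by (auto simp: openin_open)
  have "{y \<in> T. F y \<in> fst d} = T \<inter> F -` W" using W F(2) by auto
  then show ?thesis using continuous_open_preimage[OF smooth_on_imp_continuous[OF F(1)] T W(1)] by simp
qed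

lemma map_in_chart:
  assumes c: "c \<in> charts_at \<A> x" and d: "d \<in> charts_at \<B> (f x)"
    and T: "open T" "snd c x \<in> T" and F: "smooth_on T (\<lambda>y. f (chart_inv c y))" "(\<lambda>y. f (chart_inv c y)) ` T \<subseteq> S"
  shows "((\<lambda>y. snd d (f (chart_inv c y))) has_derivative dd (\<lambda>y. snd d (f (chart_inv c y))) (snd c x)) (at (snd c x))"
    and "dd (\<lambda>y. f (chart_inv c y)) (snd c x) w = dd (chart_inv d) (snd d (f x)) (dd (\<lambda>y. snd d (f (chart_inv c y))) (snd c x) w)"
proof -
  note cc = src.charts_atD[OF c] and cd = tgt.charts_atD[OF d]
  let ?F = "\<lambda>y. f (chart_inv c y)"
  let ?T = "{y \<in> T. ?F y \<in> fst d}"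
  have op: "open ?T" by (rule map_chart_open[OF cd(1) T(1) F])
  have y: "snd c x \<in> ?T" using T cc cd by simp
  have "smooth_on ?T (\<lambda>y. snd d (?F y))"
    by (rule submanifold_smooth_lift[OF cd(1)[unfolded tgt.atlas] op smooth_on_subset[OF F(1)]]) auto
  then show t: "((\<lambda>y. snd d (?F y)) has_derivative dd (\<lambda>y. snd d (?F y)) (snd c x)) (at (snd c x))"
    by (rule smooth_on_has_derivative[OF _ y])
  have "((\<lambda>y. chart_inv d (snd d (?F y))) has_derivative (\<lambda>w. dd (chart_inv d) (snd d (f x)) (dd (\<lambda>y. snd d (?F y)) (snd c x) w))) (at (snd c x))"
    by (rule has_derivative_compose[OF t]) (use cc cd in \<open>auto intro!: smooth_on_has_derivative[OF tgt.param_smooth]\<close>)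
  then have "(?F has_derivative (\<lambda>w. dd (chart_inv d) (snd d (f x)) (dd (\<lambda>y. snd d (?F y)) (snd c x) w))) (at (snd c x))"
    by (rule has_derivative_transform_within_open[OF _ op y]) (use cd in auto)
  then show "dd ?F (snd c x) w = dd (chart_inv d) (snd d (f x)) (dd (\<lambda>y. snd d (?F y)) (snd c x) w)"
    by (simp add: dd_eqI)
qed

text \<open>The differential is defined by its components in all charts; they are related by the chain rule, so those in one chart suffice.\<close>

lemma differential_eq_lift:
  assumes c: "c \<in> charts_at \<A> x" and d: "d \<in> charts_at \<B> (f x)"
    and T: "open T" "snd c x \<in> T" and F: "smooth_on T (\<lambda>y. f (chart_inv c y))" "(\<lambda>y. f (chart_inv c y)) ` T \<subseteq> S"
    and v: "v \<in> tangent_space \<A> x"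
  shows "differential \<A> \<B> f x v = tgt.lift d (f x) (dd (\<lambda>y. snd d (f (chart_inv c y))) (snd c x) (v c))"
proof (rule ext)
  fix d'
  note cc = src.charts_atD[OF c] and cd = tgt.charts_atD[OF d]
  let ?F = "\<lambda>y. f (chart_inv c y)"
  note m = map_in_chart(1)[OF c _ T F]
  show "differential \<A> \<B> f x v d' = tgt.lift d (f x) (dd (\<lambda>y. snd d (?F y)) (snd c x) (v c)) d'"
  proof (cases "d' \<in> charts_at \<B> (f x)")
    case True
    let ?T = "{y \<in> T. ?F y \<in> fst d}"
    have op: "open ?T" by (rule map_chart_open[OF cd(1) T(1) F])
    have y: "snd c x \<in> ?T" using T cc cd by simp
    have "((\<lambda>y. snd d' (chart_inv d (snd d (?F y)))) has_derivative
       (\<lambda>w. dd (\<lambda>z. snd d' (chart_inv d z)) (snd d (f x)) (dd (\<lambda>y. snd d (?F y)) (snd c x) w))) (at (snd c x))"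
      by (rule has_derivative_compose[OF m[OF d]]) (use tgt.transition_has_derivative[OF d True] cc in simp)
    then have "((\<lambda>y. snd d' (?F y)) has_derivative
       (\<lambda>w. dd (\<lambda>z. snd d' (chart_inv d z)) (snd d (f x)) (dd (\<lambda>y. snd d (?F y)) (snd c x) w))) (at (snd c x))"
      by (rule has_derivative_transform_within_open[OF _ op y]) (use cd in auto)
    from src.dir_deriv_eq[OF c v this] show ?thesis
      using True d by (simp add: differential_def tgt.lift_def)
  next
    case False
    then show ?thesis by (simp add: differential_def tgt.lift_def)
  qed
qed

lemma differential_in_iota:
  assumes c: "c \<in> charts_at \<A> x" and d: "d \<in> charts_at \<B> (f x)"
    and T: "open T" "snd c x \<in> T" and F: "smooth_on T (\<lambda>y. f (chart_inv c y))" "(\<lambda>y. f (chart_inv c y)) ` T \<subseteq> S"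
    and v: "v \<in> tangent_space \<A> x"
  shows "differential \<A> \<B> f x v \<in> tangent_space \<B> (f x)"
    and "tgt.iota (f x) (differential \<A> \<B> f x v) = dd (\<lambda>y. f (chart_inv c y)) (snd c x) (v c)"
  unfolding differential_eq_lift[OF c d T F v] map_in_chart(2)[OF c d T F]
  by (simp_all add: tgt.lift_in[OF d] tgt.iota_lift[OF d])

text \<open>If \<open>n\<close> is the restriction to the map \<open>f\<close> of an ambient field \<open>E\<close>, the covariant derivative of \<open>E\<close> in the direction of \<open>df(v)\<close> is
the tangential part of the derivative of \<open>n\<close> as a function with values in the vector space.\<close>

lemma covariant_derivative_along:
  assumes c: "c \<in> charts_at \<A> x" and d: "d \<in> charts_at \<B> (f x)"
    and T: "open T" "snd c x \<in> T" and F: "smooth_on T (\<lambda>y. f (chart_inv c y))" "(\<lambda>y. f (chart_inv c y)) ` T \<subseteq> S"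
    and V: "openin (top_of_set S) V" "smooth_field \<B> V E" "f x \<in> V"
    and n: "\<And>y. y \<in> T \<Longrightarrow> f (chart_inv c y) \<in> V \<Longrightarrow> n y = tgt.iota (f (chart_inv c y)) (E (f (chart_inv c y)))"
  shows "n differentiable (at (snd c x))"
    and "v \<in> tangent_space \<A> x \<Longrightarrow> b \<in> tgt.tangent_plane (f x) \<Longrightarrow>
      ip (tgt.iota (f x) (D (f x) (differential \<A> \<B> f x v) E)) b = ip (dd n (snd c x) (v c)) b"
proof -
  note cc = src.charts_atD[OF c] and cd = tgt.charts_atD[OF d]
  let ?F = "\<lambda>y. f (chart_inv c y)"
  let ?T = "{y \<in> T. ?F y \<in> fst d} \<inter> {y \<in> T. ?F y \<in> V}"
  let ?e = "\<lambda>z. tgt.iota (chart_inv d z) (E (chart_inv d z))"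
  have "open {y \<in> T. ?F y \<in> V}"
  proof -
    obtain W where W: "open W" "V = S \<inter> W" using V(1) by (auto simp: openin_open)
    have "{y \<in> T. ?F y \<in> V} = T \<inter> ?F -` W" using W F(2) by auto
    then show ?thesis using continuous_open_preimage[OF smooth_on_imp_continuous[OF F(1)] T(1) W(1)] by simp
  qed
  then have op: "open ?T" using map_chart_open[OF cd(1) T(1) F] by (rule open_Int[rotated])
  have y: "snd c x \<in> ?T" using T cc cd V(3) by simp
  have e: "(?e has_derivative dd ?e (snd d (f x))) (at (snd d (f x)))"
    by (rule smooth_on_has_derivative[OF tgt.ambient_field_smooth[OF V(1,2) cd(1)]]) (use cd V(3) in auto)
  have "((\<lambda>y. ?e (snd d (?F y))) has_derivative (\<lambda>w. dd ?e (snd d (f x)) (dd (\<lambda>y. snd d (?F y)) (snd c x) w))) (at (snd c x))"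
    by (rule has_derivative_compose[OF map_in_chart(1)[OF c d T F]]) (use e cc in simp)
  then have N: "(n has_derivative (\<lambda>w. dd ?e (snd d (f x)) (dd (\<lambda>y. snd d (?F y)) (snd c x) w))) (at (snd c x))"
    by (rule has_derivative_transform_within_open[OF _ op y]) (use cd n in auto)
  then show "n differentiable (at (snd c x))" by (auto simp: differentiable_def)
  assume v: "v \<in> tangent_space \<A> x" and b: "b \<in> tgt.tangent_plane (f x)"
  have "differential \<A> \<B> f x v d = dd (\<lambda>y. snd d (?F y)) (snd c x) (v c)"
    by (simp add: differential_eq_lift[OF c d T F v] tgt.lift_self[OF d])
  then show "ip (tgt.iota (f x) (D (f x) (differential \<A> \<B> f x v) E)) b = ip (dd n (snd c x) (v c)) b"
    using tgt.gauss_formula[OF V(1,2,3) d differential_in_iota(1)[OF c d T F v] b]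
    by (simp add: dd_eqI[OF N])
qed

end

section \<open>Local retractions onto an immersion\<close>

text \<open>For a left inverse \<open>L\<close> of the derivative at \<open>y0\<close>, the map \<open>L \<circ> F\<close> is a local diffeomorphism, and its local inverse composed with
\<open>L\<close> is a smooth retraction defined in the ambient space.\<close>

lemma immersion_local_retraction:
  fixes F :: "'e::euclidean_space \<Rightarrow> 'v::euclidean_space"
  assumes T: "open T" "y0 \<in> T" and F: "smooth_on T F" and inj: "inj (dd F y0)"
  obtains U V :: "'e set" and L :: "'v \<Rightarrow> 'e" and g :: "'e \<Rightarrow> 'e"
  where "open U" "U \<subseteq> T" "y0 \<in> U" "bounded_linear L" "open V" "smooth_on V g"
    "\<And>y. y \<in> U \<Longrightarrow> L (F y) \<in> V \<and> g (L (F y)) = y" "g ` V \<subseteq> U"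
proof -
  note dF = smooth_on_has_derivative[OF F]
  obtain L C where L: "bounded_linear L" "\<And>v. L (dd F y0 v) = v" and C: "C > (0::real)" "\<And>v. norm (L v) \<le> C * norm v"
    using linear_injective_bounded_left_inverse[OF has_derivative_linear[OF dF[OF T(2)]] inj] by metis
  let ?\<psi> = "\<lambda>y. L (F y)"
  have \<psi>: "smooth_on T ?\<psi>" by (rule smooth_on_linear[OF L(1) T(1) F])
  define f' where "f' y = Blinfun (dd ?\<psi> y)" for y
  have f': "blinfun_apply (f' y) = dd ?\<psi> y" if "y \<in> T" for y
    unfolding f'_def
    by (rule bounded_linear_Blinfun_apply[OF has_derivative_bounded_linear[OF smooth_on_has_derivative[OF \<psi> that]]])
  have d\<psi>0: "dd ?\<psi> y0 = (\<lambda>v. v)"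
    using bounded_linear.has_derivative[OF L(1) dF[OF T(2)]] L(2) by (simp add: dd_eqI)
  have der: "(?\<psi> has_derivative blinfun_apply (f' y)) (at y)" if "y \<in> T" for y
    using smooth_on_has_derivative[OF \<psi> that] f'[OF that] by simp
  have cont: "continuous_on T f'"
  proof (rule continuous_on_blinfun_componentwise)
    fix i :: 'e
    have "continuous_on T (\<lambda>y. dd ?\<psi> y i)" by (rule smooth_on_imp_continuous[OF smooth_on_dd[OF \<psi>]])
    then show "continuous_on T (\<lambda>y. f' y i)" by (simp add: f' cong: continuous_on_cong)
  qed
  have inv: "id_blinfun o\<^sub>L f' y0 = id_blinfun"
    by (rule blinfun_eqI) (simp add: f'[OF T(2)] d\<psi>0)
  show ?thesis
  proof (rule inverse_function_theorem[OF T(1) der cont T(2) inv])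
    fix U V g g'
    assume a: "open U" "U \<subseteq> T" "y0 \<in> U" "open V" "?\<psi> y0 \<in> V" and h: "homeomorphism U V ?\<psi> g"
      and "\<And>y. y \<in> V \<Longrightarrow> (g has_derivative g' y) (at y)"
      and "\<And>y. y \<in> V \<Longrightarrow> g' y = inv (blinfun_apply (f' (g y)))"
      and bij: "\<And>y. y \<in> V \<Longrightarrow> bij (blinfun_apply (f' (g y)))"
    have gV: "g ` V = U" and \<psi>g: "\<And>y. y \<in> V \<Longrightarrow> ?\<psi> (g y) = y" and \<psi>U: "?\<psi> ` U = V"
      and g\<psi>: "\<And>y. y \<in> U \<Longrightarrow> g (?\<psi> y) = y"
      using h by (auto simp: homeomorphism_def)
    have "smooth_on V g"
    proof (rule smooth_on_lift[where \<phi> = ?\<psi> and V = U, OF a(4,1) smooth_on_subset[OF \<psi> a(2)]])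
      show "inj (dd ?\<psi> z)" if z: "z \<in> U" for z
      proof -
        have "bij (blinfun_apply (f' (g (?\<psi> z))))" using z \<psi>U by (intro bij) auto
        then show ?thesis using f' a(2) z g\<psi>[OF z] by (auto simp: bij_is_inj)
      qed
      show "continuous_on V g" using h by (simp add: homeomorphism_def)
      show "smooth_on V (\<lambda>y. ?\<psi> (g y))"
        by (rule smooth_on_cong[OF a(4) smooth_on_id[OF a(4)]]) (simp add: \<psi>g)
    qed (use gV in auto)
    then show ?thesis
      using a \<psi>U g\<psi> gV by (intro that[of U L V g] L(1)) auto
  qed
qed

section \<open>The source manifold in a chart\<close>

locale source_manifold = levi_civita_charts M \<A> g nabla
  for M :: "'a topology" and \<A> :: "('a, 'e::euclidean_space) chart set"
    and g :: "('a, 'e) metric" and nabla :: "('a, 'e) connection" +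
  fixes A :: "'a \<Rightarrow> ('a, 'e) tvec \<Rightarrow> ('a, 'e) tvec" and \<kappa> :: real and r s :: nat
  assumes semi_riemannian: "semi_riemannian_metric M \<A> r s g"
    and endo: "symmetric_endomorphism_field M \<A> g A"
    and codazzi_eq: "codazzi_mainardi_equation M \<A> nabla A"
    and gauss_eq: "gauss_equation M \<A> g nabla \<kappa> A"
begin

lemma dim_source: "DIM('e) = r + s"
  using semi_riemannian by (simp add: semi_riemannian_metric_def)

lemma g_sym: "p \<in> topspace M \<Longrightarrow> u \<in> tangent_space \<A> p \<Longrightarrow> v \<in> tangent_space \<A> p \<Longrightarrow> g p u v = g p v u"
  by (rule semi_riemannian[unfolded semi_riemannian_metric_def, THEN conjunct2, THEN conjunct1, THEN bspec, THEN conjunct1, rule_format])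

lemma g_add: "p \<in> topspace M \<Longrightarrow> u \<in> tangent_space \<A> p \<Longrightarrow> v \<in> tangent_space \<A> p \<Longrightarrow> w \<in> tangent_space \<A> p
   \<Longrightarrow> g p (u + v) w = g p u w + g p v w"
  by (rule semi_riemannian[unfolded semi_riemannian_metric_def, THEN conjunct2, THEN conjunct1, THEN bspec, THEN conjunct2, THEN conjunct1, rule_format])

lemma g_scale: "p \<in> topspace M \<Longrightarrow> u \<in> tangent_space \<A> p \<Longrightarrow> v \<in> tangent_space \<A> p \<Longrightarrow> g p (tscale a u) v = a * g p u v"
  by (rule semi_riemannian[unfolded semi_riemannian_metric_def, THEN conjunct2, THEN conjunct1, THEN bspec, THEN conjunct2, THEN conjunct2, THEN conjunct1, rule_format])

lemma g_frame: "p \<in> topspace M \<Longrightarrow> \<exists>e. (\<forall>i\<in>{1..r + s}. e i \<in> tangent_space \<A> p) \<and>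
    (\<forall>i\<in>{1..r + s}. \<forall>j\<in>{1..r + s}. g p (e i) (e j) = (if i \<noteq> j then 0 else if i \<le> r then 1 else - 1))"
  by (rule semi_riemannian[unfolded semi_riemannian_metric_def, THEN conjunct2, THEN conjunct1, THEN bspec, THEN conjunct2, THEN conjunct2, THEN conjunct2])

lemma g_smooth: "openin M U \<Longrightarrow> smooth_field \<A> U X \<Longrightarrow> smooth_field \<A> U Y \<Longrightarrow> smooth_fun \<A> U (\<lambda>x. g x (X x) (Y x))"
  by (rule semi_riemannian[unfolded semi_riemannian_metric_def, THEN conjunct2, THEN conjunct2, rule_format])

lemma A_tangent_linear: "p \<in> topspace M \<Longrightarrow> tangent_linear \<A> p \<A> p (A p)"
  by (rule endo[unfolded symmetric_endomorphism_field_def, THEN conjunct1, THEN bspec, THEN conjunct1])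

lemma A_selfadjoint: "p \<in> topspace M \<Longrightarrow> u \<in> tangent_space \<A> p \<Longrightarrow> v \<in> tangent_space \<A> p \<Longrightarrow> g p (A p u) v = g p u (A p v)"
  by (rule endo[unfolded symmetric_endomorphism_field_def, THEN conjunct1, THEN bspec, THEN conjunct2, rule_format])

lemma A_smooth_field: "openin M U \<Longrightarrow> smooth_field \<A> U X \<Longrightarrow> smooth_field \<A> U (\<lambda>x. A x (X x))"
  by (rule endo[unfolded symmetric_endomorphism_field_def, THEN conjunct2, rule_format])

lemma A_in: "p \<in> topspace M \<Longrightarrow> u \<in> tangent_space \<A> p \<Longrightarrow> A p u \<in> tangent_space \<A> p"
  by (rule A_tangent_linear[unfolded tangent_linear_def, THEN conjunct1, rule_format])

lemma dom_topspace: "c \<in> \<A> \<Longrightarrow> x \<in> fst c \<Longrightarrow> x \<in> topspace M"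
  using openin_subset[OF open_dom] by blast

definition coord_metric :: "('a, 'e) chart \<Rightarrow> 'e \<Rightarrow> 'e \<Rightarrow> 'e \<Rightarrow> real" where
  "coord_metric c y v w = g (chart_inv c y) (lift c (chart_inv c y) v) (lift c (chart_inv c y) w)"

definition coord_endo :: "('a, 'e) chart \<Rightarrow> 'e \<Rightarrow> 'e \<Rightarrow> 'e" where
  "coord_endo c y w = A (chart_inv c y) (lift c (chart_inv c y) w) c"

lemma A_lift:
  assumes c: "c \<in> charts_at \<A> x"
  shows "A x (lift c x w) = lift c x (coord_endo c (snd c x) w)"
  using tvec_eq_lift[OF c A_in[OF dom_topspace[OF charts_atD[OF c]] lift_in[OF c]], of w] charts_atD[OF c]
  by (simp add: coord_endo_def)

lemma coord_metric_bilinear: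
  assumes c: "c \<in> \<A>" and y: "y \<in> snd c ` fst c"
  shows "bilinear (coord_metric c y)" and "coord_metric c y v w = coord_metric c y w v"
proof -
  let ?x = "chart_inv c y"
  have x: "?x \<in> fst c" using chart_inv_in[OF c subset_refl y] by simp
  have cx: "c \<in> charts_at \<A> ?x" using x c by (simp add: charts_at_def)
  note tx = dom_topspace[OF c x] and l = lift_in[OF cx]
  show sym: "coord_metric c y v w = coord_metric c y w v" for v w
    unfolding coord_metric_def by (rule g_sym[OF tx l l])
  have lin: "linear (\<lambda>v. coord_metric c y v w)" for w
    by (rule linearI) (simp_all add: coord_metric_def lift_add lift_scale g_add[OF tx l l l] g_scale[OF tx l l])
  then have "linear (coord_metric c y w)" for w
    using sym[of w] by (simp add: linear_iff)
  with lin show "bilinear (coord_metric c y)" by (simp add: bilinear_def)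
qed

lemma coord_frame:
  assumes c: "c \<in> \<A>" and y: "y \<in> snd c ` fst c"
  obtains E where "orthonormal_frame (coord_metric c y) r s E"
proof -
  let ?x = "chart_inv c y"
  have x: "?x \<in> fst c" using chart_inv_in[OF c subset_refl y] by simp
  have cx: "c \<in> charts_at \<A> ?x" using x c by (simp add: charts_at_def)
  obtain e where e: "\<And>i. i \<in> {1..r + s} \<Longrightarrow> e i \<in> tangent_space \<A> ?x"
    "\<And>i j. i \<in> {1..r + s} \<Longrightarrow> j \<in> {1..r + s} \<Longrightarrow> g ?x (e i) (e j) = (if i \<noteq> j then 0 else if i \<le> r then 1 else - 1)"
    using g_frame[OF dom_topspace[OF c x]] by blast
  have "orthonormal_frame (coord_metric c y) r s (\<lambda>i. e i c)"
  proof
    show "bilinear (coord_metric c y)" "coord_metric c y v w = coord_metric c y w v" for v w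
      by (rule coord_metric_bilinear[OF c y])+
    show "coord_metric c y (e i c) (e j c) = (if i \<noteq> j then 0 else if i \<le> r then 1 else - 1)"
      if "i \<in> {1..r + s}" "j \<in> {1..r + s}" for i j
      unfolding coord_metric_def tvec_eq_lift[OF cx e(1)[OF that(1)]] tvec_eq_lift[OF cx e(1)[OF that(2)]]
      by (rule e(2)[OF that])
  qed (rule dim_source)
  then show ?thesis by (rule that)
qed

lemma coord_metric_smooth:
  assumes c: "c \<in> \<A>"
  shows "smooth_on (snd c ` fst c) (\<lambda>y. coord_metric c y v w)"
  using g_smooth[OF open_dom[OF c] smooth_field_coord[OF c, of v] smooth_field_coord[OF c, of w]] c
  unfolding smooth_fun_def coord_metric_def by force

lemma coord_endo_smooth:
  assumes c: "c \<in> \<A>"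
  shows "smooth_on (snd c ` fst c) (\<lambda>y. coord_endo c y w)"
  using smooth_fieldD(1)[OF A_smooth_field[OF open_dom[OF c] smooth_field_coord[OF c, of w]] c]
  by (simp add: coord_endo_def)

text \<open>The equation of Codazzi-Mainardi for coordinate fields; the terms \<open>A(\<nabla>\<^sub>v w)\<close> and \<open>A(\<nabla>\<^sub>w v)\<close> agree because the
connection is torsion free.\<close>

lemma coord_codazzi:
  assumes c: "c \<in> \<A>" and x: "x \<in> fst c"
  shows "dd (\<lambda>y. coord_endo c y w) (snd c x) v + christoffel c (snd c x) v (coord_endo c (snd c x) w)
    = dd (\<lambda>y. coord_endo c y v) (snd c x) w + christoffel c (snd c x) w (coord_endo c (snd c x) v)"
proof -
  have cx: "c \<in> charts_at \<A> x" using x c by (simp add: charts_at_def)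
  note f = smooth_field_coord[OF c] and op = open_dom[OF c]
  have cov: "cov_deriv_endo nabla A (\<lambda>x. lift c x v) (\<lambda>x. lift c x w) x c
     = dd (\<lambda>y. coord_endo c y w) (snd c x) v + christoffel c (snd c x) v (coord_endo c (snd c x) w)
       - coord_endo c (snd c x) (christoffel c (snd c x) v w)" for v w
  proof -
    have "nabla x (lift c x v) (\<lambda>x. A x (lift c x w)) c =
       dd (\<lambda>y. coord_endo c y w) (snd c x) v + christoffel c (snd c x) v (coord_endo c (snd c x) w)"
      using D_coord[OF op A_smooth_field[OF op f] c x x lift_in[OF cx], of v w] c x
      by (simp add: lift_self[OF cx] coord_endo_def)
    moreover have "A x (nabla x (lift c x v) (\<lambda>x. lift c x w)) c = coord_endo c (snd c x) (christoffel c (snd c x) v w)"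
      by (simp add: D_coord_field[OF c x lift_in[OF cx]] lift_self[OF cx] A_lift[OF cx])
    ultimately show ?thesis by (simp add: cov_deriv_endo_def)
  qed
  have "cov_deriv_endo nabla A (\<lambda>x. lift c x v) (\<lambda>x. lift c x w) x = cov_deriv_endo nabla A (\<lambda>x. lift c x w) (\<lambda>x. lift c x v) x"
    by (rule codazzi_eq[unfolded codazzi_mainardi_equation_def, rule_format, OF op f f x])
  from fun_cong[OF this, of c] show ?thesis
    unfolding cov using lie_bracket_coord_fields(2)[OF c x, of v w] by simp
qed

text \<open>The curvature of coordinate fields in terms of Christoffel symbols; the bracket term vanishes.\<close>

lemma coord_gauss:
  assumes c: "c \<in> \<A>" and x: "x \<in> fst c"
  shows "dd (\<lambda>y. christoffel c y w z) (snd c x) v + christoffel c (snd c x) v (christoffel c (snd c x) w z)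
        - (dd (\<lambda>y. christoffel c y v z) (snd c x) w + christoffel c (snd c x) w (christoffel c (snd c x) v z))
      = coord_metric c (snd c x) (coord_endo c (snd c x) w) z *\<^sub>R coord_endo c (snd c x) v
        - coord_metric c (snd c x) (coord_endo c (snd c x) v) z *\<^sub>R coord_endo c (snd c x) w
        + \<kappa> *\<^sub>R (coord_metric c (snd c x) w z *\<^sub>R v - coord_metric c (snd c x) v z *\<^sub>R w)"
proof -
  have cx: "c \<in> charts_at \<A> x" using x c by (simp add: charts_at_def)
  note f = smooth_field_coord[OF c] and op = open_dom[OF c]
  have D2: "nabla x (lift c x v) (\<lambda>x. nabla x (lift c x w) (\<lambda>x. lift c x z)) c
     = dd (\<lambda>y. christoffel c y w z) (snd c x) v + christoffel c (snd c x) v (christoffel c (snd c x) w z)" for v w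
    using D_coord[OF op D_smooth[OF op f f] c x x lift_in[OF cx], of v w z] c x
    by (simp add: lift_self[OF cx] D_coord_field[OF c x lift_in[OF cx]]) (simp add: christoffel_def)
  have "nabla x 0 (\<lambda>x. lift c x z) = 0"
    using D_coord_field[OF c x lift_in[OF cx, of 0], of z] bilinear_lzero[OF christoffel_bilinear[OF c, of "snd c x"]] x
    by (simp add: lift_0)
  then have "curvature \<A> nabla (\<lambda>x. lift c x v) (\<lambda>x. lift c x w) (\<lambda>x. lift c x z) x c
    = dd (\<lambda>y. christoffel c y w z) (snd c x) v + christoffel c (snd c x) v (christoffel c (snd c x) w z)
        - (dd (\<lambda>y. christoffel c y v z) (snd c x) w + christoffel c (snd c x) w (christoffel c (snd c x) v z))"
    by (simp add: curvature_def D2 lie_bracket_coord_fields(1)[OF c x])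
  moreover have "curvature \<A> nabla (\<lambda>x. lift c x v) (\<lambda>x. lift c x w) (\<lambda>x. lift c x z) x =
     tscale (g x (A x (lift c x w)) (lift c x z)) (A x (lift c x v)) - tscale (g x (A x (lift c x v)) (lift c x z)) (A x (lift c x w))
           + tscale \<kappa> (tscale (g x (lift c x w) (lift c x z)) (lift c x v) - tscale (g x (lift c x v) (lift c x z)) (lift c x w))"
    by (rule gauss_eq[unfolded gauss_equation_def, rule_format, OF op f f f x])
  ultimately show ?thesis
    using c x by (simp add: A_lift[OF cx] coord_metric_def tscale_def lift_self[OF cx])
qed

lemma gauss_codazzi_chart:
  fixes ip :: "'v::euclidean_space \<Rightarrow> 'v \<Rightarrow> real"
  assumes "nondegenerate_form ip" and c: "c \<in> \<A>"
    and dim: "DIM('v) = DIM('e) + (if \<kappa> = 0 then 1 else 2)"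
  shows "gauss_codazzi ip (snd c ` fst c) (coord_metric c) (christoffel c) (coord_endo c) \<kappa>"
proof (intro gauss_codazzi.intro[OF assms(1)] gauss_codazzi_axioms.intro)
  fix y assume y: "y \<in> snd c ` fst c"
  let ?x = "chart_inv c y"
  have x: "?x \<in> fst c" and xy: "snd c ?x = y" using chart_inv_in[OF c subset_refl y] by simp_all
  have cx: "c \<in> charts_at \<A> ?x" using x c by (simp add: charts_at_def)
  note tx = dom_topspace[OF c x] and l = lift_in[OF cx]
  show "bilinear (coord_metric c y)" "coord_metric c y v w = coord_metric c y w v" for v w
    by (rule coord_metric_bilinear[OF c y])+
  show "v = 0" if "\<And>w. coord_metric c y v w = 0" for v
  proof -
    obtain E where "orthonormal_frame (coord_metric c y) r s E" by (rule coord_frame[OF c y])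
    then show ?thesis using that by (rule orthonormal_frame.frame_nondegenerate)
  qed
  show "bilinear (christoffel c y)" by (rule christoffel_bilinear[OF c y])
  show "linear (coord_endo c y)"
    using A_tangent_linear[OF tx] l
    by (intro linearI) (simp_all add: coord_endo_def tangent_linear_def lift_add lift_scale, simp add: tscale_def)
  show "christoffel c y v w = christoffel c y w v" for v w
    using lie_bracket_coord_fields(2)[OF c x] xy by simp
  show "dd (\<lambda>y. coord_metric c y v w) y u = coord_metric c y (christoffel c y u v) w + coord_metric c y v (christoffel c y u w)" for u v w
    using metric_coord[OF c x, of v w u] smooth_on_imp_differentiable[OF coord_metric_smooth[OF c] y] xy
    by (simp add: coord_metric_def)
  show "coord_metric c y (coord_endo c y v) w = coord_metric c y v (coord_endo c y w)" for v w
    using A_selfadjoint[OF tx l[of v] l[of w]] xy by (simp add: coord_metric_def A_lift[OF cx])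
  show "dd (\<lambda>y. coord_endo c y w) y v + christoffel c y v (coord_endo c y w) = dd (\<lambda>y. coord_endo c y v) y w + christoffel c y w (coord_endo c y v)" for v w
    using coord_codazzi[OF c x] xy by simp
  show "dd (\<lambda>y. christoffel c y w z) y v + christoffel c y v (christoffel c y w z) - (dd (\<lambda>y. christoffel c y v z) y w + christoffel c y w (christoffel c y v z))
      = coord_metric c y (coord_endo c y w) z *\<^sub>R coord_endo c y v - coord_metric c y (coord_endo c y v) z *\<^sub>R coord_endo c y w
        + \<kappa> *\<^sub>R (coord_metric c y w z *\<^sub>R v - coord_metric c y v z *\<^sub>R w)" for v w z
    using coord_gauss[OF c x] xy by simp
next
  show "smooth_on (snd c ` fst c) (\<lambda>y. coord_metric c y v w)" for v w by (rule coord_metric_smooth[OF c])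
  show "smooth_on (snd c ` fst c) (\<lambda>y. coord_endo c y w)" for w by (rule coord_endo_smooth[OF c])
  show "smooth_on (snd c ` fst c) (\<lambda>y. christoffel c y v w)" for v w by (rule christoffel_smooth[OF c])
qed (rule open_img[OF c] dim)+

end

section \<open>The model spaces are quadrics\<close>

lemma model_inner_form:
  assumes "DIM('v::euclidean_space) = model_ambient_dim \<kappa> p s"
  shows "nondegenerate_form (model_inner \<kappa> p s :: 'v \<Rightarrow> 'v \<Rightarrow> real)"
    and "subspace W \<Longrightarrow> (\<And>x. x \<in> W \<Longrightarrow> model_inner \<kappa> p s x x \<le> 0) \<Longrightarrow> dim (W :: 'v set) \<le> (if \<kappa> < 0 then s + 1 else s)"
proof -
  define P S where "P = (if \<kappa> > 0 then p + 1 else p)" and "S = (if \<kappa> < 0 then s + 1 else s)"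
  have eq: "(model_inner \<kappa> p s :: 'v \<Rightarrow> 'v \<Rightarrow> real) = pseudo_inner P S" by (auto simp: model_inner_def P_def S_def)
  have dim: "DIM('v) = P + S" using assms by (auto simp: model_ambient_dim_def P_def S_def)
  show "nondegenerate_form (model_inner \<kappa> p s :: 'v \<Rightarrow> 'v \<Rightarrow> real)"
    unfolding eq by (rule pseudo_inner_nondegenerate[OF dim])
  show "subspace W \<Longrightarrow> (\<And>x. x \<in> W \<Longrightarrow> model_inner \<kappa> p s x x \<le> 0) \<Longrightarrow> dim W \<le> (if \<kappa> < 0 then s + 1 else s)"
    unfolding eq S_def[symmetric] by (rule pseudo_inner_inertia[OF dim])
qed

text \<open>Since \<open>r + 1 > 0\<close>, the only model spaces that are defined by an additional inequality are those with \<open>\<kappa> < 0\<close> and \<open>s = 0\<close>.\<close>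

lemma model_quadric:
  fixes D :: "('v::euclidean_space, 'h::euclidean_space) connection"
  assumes dim: "DIM('v) = model_ambient_dim \<kappa> (r + 1) s" "DIM('h) = r + 1 + s"
    and lc: "levi_civita_connection (model_top \<kappa> (r + 1) s) (model_atlas \<kappa> (r + 1) s) (model_metric \<kappa> (r + 1) s) D"
  shows "quadric (model_inner \<kappa> (r + 1) s) \<kappa> (model_space \<kappa> (r + 1) s) (model_atlas \<kappa> (r + 1) s) D"
proof (intro quadric.intro[OF model_inner_form(1)[OF dim(1)]] quadric_axioms.intro)
  show "model_inner \<kappa> (r + 1) s x x = 1 / \<kappa>" if "\<kappa> \<noteq> 0" "x \<in> model_space \<kappa> (r + 1) s" for x :: 'v
    using that by (auto simp: model_space_def split: if_splits)
  show "\<exists>T. open T \<and> q \<in> T \<and> (\<forall>x\<in>T. (\<kappa> \<noteq> 0 \<longrightarrow> model_inner \<kappa> (r + 1) s x x = 1 / \<kappa>) \<longrightarrow> x \<in> model_space \<kappa> (r + 1) s)"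
    if q: "q \<in> model_space \<kappa> (r + 1) s" for q :: 'v
  proof (cases "\<kappa> < 0 \<and> s = 0")
    case True
    let ?c = "coord (r + 1 + s + 1) :: 'v \<Rightarrow> real"
    have "continuous_on UNIV ?c"
      by (rule linear_continuous_on[OF coord_bounded_linear])
    then have "open {x. ?c x > 0}" by (intro open_Collect_less continuous_on_const)
    then show ?thesis
      using q True by (intro exI[of _ "{x. ?c x > 0}"]) (auto simp: model_space_def)
  next
    case False
    then show ?thesis by (intro exI[of _ UNIV]) (auto simp: model_space_def)
  qed
  show "DIM('v) = DIM('h) + (if \<kappa> = 0 then 0 else 1)" using dim by (simp add: model_ambient_dim_def)
  have "model_metric \<kappa> (r + 1) s = (\<lambda>q (v :: ('v, 'h) tvec) w. model_inner \<kappa> (r + 1) s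
     (dir_deriv (model_atlas \<kappa> (r + 1) s) q v (\<lambda>x. x)) (dir_deriv (model_atlas \<kappa> (r + 1) s) q w (\<lambda>x. x)))"
    by (intro ext) (simp add: model_metric_def)
  then show "levi_civita_connection (model_top \<kappa> (r + 1) s) (model_atlas \<kappa> (r + 1) s) (\<lambda>q (v :: ('v, 'h) tvec) w. model_inner \<kappa> (r + 1) s
     (dir_deriv (model_atlas \<kappa> (r + 1) s) q v (\<lambda>x. x)) (dir_deriv (model_atlas \<kappa> (r + 1) s) q w (\<lambda>x. x))) D"
    using lc by simp
qed simp

section \<open>Hypersurfaces with prescribed Weingarten map\<close>

locale hypersurface_setting = source: source_manifold M \<A> g nabla A \<kappa> r s + quadric_map M \<A> ip \<kappa> S \<B> D
  for M :: "'a topology" and \<A> :: "('a, 'e::euclidean_space) chart set"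
    and g :: "('a, 'e) metric" and nabla :: "('a, 'e) connection"
    and A :: "'a \<Rightarrow> ('a, 'e) tvec \<Rightarrow> ('a, 'e) tvec" and \<kappa> :: real and r s :: nat
    and ip :: "'v::euclidean_space \<Rightarrow> 'v \<Rightarrow> real" and S
    and \<B> :: "('v, 'h::euclidean_space) chart set" and D +
  assumes codim: "DIM('h) = DIM('e) + 1"
    and inertia: "\<And>W. subspace W \<Longrightarrow> (\<And>x. x \<in> W \<Longrightarrow> ip x x \<le> 0) \<Longrightarrow> dim W \<le> (if \<kappa> < 0 then s + 1 else s)"
begin

abbreviation quadric_metric :: "('v, 'h) metric" where
  "quadric_metric \<equiv> \<lambda>q v w. ip (tgt.iota q v) (tgt.iota q w)"

abbreviation hypersurface :: "'a set \<Rightarrow> ('a \<Rightarrow> 'v) \<Rightarrow> ('a \<Rightarrow> ('v, 'h) tvec) \<Rightarrow> bool" where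
  "hypersurface \<equiv> hypersurface_with_weingarten_map M \<A> g (top_of_set S) \<B> quadric_metric D A"

lemma dim_v_e: "DIM('v) = DIM('e) + (if \<kappa> = 0 then 1 else 2)"
  using tgt.dim_v codim by simp

lemma coords: "c \<in> \<A> \<Longrightarrow> gauss_codazzi ip (snd c ` fst c) (source.coord_metric c) (source.christoffel c) (source.coord_endo c) \<kappa>"
  by (rule source.gauss_codazzi_chart[OF tgt.nondegenerate_form_axioms _ dim_v_e])

text \<open>At a point without charts the only tangent vector is \<open>0\<close>, whereas \<open>F\<close> is injective on a nontrivial vector space.\<close>

lemma target_chart_exists:
  assumes c: "c \<in> charts_at \<A> p" and F: "inj_on F (tangent_space \<A> p)" "\<And>v. v \<in> tangent_space \<A> p \<Longrightarrow> F v \<in> tangent_space \<B> q"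
  obtains d where "d \<in> charts_at \<B> q"
proof -
  have "charts_at \<B> q \<noteq> {}"
  proof
    assume e: "charts_at \<B> q = {}"
    have z: "v = 0" if "v \<in> tangent_space \<B> q" for v
      using that e by (auto simp: tangent_space_def fun_eq_iff)
    obtain w :: 'e where w: "w \<in> Basis" using nonempty_Basis by blast
    have "F (source.lift c p w) = F (source.lift c p 0)"
      using z[OF F(2)[OF source.lift_in[OF c]]] by metis
    then have "source.lift c p w = source.lift c p 0"
      using inj_onD[OF F(1) _ source.lift_in[OF c] source.lift_in[OF c]] by blast
    then have "w = 0" using source.lift_self[OF c, of w] source.lift_self[OF c, of 0] by simp
    then show False using w nonzero_Basis by blast
  qed
  then show ?thesis using that by blast
qed

text \<open>The Weingarten condition, formulated with an extension of the normal field and the connection of the quadric, is a statement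
about the derivative of the vector-valued function \<open>n\<close>, as soon as that derivative is tangent to the quadric.\<close>

lemma weingarten_iff:
  assumes c: "c \<in> charts_at \<A> x" and d: "d \<in> charts_at \<B> (f x)"
    and T: "open T" "snd c x \<in> T" and F: "smooth_on T (\<lambda>y. f (chart_inv c y))" "(\<lambda>y. f (chart_inv c y)) ` T \<subseteq> S"
    and V: "openin (top_of_set S) V" "smooth_field \<B> V E" "f x \<in> V"
    and n: "\<And>y. y \<in> T \<Longrightarrow> f (chart_inv c y) \<in> V \<Longrightarrow> n y = tgt.iota (f (chart_inv c y)) (E (f (chart_inv c y)))"
    and u: "u \<in> tangent_space \<A> x" and v: "v \<in> tangent_space \<A> x"
    and dn: "dd n (snd c x) (v c) \<in> tgt.tangent_plane (f x)"
  shows "differential \<A> \<B> f x u = - D (f x) (differential \<A> \<B> f x v) E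
     \<longleftrightarrow> dd n (snd c x) (v c) = - dd (\<lambda>y. f (chart_inv c y)) (snd c x) (u c)"
proof -
  note diff = differential_in_iota[OF c d T F]
  let ?X = "D (f x) (differential \<A> \<B> f x v) E"
  have X: "?X \<in> tangent_space \<B> (f x)" by (rule tgt.D_in[OF V diff(1)[OF v]])
  have fS: "f x \<in> S" using F(2) T(2) source.charts_atD[OF c] by force
  have "tgt.iota (f x) ?X - dd n (snd c x) (v c) = 0"
  proof (rule tgt.tangent_plane_nondegenerate[OF fS])
    show "tgt.iota (f x) ?X - dd n (snd c x) (v c) \<in> tgt.tangent_plane (f x)"
      by (intro subspace_diff tgt.tangent_plane_subspace tgt.iota_in[OF d X] dn)
    show "ip (tgt.iota (f x) ?X - dd n (snd c x) (v c)) b = 0" if "b \<in> tgt.tangent_plane (f x)" for b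
      using covariant_derivative_along(2)[OF c d T F V n v that] by (simp add: tgt.ip_simps)
  qed
  then have iX: "tgt.iota (f x) ?X = dd n (snd c x) (v c)" by simp
  have "differential \<A> \<B> f x u = - ?X \<longleftrightarrow> tgt.iota (f x) (differential \<A> \<B> f x u) = tgt.iota (f x) (- ?X)"
    by (rule iffI, erule arg_cong, erule tgt.iota_inj[OF d diff(1)[OF u] tgt.tangent_space_uminus[OF d X]])
  also have "\<dots> \<longleftrightarrow> dd (\<lambda>y. f (chart_inv c y)) (snd c x) (u c) = - dd n (snd c x) (v c)"
    by (simp add: diff(2)[OF u] tgt.iota_linear_simps(3)[OF d X X] iX)
  finally show ?thesis by (metis minus_equation_iff)
qed

subsection \<open>From hypersurfaces to coordinate data\<close>

text \<open>The derivative of the normal is tangent to the quadric because the normal is orthogonal to the position vector.\<close>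

lemma hypersurface_immersion_data:
  assumes H: "hypersurface U f \<nu>" and U: "openin M U" and c: "c \<in> \<A>" and d: "d \<in> \<B>"
  defines "T \<equiv> snd c ` {x \<in> U \<inter> fst c. f x \<in> fst d}"
  shows "gauss_codazzi.immersion_data ip (snd c ` fst c) (source.coord_metric c) (source.coord_endo c) \<kappa> T
     (\<lambda>y. f (chart_inv c y)) (\<lambda>y. tgt.iota (f (chart_inv c y)) (\<nu> (chart_inv c y)))"
proof -
  interpret gc: gauss_codazzi ip "snd c ` fst c" "source.coord_metric c" "source.christoffel c" "source.coord_endo c" \<kappa>
    by (rule coords[OF c])
  note h = H[unfolded hypersurface_with_weingarten_map_def]
  have emb: "smooth_embedding M \<A> (top_of_set S) \<B> U f" using h by blast
  then have cont: "continuous_map (subtopology M U) (top_of_set S) f"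
    and sm: "smooth_on T (\<lambda>y. snd d (f (chart_inv c y)))"
    using c d by (auto simp: smooth_embedding_def smooth_map_def T_def)
  have iso: "\<And>x. x \<in> U \<Longrightarrow> linear_isometric_embedding \<A> g x \<B> quadric_metric (f x) (differential \<A> \<B> f x)"
    using h by blast
  have nu: "\<nu> x \<in> tangent_space \<B> (f x)" "ip (tgt.iota (f x) (\<nu> x)) (tgt.iota (f x) (\<nu> x)) = 1"
    "\<And>v. v \<in> tangent_space \<A> x \<Longrightarrow> ip (tgt.iota (f x) (\<nu> x)) (tgt.iota (f x) (differential \<A> \<B> f x v)) = 0"
    if "x \<in> U" for x using h that by blast+
  have ext: "\<exists>V E. f x \<in> V \<and> extends_along (top_of_set S) \<B> U f \<nu> V E" if "x \<in> U" for x
    using h that by blast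
  have wein: "differential \<A> \<B> f x (A x v) = - D (f x) (differential \<A> \<B> f x v) E"
    if "x \<in> U" "f x \<in> V" "extends_along (top_of_set S) \<B> U f \<nu> V E" "v \<in> tangent_space \<A> x" for x V E v
    using h that by blast
  let ?F = "\<lambda>y. f (chart_inv c y)" and ?n = "\<lambda>y. tgt.iota (f (chart_inv c y)) (\<nu> (chart_inv c y))"
  have opT: "open T"
  proof -
    have "openin (subtopology M U) {x \<in> topspace (subtopology M U). f x \<in> fst d}"
      by (rule openin_continuous_map_preimage[OF cont tgt.open_dom[OF d]])
    then have "openin M {x \<in> topspace (subtopology M U). f x \<in> fst d}"
      using U openin_trans_full by blast
    moreover have "T = snd c ` ({x \<in> topspace (subtopology M U). f x \<in> fst d} \<inter> fst c)"
      using openin_subset[OF U] by (auto simp: T_def)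
    ultimately show ?thesis using source.chart_image_open[OF c] by simp
  qed
  have Tsub: "T \<subseteq> snd c ` fst c" by (auto simp: T_def)
  have FS: "?F ` T \<subseteq> fst d" using c by (auto simp: T_def)
  have F: "smooth_on T ?F"
    by (rule smooth_on_cong[OF opT smooth_on_compose[OF opT sm tgt.param_smooth[OF d]]]) (use FS d in auto)
  have FS': "?F ` T \<subseteq> S" using FS tgt.dom_subset[OF d] by blast
  have pt: "chart_inv c y \<in> U" "c \<in> charts_at \<A> (chart_inv c y)" "d \<in> charts_at \<B> (?F y)" "snd c (chart_inv c y) = y"
    if "y \<in> T" for y using that c d by (auto simp: T_def charts_at_def)
  have dF: "dd ?F y v = tgt.iota (?F y) (differential \<A> \<B> f (chart_inv c y) (source.lift c (chart_inv c y) v))" if "y \<in> T" for y v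
    using differential_in_iota(2)[OF pt(2,3)[OF that] opT _ F FS' source.lift_in[OF pt(2)[OF that]]] pt[OF that] that
    by (simp add: source.lift_self)
  show ?thesis
    unfolding gc.immersion_data_def
  proof (intro conjI ballI allI impI)
    fix y assume y: "y \<in> T"
    let ?x = "chart_inv c y"
    note p = pt[OF y]
    have l: "source.lift c ?x v \<in> tangent_space \<A> ?x" for v by (rule source.lift_in[OF p(2)])
    have FyS: "?F y \<in> S" using FS' y by blast
    show "ip (dd ?F y v) (dd ?F y w) = source.coord_metric c y v w" for v w
      using iso[OF p(1)] l by (simp add: dF[OF y] linear_isometric_embedding_def source.coord_metric_def)
    show "ip (?n y) (?n y) = 1" by (rule nu(2)[OF p(1)])
    show nF: "ip (?n y) (dd ?F y v) = 0" for v unfolding dF[OF y] by (rule nu(3)[OF p(1) l])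
    show "ip (?F y) (?F y) = 1 / \<kappa>" if "\<kappa> \<noteq> 0" by (rule tgt.quadric_eq[OF that FyS])
    have nT: "?n y \<in> tgt.tangent_plane (?F y)" if "y \<in> T" for y
      by (rule tgt.iota_in[OF pt(3)[OF that] nu(1)[OF pt(1)[OF that]]])
    then have nf: "ip (?n y) (?F y) = 0" if "\<kappa> \<noteq> 0" "y \<in> T" for y
      using that unfolding tgt.tangent_plane_def by blast
    show "ip (?F y) (?n y) = 0" if "\<kappa> \<noteq> 0" using nf[OF that y] tgt.ip_sym by metis
    obtain V E where V: "?F y \<in> V" "extends_along (top_of_set S) \<B> U f \<nu> V E" using ext[OF p(1)] by blast
    then have V': "openin (top_of_set S) V" "smooth_field \<B> V E" "\<And>x. x \<in> U \<Longrightarrow> f x \<in> V \<Longrightarrow> E (f x) = \<nu> x"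
      by (auto simp: extends_along_def)
    have n: "?n z = tgt.iota (?F z) (E (?F z))" if "z \<in> T" "?F z \<in> V" for z
      using V'(3)[OF pt(1)[OF that(1)] that(2)] by simp
    have yT: "snd c ?x \<in> T" using y p(4) by simp
    show nd: "?n differentiable (at y)"
      using covariant_derivative_along(1)[OF p(2,3) opT yT F FS' V'(1,2) V(1) n] p(4) by simp
    show "dd ?n y v = - dd ?F y (source.coord_endo c y v)" for v
    proof -
      have tx: "?x \<in> topspace M" using openin_subset[OF U] p(1) by blast
      have "dd ?n y v \<in> tgt.tangent_plane (?F y)"
        unfolding tgt.tangent_plane_def
      proof (rule CollectI, rule impI)
        assume \<kappa>: "\<kappa> \<noteq> 0"
        have "((\<lambda>y. 0) has_derivative (\<lambda>v. ip (?n y) (dd ?F y v) + ip (dd ?n y v) (?F y))) (at y)"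
          by (rule has_derivative_transform_within_open[OF tgt.ip_has_derivative[OF dd_works[OF nd] smooth_on_has_derivative[OF F y]] opT y])
             (rule nf[OF \<kappa>])
        then have "(\<lambda>v. ip (?n y) (dd ?F y v) + ip (dd ?n y v) (?F y)) = (\<lambda>v. 0)"
          using has_derivative_const has_derivative_unique by blast
        then have "ip (?n y) (dd ?F y v) + ip (dd ?n y v) (?F y) = 0" by (rule fun_cong)
        then show "ip (dd ?n y v) (?F y) = 0" using nF[of v] by simp
      qed
      then have "dd ?n (snd c ?x) (source.lift c ?x v c) \<in> tgt.tangent_plane (f ?x)"
        using p by (simp add: source.lift_self)
      from iffD1[OF weingarten_iff[OF p(2,3) opT yT F FS' V'(1,2) V(1) n source.A_in[OF tx l[of v]] l[of v] this]
          wein[OF p(1) V l[of v]]]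
      show ?thesis
        using p by (simp add: source.lift_self source.coord_endo_def)
    qed
  qed (use opT Tsub F in auto)
qed

theorem hypersurface_unique:
  assumes U1: "openin M U1" "p \<in> U1" and H1: "hypersurface U1 f1 \<nu>1"
    and U2: "openin M U2" "p \<in> U2" and H2: "hypersurface U2 f2 \<nu>2" and c: "c \<in> charts_at \<A> p"
    and init: "f1 p = f2 p" "\<And>v. v \<in> tangent_space \<A> p \<Longrightarrow> differential \<A> \<B> f1 p v = differential \<A> \<B> f2 p v" "\<nu>1 p = \<nu>2 p"
  shows "\<exists>V. openin M V \<and> p \<in> V \<and> V \<subseteq> U1 \<inter> U2 \<and> (\<forall>x\<in>V. f1 x = f2 x)"
proof -
  note cc = source.charts_atD[OF c]
  have "linear_isometric_embedding \<A> g p \<B> quadric_metric (f1 p) (differential \<A> \<B> f1 p)"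
    using H1 U1(2) unfolding hypersurface_with_weingarten_map_def by blast
  then obtain d where d: "d \<in> charts_at \<B> (f1 p)"
    using target_chart_exists[OF c, of "differential \<A> \<B> f1 p" "f1 p"]
    unfolding linear_isometric_embedding_def tangent_linear_def by blast
  note cd = tgt.charts_atD[OF d]
  interpret gc: gauss_codazzi ip "snd c ` fst c" "source.coord_metric c" "source.christoffel c" "source.coord_endo c" \<kappa>
    by (rule coords[OF cc(1)])
  let ?T = "\<lambda>U f. snd c ` {x \<in> U \<inter> fst c. f x \<in> fst d}"
  let ?F = "\<lambda>f y. f (chart_inv c y)" and ?n = "\<lambda>f \<nu> y. tgt.iota (f (chart_inv c y)) (\<nu> (chart_inv c y))"
  note I1 = hypersurface_immersion_data[OF H1 U1(1) cc(1) cd(1)]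
  note I2 = hypersurface_immersion_data[OF H2 U2(1) cc(1) cd(1)]
  have y0: "snd c p \<in> ?T U1 f1" "snd c p \<in> ?T U2 f2" using U1 U2 cc cd init by auto
  have dF: "dd (?F f) (snd c p) v = tgt.iota (f p) (differential \<A> \<B> f p (source.lift c p v))"
    if I: "gc.immersion_data (?T U f) (?F f) (?n f \<nu>)" and y0: "snd c p \<in> ?T U f" and fp: "f p = f1 p" for U f \<nu> v
  proof -
    have sub: "?F f ` ?T U f \<subseteq> S" using tgt.dom_subset[OF cd(1)] cc by auto
    have dp: "d \<in> charts_at \<B> (f p)" using d fp by simp
    have "open (?T U f)" "smooth_on (?T U f) (?F f)" using I by (auto simp: gc.immersion_data_def)
    then show ?thesis
      using differential_in_iota(2)[OF c dp _ y0 _ sub source.lift_in[OF c, of v]] by (simp add: source.lift_self[OF c])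
  qed
  obtain \<delta> where \<delta>: "\<delta> > 0" "ball (snd c p) \<delta> \<subseteq> ?T U1 f1 \<inter> ?T U2 f2"
    "\<And>y. y \<in> ball (snd c p) \<delta> \<Longrightarrow> ?F f1 y = ?F f2 y"
  proof (rule gc.immersion_data_unique[OF I1 I2 y0])
    show "?F f1 (snd c p) = ?F f2 (snd c p)" using init cc by simp
    show "dd (?F f1) (snd c p) v = dd (?F f2) (snd c p) v" for v
      using dF[OF I1 y0(1)] dF[OF I2 y0(2)] init(1) init(2)[OF source.lift_in[OF c]] by simp
    show "?n f1 \<nu>1 (snd c p) = ?n f2 \<nu>2 (snd c p)" using init cc by simp
  qed blast
  let ?V = "{x \<in> fst c. snd c x \<in> ball (snd c p) \<delta>}"
  have "openin M ?V" by (rule source.chart_preimage_open[OF cc(1) open_ball])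
  moreover have "p \<in> ?V" using cc \<delta>(1) by simp
  moreover have "?V \<subseteq> U1 \<inter> U2"
  proof
    fix x assume x: "x \<in> ?V"
    then have "snd c x \<in> ?T U1 f1" "snd c x \<in> ?T U2 f2" using \<delta>(2) by blast+
    then show "x \<in> U1 \<inter> U2" using x inj_onD[OF source.inj_chart[OF cc(1)]] by blast
  qed
  moreover have "f1 x = f2 x" if "x \<in> ?V" for x
    using \<delta>(3)[of "snd c x"] that cc by simp
  ultimately show ?thesis by blast
qed

subsection \<open>From coordinate data to hypersurfaces\<close>

text \<open>The field \<open>n \<circ> \<rho> \<circ> L\<close> extends the normal field to a neighbourhood, but is tangent to the quadric only along the hypersurface; the
component in the direction of the position vector is removed.  Its components in the chart solve a linear equation with injective
coefficients, hence are smooth.\<close>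

lemma retract_extension:
  assumes d: "d \<in> \<B>" and V: "open V" and L: "bounded_linear L" and \<rho>: "smooth_on V \<rho>" "\<rho> ` V \<subseteq> W" and W: "open W"
    and n: "smooth_on W n"
  obtains E where "smooth_field \<B> {z \<in> fst d. L z \<in> V} E" "openin (top_of_set S) {z \<in> fst d. L z \<in> V}"
    "\<And>z. z \<in> fst d \<Longrightarrow> L z \<in> V \<Longrightarrow> n (\<rho> (L z)) \<in> tgt.tangent_plane z \<Longrightarrow> tgt.iota z (E z) = n (\<rho> (L z))"
proof -
  let ?V = "{z \<in> fst d. L z \<in> V}" and ?\<phi> = "chart_inv d"
  have op: "openin (top_of_set S) ?V"
  proof -
    have "open (L -` V)" by (rule open_vimage[OF V linear_continuous_on[OF L]])
    then have "openin (top_of_set S) (fst d \<inter> (L -` V))"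
      using tgt.open_dom[OF d] openin_Int_open by blast
    moreover have "fst d \<inter> (L -` V) = ?V" by auto
    ultimately show ?thesis by simp
  qed
  let ?T = "snd d ` ?V"
  have opT: "open ?T" using tgt.chart_image_open[OF d op] by (simp add: Int_absorb2 subset_eq)
  have T: "?T \<subseteq> snd d ` fst d" by auto
  have LV: "L (?\<phi> u) \<in> V" "?\<phi> u \<in> fst d" "snd d (?\<phi> u) = u" if "u \<in> ?T" for u using that d by auto
  define N where "N z = n (\<rho> (L z)) - (\<kappa> * ip (n (\<rho> (L z))) z) *\<^sub>R z" for z
  have NT: "N z \<in> tgt.tangent_plane z" if "z \<in> fst d" for z
  proof -
    have "z \<in> S" using tgt.dom_subset[OF d] that by blast
    then show ?thesis using tgt.quadric_eq[of z] unfolding tgt.tangent_plane_def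
      by (auto simp: N_def tgt.ip_simps)
  qed
  have \<phi>: "smooth_on ?T ?\<phi>" by (rule smooth_on_subset[OF tgt.param_smooth[OF d] T])
  have sn: "smooth_on ?T (\<lambda>u. n (\<rho> (L (?\<phi> u))))"
  proof (rule smooth_on_compose[OF opT _ n])
    show "smooth_on ?T (\<lambda>u. \<rho> (L (?\<phi> u)))"
      by (rule smooth_on_compose[OF opT smooth_on_linear[OF L opT \<phi>] \<rho>(1)]) (use LV in auto)
    show "(\<lambda>u. \<rho> (L (?\<phi> u))) ` ?T \<subseteq> W" using LV \<rho>(2) by blast
  qed
  have "smooth_on ?T (\<lambda>u. n (\<rho> (L (?\<phi> u))) + (- \<kappa>) *\<^sub>R (ip (n (\<rho> (L (?\<phi> u)))) (?\<phi> u) *\<^sub>R ?\<phi> u))"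
    by (intro smooth_on_add opT sn smooth_on_linear[OF bounded_linear_scaleR_right] smooth_on_bilinear[OF bounded_bilinear_scaleR]
        tgt.smooth_on_ip \<phi>)
  then have sN: "smooth_on ?T (\<lambda>u. N (?\<phi> u))" by (simp add: N_def)
  define k where "k u = (SOME w. dd ?\<phi> u w = N (?\<phi> u))" for u
  have k: "dd ?\<phi> u (k u) = N (?\<phi> u)" if "u \<in> ?T" for u
  proof -
    have "\<exists>w. dd ?\<phi> u w = N (?\<phi> u)"
      using NT[OF LV(2)[OF that]] tgt.range_param[OF d LV(2)[OF that]] LV(3)[OF that] by (metis rangeE)
    then show ?thesis unfolding k_def by (rule someI_ex)
  qed
  have "smooth_on ?T k"
    by (rule smooth_on_linear_solution[where P = "dd ?\<phi>" and q = "\<lambda>u. N (?\<phi> u)", OF opT])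
       (use tgt.param_linear[OF d] tgt.param_inj[OF d] T smooth_on_subset[OF smooth_on_dd[OF tgt.param_smooth[OF d]] T] sN k in auto)
  then have sf: "smooth_field \<B> ?V (\<lambda>z. tgt.lift d z (k (snd d z)))"
    by (intro tgt.smooth_field_lift[OF d op]) auto
  have "tgt.iota z (tgt.lift d z (k (snd d z))) = n (\<rho> (L z))"
    if z: "z \<in> fst d" "L z \<in> V" "n (\<rho> (L z)) \<in> tgt.tangent_plane z" for z
  proof -
    have dz: "d \<in> charts_at \<B> z" using d z by (simp add: charts_at_def)
    have "snd d z \<in> ?T" using z by auto
    then have "tgt.iota z (tgt.lift d z (k (snd d z))) = N z"
      using k d z by (simp add: tgt.iota_lift[OF dz])
    also have "\<dots> = n (\<rho> (L z))"
    proof -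
      have "\<kappa> * ip (n (\<rho> (L z))) z = 0" using z(3) unfolding tgt.tangent_plane_def by auto
      then show ?thesis by (simp add: N_def)
    qed
    finally show ?thesis .
  qed
  then show ?thesis using that[OF sf op] by blast
qed

text \<open>The immersion data in a chart at \<open>p\<close> are restricted to a neighbourhood on which the map takes values in a chart of the model
space and has a smooth retraction.  The retraction makes the map an embedding and provides the extension of the normal field.\<close>

theorem hypersurface_exists:
  assumes c: "c \<in> charts_at \<A> p" and q: "q \<in> S"
    and F: "linear_isometric_embedding \<A> g p \<B> quadric_metric q F"
  shows "\<exists>U f \<nu>. openin M U \<and> p \<in> U \<and> hypersurface U f \<nu> \<and> f p = q \<and>
     (\<forall>v\<in>tangent_space \<A> p. differential \<A> \<B> f p v = F v)"
proof -
  note cc = source.charts_atD[OF c]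
  have F_in: "\<And>v. v \<in> tangent_space \<A> p \<Longrightarrow> F v \<in> tangent_space \<B> q"
    and F_add: "\<And>u v. u \<in> tangent_space \<A> p \<Longrightarrow> v \<in> tangent_space \<A> p \<Longrightarrow> F (u + v) = F u + F v"
    and F_scale: "\<And>a u. u \<in> tangent_space \<A> p \<Longrightarrow> F (tscale a u) = tscale a (F u)"
    and F_inj: "inj_on F (tangent_space \<A> p)"
    and F_iso: "\<And>u v. u \<in> tangent_space \<A> p \<Longrightarrow> v \<in> tangent_space \<A> p \<Longrightarrow> ip (tgt.iota q (F u)) (tgt.iota q (F v)) = g p u v"
    using F unfolding linear_isometric_embedding_def tangent_linear_def by blast+
  obtain d where d: "d \<in> charts_at \<B> q" using target_chart_exists[OF c F_inj F_in] by blast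
  note cd = tgt.charts_atD[OF d]
  interpret gc: gauss_codazzi ip "snd c ` fst c" "source.coord_metric c" "source.christoffel c" "source.coord_endo c" \<kappa>
    by (rule coords[OF cc(1)])
  let ?y0 = "snd c p"
  have y0: "?y0 \<in> snd c ` fst c" using cc by simp
  define F0 where "F0 w = tgt.iota q (F (source.lift c p w))" for w
  note l = source.lift_in[OF c]
  have F0: "linear F0"
    by (rule linearI)
       (simp_all add: F0_def source.lift_add source.lift_scale F_add[OF l l] F_scale[OF l] tgt.iota_linear_simps[OF d F_in[OF l] F_in[OF l]])
  have F0_iso: "ip (F0 v) (F0 w) = source.coord_metric c ?y0 v w" for v w
    using F_iso[OF l l] cc by (simp add: F0_def source.coord_metric_def)
  have F0_T: "F0 v \<in> tgt.tangent_plane q" for v unfolding F0_def by (rule tgt.iota_in[OF d F_in[OF l]])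
  have qq: "ip q q = 1 / \<kappa> \<and> (\<forall>v. ip q (F0 v) = 0)" if "\<kappa> \<noteq> 0"
    using tgt.quadric_eq[OF that q] F0_T that tgt.ip_sym[of q "F0 _"] by (simp add: tgt.tangent_plane_def)
  obtain e where fr: "orthonormal_frame (source.coord_metric c ?y0) r s e" by (rule source.coord_frame[OF cc(1) y0])
  obtain n0 where n0: "ip n0 n0 = 1" "\<And>v. ip n0 (F0 v) = 0" "\<kappa> \<noteq> 0 \<Longrightarrow> ip q n0 = 0"
    by (rule tgt.unit_normal_exists[OF fr F0 F0_iso dim_v_e qq inertia]) blast+
  obtain \<delta> \<Phi> n where \<delta>: "\<delta> > 0" and I: "gc.immersion_data (ball ?y0 \<delta>) \<Phi> n" and ns: "smooth_on (ball ?y0 \<delta>) n"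
    and init: "\<Phi> ?y0 = q" "\<And>v. dd \<Phi> ?y0 v = F0 v" "n ?y0 = n0"
    by (rule gc.immersion_data_exists[OF y0 F0 F0_iso n0(1,2), of q]) (use qq n0(3) in blast)+
  let ?B = "ball ?y0 \<delta>"
  note i = I[unfolded gc.immersion_data_def]
  have \<Phi>: "smooth_on ?B \<Phi>" and B: "?B \<subseteq> snd c ` fst c" using i by blast+
  have iso: "ip (dd \<Phi> y v) (dd \<Phi> y w) = source.coord_metric c y v w" and nn: "ip (n y) (n y) = 1"
    and nd: "ip (n y) (dd \<Phi> y v) = 0" and dn: "dd n y v = - dd \<Phi> y (source.coord_endo c y v)"
    if "y \<in> ?B" for y v w using i that by blast+
  have \<Phi>\<Phi>: "ip (\<Phi> y) (\<Phi> y) = 1 / \<kappa>" "ip (\<Phi> y) (n y) = 0" if "\<kappa> \<noteq> 0" "y \<in> ?B" for y using i that by blast+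
  have dd_inj: "inj (dd \<Phi> y)" if y: "y \<in> ?B" for y
  proof -
    have lin: "linear (dd \<Phi> y)" by (rule linear_frechet_derivative[OF smooth_on_imp_differentiable[OF \<Phi> y]])
    show ?thesis
      unfolding linear_injective_0[OF lin]
    proof (intro allI impI)
      fix v assume "dd \<Phi> y v = 0"
      then have "source.coord_metric c y v w = 0" for w using iso[OF y, of v w] by (simp add: tgt.ip_simps)
      then show "v = 0" using gc.G_nondeg B y by blast
    qed
  qed
  obtain T0 where T0: "open T0" "q \<in> T0" "\<And>x. x \<in> T0 \<Longrightarrow> (\<kappa> \<noteq> 0 \<longrightarrow> ip x x = 1 / \<kappa>) \<Longrightarrow> x \<in> S"
    using tgt.quadric_local[OF q] by blast
  obtain W where W: "open W" "fst d = S \<inter> W" using tgt.open_dom[OF cd(1)] by (auto simp: openin_open)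
  \<comment> \<open>Values in \<open>T0\<close> lie on the quadric, hence in \<open>S\<close>; values that are also in \<open>W\<close> lie in the chart \<open>d\<close>.\<close>
  let ?T = "?B \<inter> \<Phi> -` (T0 \<inter> W)"
  have T: "open ?T" "?y0 \<in> ?T"
    using continuous_open_preimage[OF smooth_on_imp_continuous[OF \<Phi>] open_ball open_Int[OF T0(1) W(1)]] \<delta> init T0(2) W(2) cd(2) by auto
  have Td: "\<Phi> y \<in> fst d" if "y \<in> ?T" for y
    using that T0(3)[of "\<Phi> y"] \<Phi>\<Phi>(1)[of y] W(2) by auto
  have \<Phi>T: "smooth_on ?T \<Phi>" by (rule smooth_on_subset[OF \<Phi>]) blast
  have yB: "?y0 \<in> ?B" using \<delta> by simp
  obtain U' V and L :: "'v \<Rightarrow> 'e" and \<rho> where U': "open U'" "U' \<subseteq> ?T" "?y0 \<in> U'" and L: "bounded_linear L" and V: "open V" "smooth_on V \<rho>"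
    and ret: "\<And>y. y \<in> U' \<Longrightarrow> L (\<Phi> y) \<in> V \<and> \<rho> (L (\<Phi> y)) = y" and \<rho>V: "\<rho> ` V \<subseteq> U'"
    by (rule immersion_local_retraction[OF T \<Phi>T dd_inj[OF yB]]) blast
  have U'B: "U' \<subseteq> ?B" using U'(2) by blast
  have U'd: "\<Phi> y \<in> fst d" if "y \<in> U'" for y using Td U'(2) that by blast
  obtain E where E: "smooth_field \<B> {z \<in> fst d. L z \<in> V} E" "openin (top_of_set S) {z \<in> fst d. L z \<in> V}"
    "\<And>z. z \<in> fst d \<Longrightarrow> L z \<in> V \<Longrightarrow> n (\<rho> (L z)) \<in> tgt.tangent_plane z \<Longrightarrow> tgt.iota z (E z) = n (\<rho> (L z))"
    by (rule retract_extension[OF cd(1) V(1) L V(2) \<rho>V U'(1) smooth_on_subset[OF ns U'B]]) blast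
  let ?W = "{z \<in> fst d. L z \<in> V}"
  define U where "U = {x \<in> fst c. snd c x \<in> U'}"
  define f where "f = \<Phi> \<circ> snd c"
  define \<nu> where "\<nu> x = E (f x)" for x
  have U: "openin M U" unfolding U_def by (rule source.chart_preimage_open[OF cc(1) U'(1)])
  have pU: "p \<in> U" using cc U'(3) by (simp add: U_def)
  have Ux: "c \<in> charts_at \<A> x" "snd c x \<in> U'" "x \<in> fst c" "x \<in> topspace M" if "x \<in> U" for x
    using that cc openin_subset[OF U] by (auto simp: U_def charts_at_def)
  have cU: "snd c ` U = U'" using U'B B by (auto simp: U_def)
  have fx: "f x \<in> fst d" "d \<in> charts_at \<B> (f x)" "f x \<in> ?W" if "x \<in> U" for x
    using U'd[OF Ux(2)[OF that]] ret[OF Ux(2)[OF that]] cd by (auto simp: f_def charts_at_def)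
  have fS: "f ` U \<subseteq> S" using fx(1) tgt.dom_subset[OF cd(1)] by blast
  have fc: "f (chart_inv c y) = \<Phi> y" if "y \<in> U'" for y
    using that U'B B cc by (force simp: f_def)
  have fsm: "smooth_on U' (\<lambda>y. f (chart_inv c y))"
    by (rule smooth_on_cong[OF U'(1) smooth_on_subset[OF \<Phi> U'B]]) (simp add: fc)
  have fS': "(\<lambda>y. f (chart_inv c y)) ` U' \<subseteq> S" using fc U'd tgt.dom_subset[OF cd(1)] by force
  have ddf: "dd (\<lambda>y. f (chart_inv c y)) y = dd \<Phi> y" if "y \<in> U'" for y
  proof (rule dd_eqI)
    show "((\<lambda>y. f (chart_inv c y)) has_derivative dd \<Phi> y) (at y)"
      by (rule has_derivative_transform_within_open[OF smooth_on_has_derivative[OF \<Phi>] U'(1) that]) (use that U'B fc in auto)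
  qed
  have diff: "differential \<A> \<B> f x v \<in> tangent_space \<B> (f x)"
    "tgt.iota (f x) (differential \<A> \<B> f x v) = dd \<Phi> (snd c x) (v c)"
    if "x \<in> U" "v \<in> tangent_space \<A> x" for x v
    using differential_in_iota[OF Ux(1)[OF that(1)] fx(2)[OF that(1)] U'(1) Ux(2)[OF that(1)] fsm fS' that(2)] ddf[OF Ux(2)[OF that(1)]]
    by simp_all
  have nT: "n (snd c x) \<in> tgt.tangent_plane (f x)" if "x \<in> U" for x
    using \<Phi>\<Phi>(2)[of "snd c x"] U'B Ux(2)[OF that] tgt.ip_sym[of "n (snd c x)" "\<Phi> (snd c x)"] unfolding tgt.tangent_plane_def f_def by auto
  have \<nu>: "\<nu> x \<in> tangent_space \<B> (f x)" "tgt.iota (f x) (\<nu> x) = n (snd c x)" if "x \<in> U" for x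
  proof -
    show "\<nu> x \<in> tangent_space \<B> (f x)" unfolding \<nu>_def by (rule tgt.smooth_fieldD(2)[OF E(1) fx(3)[OF that]])
    have "\<rho> (L (f x)) = snd c x" "L (f x) \<in> V" using ret[OF Ux(2)[OF that]] by (auto simp: f_def)
    then show "tgt.iota (f x) (\<nu> x) = n (snd c x)"
      unfolding \<nu>_def using E(3)[OF fx(1)[OF that]] nT[OF that] by simp
  qed
  have lie: "linear_isometric_embedding \<A> g x \<B> quadric_metric (f x) (differential \<A> \<B> f x)" if x: "x \<in> U" for x
    unfolding linear_isometric_embedding_def tangent_linear_def
  proof (intro conjI ballI allI)
    note cx = Ux(1)[OF x] and dx = fx(2)[OF x] and df = diff[OF x]
    have yB: "snd c x \<in> ?B" using Ux(2)[OF x] U'B by blast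
    have lin: "linear (dd \<Phi> (snd c x))" by (rule linear_frechet_derivative[OF smooth_on_imp_differentiable[OF \<Phi> yB]])
    show "differential \<A> \<B> f x u \<in> tangent_space \<B> (f x)" if "u \<in> tangent_space \<A> x" for u by (rule df(1)[OF that])
    show "differential \<A> \<B> f x (u + v) = differential \<A> \<B> f x u + differential \<A> \<B> f x v"
      if u: "u \<in> tangent_space \<A> x" and v: "v \<in> tangent_space \<A> x" for u v
    proof (rule tgt.iota_inj[OF dx df(1)[OF source.tangent_space_add[OF cx u v]] tgt.tangent_space_add[OF dx df(1)[OF u] df(1)[OF v]]])
      show "tgt.iota (f x) (differential \<A> \<B> f x (u + v)) = tgt.iota (f x) (differential \<A> \<B> f x u + differential \<A> \<B> f x v)"
        unfolding tgt.iota_linear_simps(1)[OF dx df(1)[OF u] df(1)[OF v]] df(2)[OF u] df(2)[OF v]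
          df(2)[OF source.tangent_space_add[OF cx u v]] by (simp add: linear_add[OF lin])
    qed
    show "differential \<A> \<B> f x (tscale a u) = tscale a (differential \<A> \<B> f x u)" if u: "u \<in> tangent_space \<A> x" for a u
    proof -
      have s: "tscale a u \<in> tangent_space \<A> x"
        using source.lift_in[OF cx, of "a *\<^sub>R u c"] by (simp add: source.lift_scale source.tvec_eq_lift[OF cx u])
      have s': "tscale a (differential \<A> \<B> f x u) \<in> tangent_space \<B> (f x)"
        using tgt.lift_in[OF dx, of "a *\<^sub>R differential \<A> \<B> f x u d"] by (simp add: tgt.lift_scale tgt.tvec_eq_lift[OF dx df(1)[OF u]])
      show ?thesis
      proof (rule tgt.iota_inj[OF dx df(1)[OF s] s'])
        show "tgt.iota (f x) (differential \<A> \<B> f x (tscale a u)) = tgt.iota (f x) (tscale a (differential \<A> \<B> f x u))"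
          unfolding tgt.iota_linear_simps(4)[OF dx df(1)[OF u] df(1)[OF u]] df(2)[OF u] df(2)[OF s]
          by (simp add: tscale_def linear_scale[OF lin])
      qed
    qed
    show "inj_on (differential \<A> \<B> f x) (tangent_space \<A> x)"
    proof (rule inj_onI)
      fix u v assume u: "u \<in> tangent_space \<A> x" and v: "v \<in> tangent_space \<A> x"
        and eq: "differential \<A> \<B> f x u = differential \<A> \<B> f x v"
      have "dd \<Phi> (snd c x) (u c) = dd \<Phi> (snd c x) (v c)" using df(2)[OF u] df(2)[OF v] eq by simp
      then show "u = v" by (intro source.tvec_eqI[OF cx u v] injD[OF dd_inj[OF yB]])
    qed
    show "ip (tgt.iota (f x) (differential \<A> \<B> f x u)) (tgt.iota (f x) (differential \<A> \<B> f x v)) = g x u v"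
      if u: "u \<in> tangent_space \<A> x" and v: "v \<in> tangent_space \<A> x" for u v
      unfolding df(2)[OF u] df(2)[OF v] iso[OF yB] source.coord_metric_def
      using cc(1) Ux(3)[OF x] by (simp add: source.tvec_eq_lift[OF cx u] source.tvec_eq_lift[OF cx v])
  qed
  have fT: "f ` topspace (subtopology M U) = \<Phi> ` U'"
  proof -
    have "topspace (subtopology M U) = U" using openin_subset[OF U] by auto
    then show ?thesis using cU by (auto simp: f_def image_comp)
  qed
  have emb: "embedding_map (subtopology M U) (top_of_set S) f"
  proof -
    have "homeomorphic_map (subtopology (subtopology M (fst c)) U) (subtopology (top_of_set (snd c ` fst c)) U') (snd c)"
      by (rule homeomorphic_map_subtopologies[OF source.homeo[OF cc(1)]])
         (use source.topspace_dom[OF cc(1)] in \<open>auto simp: U_def\<close>)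
    moreover have "fst c \<inter> U = U" "snd c ` fst c \<inter> U' = U'" using U'B B by (auto simp: U_def)
    ultimately have 1: "homeomorphic_map (subtopology M U) (top_of_set U') (snd c)"
      by (simp add: subtopology_subtopology)
    have "homeomorphic_maps (top_of_set U') (top_of_set (\<Phi> ` U')) \<Phi> (\<lambda>z. \<rho> (L z))"
      unfolding homeomorphic_maps_def
    proof (intro conjI ballI)
      have "continuous_on U' \<Phi>" by (rule continuous_on_subset[OF smooth_on_imp_continuous[OF \<Phi>] U'B])
      then show "continuous_map (top_of_set U') (top_of_set (\<Phi> ` U')) \<Phi>" by auto
      have "continuous_on (\<Phi> ` U') (\<lambda>z. \<rho> (L z))"
        by (rule continuous_on_compose2[OF smooth_on_imp_continuous[OF V(2)] linear_continuous_on[OF L]]) (use ret in auto)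
      then show "continuous_map (top_of_set (\<Phi> ` U')) (top_of_set U') (\<lambda>z. \<rho> (L z))" using ret by auto
    qed (use ret in auto)
    then have "homeomorphic_map (top_of_set U') (top_of_set (\<Phi> ` U')) \<Phi>" by (rule homeomorphic_maps_imp_map)
    with 1 have "homeomorphic_map (subtopology M U) (top_of_set (\<Phi> ` U')) f"
      unfolding f_def by (rule homeomorphic_map_compose)
    moreover have "\<Phi> ` U' \<subseteq> S" using U'd tgt.dom_subset[OF cd(1)] by blast
    ultimately show ?thesis
      unfolding embedding_map_def fT by (simp add: subtopology_subtopology Int_absorb1)
  qed
  then have cont: "continuous_map (subtopology M U) (top_of_set S) f" 
    unfolding embedding_map_def
    by (intro continuous_map_into_fulltopology[OF homeomorphic_imp_continuous_map])
  have smap: "smooth_map M \<A> (top_of_set S) \<B> U f"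
    unfolding smooth_map_def
  proof (intro conjI ballI cont)
    fix c' d' assume c': "c' \<in> \<A>" and d': "d' \<in> \<B>"
    let ?K = "{x \<in> U \<inter> fst c'. f x \<in> fst d'}"
    let ?T = "snd c' ` ?K"
    have "openin (subtopology M U) {x \<in> topspace (subtopology M U). f x \<in> fst d'}"
      by (rule openin_continuous_map_preimage[OF cont tgt.open_dom[OF d']])
    then have "openin M {x \<in> topspace (subtopology M U). f x \<in> fst d'}"
      using U openin_trans_full by blast
    moreover have "?K = {x \<in> topspace (subtopology M U). f x \<in> fst d'} \<inter> fst c'"
      using openin_subset[OF U] by auto
    ultimately have op: "open ?T" using source.chart_image_open[OF c'] by simp
    have inv: "chart_inv c' y \<in> ?K" if "y \<in> ?T" for y
      using that c' by auto
    have "smooth_on ?T (\<lambda>y. \<Phi> (snd c (chart_inv c' y)))"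
    proof (rule smooth_on_compose[OF op _ smooth_on_subset[OF \<Phi> U'B]])
      show "smooth_on ?T (\<lambda>y. snd c (chart_inv c' y))"
        by (rule smooth_on_subset[OF source.smooth_transition[OF c' cc(1)]]) (use Ux(3) in auto)
      show "(\<lambda>y. snd c (chart_inv c' y)) ` ?T \<subseteq> U'" using inv Ux(2) by blast
    qed
    then have "smooth_on ?T (\<lambda>y. f (chart_inv c' y))" by (simp add: f_def)
    then show "smooth_on ?T (\<lambda>y. snd d' (f (chart_inv c' y)))"
      by (rule submanifold_smooth_lift[OF d'[unfolded tgt.atlas] op]) (use inv in blast)
  qed
  have wein: "differential \<A> \<B> f x (A x v) = - D (f x) (differential \<A> \<B> f x v) E'"
    if x: "x \<in> U" and V': "f x \<in> V'" and ext: "extends_along (top_of_set S) \<B> U f \<nu> V' E'" and v: "v \<in> tangent_space \<A> x" for x V' E' v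
  proof -
    have e: "openin (top_of_set S) V'" "smooth_field \<B> V' E'" "\<And>x. x \<in> U \<Longrightarrow> f x \<in> V' \<Longrightarrow> E' (f x) = \<nu> x"
      using ext by (auto simp: extends_along_def)
    note cx = Ux(1)[OF x]
    have yB: "snd c x \<in> ?B" using Ux(2)[OF x] U'B by blast
    have n: "n y = tgt.iota (f (chart_inv c y)) (E' (f (chart_inv c y)))" if y: "y \<in> U'" "f (chart_inv c y) \<in> V'" for y
    proof -
      obtain x' where x': "x' \<in> U" "y = snd c x'" using y(1) cU by blast
      then have "chart_inv c y = x'" using cc(1) Ux(3) by simp
      then show ?thesis using e(3)[OF x'(1)] \<nu>(2)[OF x'(1)] x' y(2) by simp
    qed
    have Av: "A x v \<in> tangent_space \<A> x" by (rule source.A_in[OF Ux(4)[OF x] v])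
    have Avc: "A x v c = source.coord_endo c (snd c x) (v c)"
      using cc(1) Ux(3)[OF x] by (simp add: source.coord_endo_def source.tvec_eq_lift[OF cx v])
    have "dd n (snd c x) (v c) = - dd \<Phi> (snd c x) (A x v c)" unfolding Avc by (rule dn[OF yB])
    then have eq: "dd n (snd c x) (v c) = - dd (\<lambda>y. f (chart_inv c y)) (snd c x) (A x v c)"
      by (simp add: ddf[OF Ux(2)[OF x]])
    have "dd \<Phi> (snd c x) (A x v c) \<in> tgt.tangent_plane (f x)"
      using tgt.iota_in[OF fx(2)[OF x] diff(1)[OF x Av]] diff(2)[OF x Av] by simp
    then have "dd n (snd c x) (v c) \<in> tgt.tangent_plane (f x)"
      unfolding Avc dn[OF yB] by (rule subspace_neg[OF tgt.tangent_plane_subspace])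
    from weingarten_iff[OF cx fx(2)[OF x] U'(1) Ux(2)[OF x] fsm fS' e(1,2) V' n Av v this] eq
    show ?thesis by simp
  qed
  have "hypersurface U f \<nu>"
    unfolding hypersurface_with_weingarten_map_def smooth_embedding_def
  proof (intro conjI ballI allI impI)
    fix x assume x: "x \<in> U"
    have yB: "snd c x \<in> ?B" using Ux(2)[OF x] U'B by blast
    show "inj_on (differential \<A> \<B> f x) (tangent_space \<A> x)" using lie[OF x] by (simp add: linear_isometric_embedding_def)
    show "\<nu> x \<in> tangent_space \<B> (f x)" by (rule \<nu>(1)[OF x])
    show "ip (tgt.iota (f x) (\<nu> x)) (tgt.iota (f x) (\<nu> x)) = 1" unfolding \<nu>(2)[OF x] by (rule nn[OF yB])
    show "ip (tgt.iota (f x) (\<nu> x)) (tgt.iota (f x) (differential \<A> \<B> f x v)) = 0" if "v \<in> tangent_space \<A> x" for v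
      unfolding \<nu>(2)[OF x] diff(2)[OF x that] by (rule nd[OF yB])
    show "\<exists>V E. f x \<in> V \<and> extends_along (top_of_set S) \<B> U f \<nu> V E"
      by (intro exI[of _ ?W] exI[of _ E] conjI fx(3)[OF x]) (simp add: extends_along_def E(1,2) \<nu>_def)
  qed (rule codim | rule smap | rule emb | (rule lie, assumption) | (rule wein; assumption))+
  moreover have fp: "f p = q" using init by (simp add: f_def)
  moreover have "differential \<A> \<B> f p v = F v" if v: "v \<in> tangent_space \<A> p" for v
  proof (rule tgt.iota_inj[of d "f p"])
    show "tgt.iota (f p) (differential \<A> \<B> f p v) = tgt.iota (f p) (F v)"
      unfolding diff(2)[OF pU v] init F0_def by (simp add: source.tvec_eq_lift[OF c v] fp)
  qed (use fx(2)[OF pU] diff(1)[OF pU v] F_in[OF v] fp in auto)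
  ultimately show ?thesis using U pU by blast
qed

end

theorem corollary7p4:
  fixes M :: "'a topology" and \<A> :: "('a, 'e::euclidean_space) chart set"
    and g :: "('a, 'e) metric" and nabla_M :: "('a, 'e) connection"
    and A :: "'a \<Rightarrow> ('a, 'e) tvec \<Rightarrow> ('a, 'e) tvec"
    and \<kappa> :: real and r s :: nat
    and N :: "'v::euclidean_space topology" and \<B> :: "('v, 'h::euclidean_space) chart set"
    and h :: "('v, 'h) metric" and nabla_N :: "('v, 'h) connection"
  assumes "smooth_manifold M \<A>"
    and "semi_riemannian_metric M \<A> r s g"
    and "levi_civita_connection M \<A> g nabla_M"
    and "symmetric_endomorphism_field M \<A> g A"
    and "codazzi_mainardi_equation M \<A> nabla_M A"
    and "gauss_equation M \<A> g nabla_M \<kappa> A"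
    and "DIM('v) = model_ambient_dim \<kappa> (r + 1) s" and "DIM('h) = r + 1 + s"
    and "N = model_top \<kappa> (r + 1) s" and "\<B> = model_atlas \<kappa> (r + 1) s"
    and "h = model_metric \<kappa> (r + 1) s"
    and "levi_civita_connection N \<B> h nabla_N"
  shows "(\<forall>p\<in>topspace M. \<forall>q\<in>topspace N. \<forall>F. linear_isometric_embedding \<A> g p \<B> h q F \<longrightarrow>
            (\<exists>U f \<nu>. openin M U \<and> p \<in> U \<and>
               hypersurface_with_weingarten_map M \<A> g N \<B> h nabla_N A U f \<nu> \<and>
               f p = q \<and> (\<forall>v\<in>tangent_space \<A> p. differential \<A> \<B> f p v = F v)))
       \<and> (\<forall>p\<in>topspace M. \<forall>U\<^sub>1 f\<^sub>1 \<nu>\<^sub>1 U\<^sub>2 f\<^sub>2 \<nu>\<^sub>2.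
            openin M U\<^sub>1 \<longrightarrow> p \<in> U\<^sub>1 \<longrightarrow>
            hypersurface_with_weingarten_map M \<A> g N \<B> h nabla_N A U\<^sub>1 f\<^sub>1 \<nu>\<^sub>1 \<longrightarrow>
            openin M U\<^sub>2 \<longrightarrow> p \<in> U\<^sub>2 \<longrightarrow>
            hypersurface_with_weingarten_map M \<A> g N \<B> h nabla_N A U\<^sub>2 f\<^sub>2 \<nu>\<^sub>2 \<longrightarrow>
            f\<^sub>1 p = f\<^sub>2 p \<longrightarrow>
            (\<forall>v\<in>tangent_space \<A> p. differential \<A> \<B> f\<^sub>1 p v = differential \<A> \<B> f\<^sub>2 p v) \<longrightarrow>
            \<nu>\<^sub>1 p = \<nu>\<^sub>2 p \<longrightarrow>
            (\<exists>V. openin M V \<and> p \<in> V \<and> V \<subseteq> U\<^sub>1 \<inter> U\<^sub>2 \<and> (\<forall>x\<in>V. f\<^sub>1 x = f\<^sub>2 x)))"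
proof -
  have atlas: "charted_space M \<A>"
    by unfold_locales (use assms(1) in \<open>auto simp: smooth_manifold_def\<close>)
  have source: "source_manifold M \<A> g nabla_M A \<kappa> r s"
    by (intro source_manifold.intro levi_civita_charts.intro levi_civita_charts_axioms.intro
        source_manifold_axioms.intro atlas assms(2-6))
  have target: "quadric (model_inner \<kappa> (r + 1) s) \<kappa> (model_space \<kappa> (r + 1) s) \<B> nabla_N"
    using model_quadric[OF assms(7,8)] assms(9-12) by simp
  have codim: "DIM('h) = DIM('e) + 1"
    using assms(8) source_manifold.dim_source[OF source] by simp
  interpret hypersurface_setting M \<A> g nabla_M A \<kappa> r s "model_inner \<kappa> (r + 1) s" "model_space \<kappa> (r + 1) s" \<B> nabla_N
    by (intro hypersurface_setting.intro source quadric_map.intro atlas target hypersurface_setting_axioms.intro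
        codim model_inner_form(2)[OF assms(7)])
  have h: "h = quadric_metric"
    unfolding assms(11) assms(10) by (intro ext) (simp add: model_metric_def)
  have chart: "\<exists>c. c \<in> charts_at \<A> p" if "p \<in> topspace M" for p
    using that assms(1) by (auto simp: smooth_manifold_def charts_at_def)
  show ?thesis
  proof (intro conjI ballI allI impI)
    fix p q F
    assume p: "p \<in> topspace M" and q: "q \<in> topspace N" and F: "linear_isometric_embedding \<A> g p \<B> h q F"
    obtain c where c: "c \<in> charts_at \<A> p" using chart[OF p] by blast
    have "q \<in> model_space \<kappa> (r + 1) s" using q assms(9) by simp
    from hypersurface_exists[OF c this F[unfolded h]]
    show "\<exists>U f \<nu>. openin M U \<and> p \<in> U \<and> hypersurface_with_weingarten_map M \<A> g N \<B> h nabla_N A U f \<nu> \<and>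
        f p = q \<and> (\<forall>v\<in>tangent_space \<A> p. differential \<A> \<B> f p v = F v)"
      unfolding h assms(9) .
  next
    fix p U\<^sub>1 f\<^sub>1 \<nu>\<^sub>1 U\<^sub>2 f\<^sub>2 \<nu>\<^sub>2
    assume p: "p \<in> topspace M"
      and U1: "openin M U\<^sub>1" "p \<in> U\<^sub>1" and H1: "hypersurface_with_weingarten_map M \<A> g N \<B> h nabla_N A U\<^sub>1 f\<^sub>1 \<nu>\<^sub>1"
      and U2: "openin M U\<^sub>2" "p \<in> U\<^sub>2" and H2: "hypersurface_with_weingarten_map M \<A> g N \<B> h nabla_N A U\<^sub>2 f\<^sub>2 \<nu>\<^sub>2"
      and init: "f\<^sub>1 p = f\<^sub>2 p" "\<forall>v\<in>tangent_space \<A> p. differential \<A> \<B> f\<^sub>1 p v = differential \<A> \<B> f\<^sub>2 p v" "\<nu>\<^sub>1 p = \<nu>\<^sub>2 p"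
    obtain c where c: "c \<in> charts_at \<A> p" using chart[OF p] by blast
    show "\<exists>V. openin M V \<and> p \<in> V \<and> V \<subseteq> U\<^sub>1 \<inter> U\<^sub>2 \<and> (\<forall>x\<in>V. f\<^sub>1 x = f\<^sub>2 x)"
      by (rule hypersurface_unique[OF U1 H1[unfolded h assms(9)] U2 H2[unfolded h assms(9)] c init(1) _ init(3)])
         (use init(2) in blast)
  qed
qed

end
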